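(* There is an algorithm which, given as input $\langle G,T,u,v\rangle$, where $G$ is a directed graph on $n$ vertices, $T$ is a binary balanced tree decomposition of $G$ having depth $h$ and treewidth $w$, and $u,v\in V(G)$, decides whether there is a directed path from $u$ to $v$ in $G$, using $O(wh+\log n)$ space and polynomial time.
   Context: For tree decompositions, edge directions are ignored. A tree decomposition of $G$ is a tree $T$ with bags $B(t)\subseteq V(G)$ such that every vertex is in some bag, every edge has both endpoints in some bag, and if $t_3$ lies on the path from $t_1$ to $t_2$ then $B(t_1)\cap B(t_2)\subseteq B(t_3)$; treewidth is $\max_t(|B(t)|-1)$. A binary balanced tree decomposition is one whose tree is a rooted balanced binary tree. Space is measured as work space with read-only input. *)

theory Defs
  imports
    Complex_Main
    "HOL-Library.Tree"
    "HOL-Computational_Algebra.Polynomial"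
    "Graph_Theory.Pair_Digraph"
begin

section \<open>Binary tree decompositions\<close>

text \<open>
  The underlying tree is a value of type \<open>'v set tree\<close>: every \<^const>\<open>Node\<close> carries its bag, and
  \<^const>\<open>Leaf\<close> is the empty tree, so a node has at most two children.  Nodes are addressed by
  the path leading to them from the root (\<^const>\<open>False\<close> for left, \<^const>\<open>True\<close> for right).
\<close>

fun nodes :: "'a tree \<Rightarrow> bool list set" where
  "nodes \<langle>\<rangle> = {}"
| "nodes \<langle>l, B, r\<rangle> = insert [] (Cons False ` nodes l \<union> Cons True ` nodes r)"

fun bag :: "'v set tree \<Rightarrow> bool list \<Rightarrow> 'v set" where
  "bag \<langle>\<rangle> t = {}"
| "bag \<langle>l, B, r\<rangle> [] = B"
| "bag \<langle>l, B, r\<rangle> (b # t) = bag (if b then r else l) t"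

definition tree_graph :: "'a tree \<Rightarrow> bool list pair_pre_digraph" where
  "tree_graph T = \<lparr>pverts = nodes T,
     parcs = {(s, t). s \<in> nodes T \<and> t \<in> nodes T \<and> (\<exists>b. t = s @ [b] \<or> s = t @ [b])}\<rparr>"

definition on_tree_path :: "'a tree \<Rightarrow> bool list \<Rightarrow> bool list \<Rightarrow> bool list \<Rightarrow> bool" where
  "on_tree_path T t1 t2 t3 \<longleftrightarrow>
     (\<exists>p. pre_digraph.apath (with_proj (tree_graph T)) t1 p t2 \<and>
          t3 \<in> set (pre_digraph.awalk_verts (with_proj (tree_graph T)) t1 p))"

definition tree_decomposition :: "'v pair_pre_digraph \<Rightarrow> 'v set tree \<Rightarrow> bool" where
  "tree_decomposition G T \<longleftrightarrow>
     (\<forall>t\<in>nodes T. bag T t \<subseteq> pverts G) \<and>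
     (\<forall>x\<in>pverts G. \<exists>t\<in>nodes T. x \<in> bag T t) \<and>
     (\<forall>(x, y)\<in>parcs G. \<exists>t\<in>nodes T. x \<in> bag T t \<and> y \<in> bag T t) \<and>
     (\<forall>t1\<in>nodes T. \<forall>t2\<in>nodes T. \<forall>t3\<in>nodes T.
        on_tree_path T t1 t2 t3 \<longrightarrow> bag T t1 \<inter> bag T t2 \<subseteq> bag T t3)"

text \<open>
  The truncated subtraction is harmless: a decomposition of a nonempty graph has a nonempty bag.
\<close>

definition treewidth :: "'v set tree \<Rightarrow> nat" where
  "treewidth T = Max ((\<lambda>t. card (bag T t) - 1) ` nodes T)"

text \<open>
  The depth of \<open>T\<close> is \<^term>\<open>height T\<close>, which counts levels: a one-node tree has depth 1.
  (Counting edges instead, a one-bag decomposition would have depth 0, and a bound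
  \<open>O(wh + log n)\<close> would put directed reachability in logarithmic space.)

  Balanced means that the depth is logarithmic in the number of nodes; the constant \<open>c\<close> is a
  parameter.  Trees satisfying \<^const>\<open>complete\<close> or \<^const>\<open>acomplete\<close>, AVL trees and red-black trees
  are all balanced in this sense for some fixed \<open>c\<close>.
\<close>

definition balanced :: "real \<Rightarrow> 'a tree \<Rightarrow> bool" where
  "balanced c T \<longleftrightarrow> real (height T) \<le> c * log 2 (real (size1 T))"


section \<open>Turing machines with a read-only input tape\<close>

text \<open>
  Deterministic machines with a two-way read-only input tape, delimited by end markers which
  the head cannot cross, and a fixed number of one-way infinite read-write work tapes.
  States and work symbols are natural numbers; the work symbol 0 is the blank.
\<close>

datatype 'a cell = LeftEnd | Sym 'a | RightEnd

datatype move = MoveLeft | Stay | MoveRight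

record 'a machine =
  ntapes :: nat
  states :: "nat set"
  work_symbols :: "nat set"
  start :: nat
  accept :: nat
  reject :: nat
  delta :: "nat \<Rightarrow> 'a cell \<Rightarrow> nat list \<Rightarrow> nat \<times> move \<times> (nat \<times> move) list"

definition wf_machine :: "'a machine \<Rightarrow> bool" where
  "wf_machine M \<longleftrightarrow>
     finite (states M) \<and> finite (work_symbols M) \<and> 0 \<in> work_symbols M \<and>
     {start M, accept M, reject M} \<subseteq> states M \<and> accept M \<noteq> reject M \<and>
     (\<forall>q\<in>states M. \<forall>a ss q' d acts.
        length ss = ntapes M \<and> set ss \<subseteq> work_symbols M \<and> delta M q a ss = (q', d, acts) \<longrightarrow>
        q' \<in> states M \<and> length acts = ntapes M \<and> fst ` set acts \<subseteq> work_symbols M)"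

text \<open>A work tape is given by its head position and its contents.\<close>

record config =
  state :: nat
  input_pos :: nat
  works :: "(nat \<times> (nat \<Rightarrow> nat)) list"

fun shift :: "move \<Rightarrow> nat \<Rightarrow> nat" where
  "shift MoveLeft p = p - 1"
| "shift Stay p = p"
| "shift MoveRight p = p + 1"

definition input_cell :: "'a list \<Rightarrow> nat \<Rightarrow> 'a cell" where
  "input_cell x p =
     (if p = 0 then LeftEnd else if p \<le> length x then Sym (x ! (p - 1)) else RightEnd)"

definition initial :: "'a machine \<Rightarrow> config" where
  "initial M = \<lparr>state = start M, input_pos = 0, works = replicate (ntapes M) (0, \<lambda>_. 0)\<rparr>"

definition halted :: "'a machine \<Rightarrow> config \<Rightarrow> bool" where
  "halted M c \<longleftrightarrow> state c = accept M \<or> state c = reject M"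

definition step :: "'a machine \<Rightarrow> 'a list \<Rightarrow> config \<Rightarrow> config" where
  "step M x c =
     (if halted M c then c
      else case delta M (state c) (input_cell x (input_pos c)) (map (\<lambda>(p, f). f p) (works c)) of
        (q, d, acts) \<Rightarrow>
          \<lparr>state = q,
           input_pos = min (length x + 1) (shift d (input_pos c)),
           works = map2 (\<lambda>(p, f) (a, e). (shift e p, f(p := a))) (works c) acts\<rparr>)"

definition run :: "'a machine \<Rightarrow> 'a list \<Rightarrow> nat \<Rightarrow> config" where
  "run M x t = (step M x ^^ t) (initial M)"

text \<open>Work space is the number of work tape cells visited.\<close>

definition work_space :: "'a machine \<Rightarrow> 'a list \<Rightarrow> nat \<Rightarrow> nat" where
  "work_space M x t = card {(i, fst (works (run M x t') ! i)) | i t'. i < ntapes M \<and> t' \<le> t}"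

definition decides_within :: "'a machine \<Rightarrow> 'a list \<Rightarrow> bool \<Rightarrow> nat \<Rightarrow> real \<Rightarrow> bool" where
  "decides_within M x answer time space \<longleftrightarrow>
     (\<exists>t\<le>time. halted M (run M x t) \<and> (state (run M x t) = accept M \<longleftrightarrow> answer) \<and>
               real (work_space M x t) \<le> space)"


section \<open>Encoding of the input\<close>

text \<open>
  The vertices of an \<open>n\<close>-vertex graph are \<open>0, ..., n - 1\<close>.  A vertex set is written as its
  characteristic bit vector of length \<open>n\<close>, a vertex as the vector of its singleton, the graph
  as the rows of its adjacency matrix, and the tree in preorder.
\<close>

datatype symbol = Zero | One | Sep

definition encode_set :: "nat \<Rightarrow> nat set \<Rightarrow> symbol list" where
  "encode_set n S = map (\<lambda>i. if i \<in> S then One else Zero) [0..<n] @ [Sep]"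

definition encode_graph :: "nat \<Rightarrow> nat pair_pre_digraph \<Rightarrow> symbol list" where
  "encode_graph n G = concat (map (\<lambda>i. encode_set n {j. (i, j) \<in> parcs G}) [0..<n])"

fun encode_tree :: "nat \<Rightarrow> nat set tree \<Rightarrow> symbol list" where
  "encode_tree n \<langle>\<rangle> = [Zero]"
| "encode_tree n \<langle>l, B, r\<rangle> = One # encode_set n B @ encode_tree n l @ encode_tree n r"

definition encode :: "nat \<Rightarrow> nat pair_pre_digraph \<Rightarrow> nat set tree \<Rightarrow> nat \<Rightarrow> nat \<Rightarrow> symbol list" where
  "encode n G T u v =
     encode_graph n G @ encode_tree n T @ encode_set n {u} @ encode_set n {v}"

end

theory Submission
  imports Defs
begin

text \<open>
  Put \<open>u\<close> and \<open>v\<close> into every bag.  A call on a subtree \<open>t\<close> with parameter \<open>k\<close> extends a set of marked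
  vertices of the root bag of \<open>t\<close> by all vertices of that bag reachable from it by walks of length
  at most \<open>2 ^ k\<close> inside \<open>t\<close>: it calls itself on \<open>t\<close> with \<open>k - 1\<close>, follows the edges inside the bag,
  calls itself on the two children with \<open>k\<close>, and calls itself on \<open>t\<close> with \<open>k - 1\<close> again.  The recursion
  has depth \<open>h + log n\<close> and \<open>O(4 ^ (h + log n))\<close> calls, which is polynomial as the tree is balanced.
  A stack frame needs only a constant number of bits, because the node, its position in the input and
  the place of its marks can be recomputed from the frames below, and one bit per vertex of a bag for
  each node on the current branch stores the marks.

  The counters take \<open>O(log n + h)\<close> bits.  The second term is absorbed by \<open>w h\<close> except for \<open>w = 0\<close>;
  then the graph has only loops, which is checked beforehand by counters below \<open>n\<close>.
\<close>

section \<open>Structured tape programs and their compilation\<close>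

text \<open>A position or a vertex in every stack frame would cost about
  \<open>(h + log n) * log n\<close> cells. This is why a frame shrinks to one symbol and each round
  recomputes the current node from the whole stack, paying with time only. For the same reason marks
  are indexed by rank inside the bag: one bit per vertex of the graph would cost \<open>n\<close>
  cells per level. Having \<open>u\<close> and \<open>v\<close> in every bag puts both ends of the
  wanted walk into the root bag, and cannot break connectivity. A child call keeps the full length
  bound because the tree has become smaller; only the parts of the walk before and after the stay in
  a child are halved, and those are handled at the same node. Correctness splits in two: marks never
  leave a given edge-closed set (soundness), and a call catches all short walks (completeness).
  Resources are carried by weakest preconditions, from register programs through tape programs to
  the machine. One bound \<open>B\<close> on the rounds of all loops is enough for polynomial time,
  since the nesting depth is fixed by the program text.\<close>

datatype pcond = PIn "symbol cell set" | PSym nat "nat set"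

datatype prog =
    PSkip
  | PMvIn move
  | PWr nat nat
  | PMv nat move
  | PSeq prog prog
  | PIf pcond prog prog
  | PWhile pcond prog

type_synonym tapes = "nat \<Rightarrow> nat \<times> (nat \<Rightarrow> nat)"
type_synonym pred0 = "nat \<Rightarrow> tapes \<Rightarrow> bool"

definition sym :: "nat \<times> (nat \<Rightarrow> nat) \<Rightarrow> nat" where
  "sym = (\<lambda>(p, f). f p)"

fun ptest :: "symbol list \<Rightarrow> pcond \<Rightarrow> nat \<Rightarrow> tapes \<Rightarrow> bool" where
  "ptest x (PIn S) i W \<longleftrightarrow> input_cell x i \<in> S"
| "ptest x (PSym r S) i W \<longleftrightarrow> sym (W r) \<in> S"

text \<open>The index is the number of rounds still allowed. When it is used up the test has to
  fail, so the predicate includes termination.\<close>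

primrec while0 :: "(pred0 \<Rightarrow> pred0) \<Rightarrow> pred0 \<Rightarrow> pred0 \<Rightarrow> nat \<Rightarrow> pred0" where
  "while0 F b Q 0 = (\<lambda>i W. \<not> b i W \<and> Q i W)"
| "while0 F b Q (Suc k) = (\<lambda>i W. if b i W then F (while0 F b Q k) i W else Q i W)"

text \<open>
  \<open>wp0 x A B p Q\<close>: the program \<open>p\<close> terminates in a state satisfying \<open>Q\<close>, the head of tape \<open>r\<close>
  never moves beyond cell \<open>A r\<close>, and every execution of a loop takes at most \<open>B\<close> rounds.
\<close>

primrec wp0 :: "symbol list \<Rightarrow> (nat \<Rightarrow> nat) \<Rightarrow> nat \<Rightarrow> prog \<Rightarrow> pred0 \<Rightarrow> pred0" where
  "wp0 x A B PSkip = (\<lambda>Q. Q)"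
| "wp0 x A B (PMvIn d) = (\<lambda>Q i W. Q (min (length x + 1) (shift d i)) W)"
| "wp0 x A B (PWr r a) = (\<lambda>Q i W. Q i (W(r := (fst (W r), (snd (W r))(fst (W r) := a)))))"
| "wp0 x A B (PMv r d) = (\<lambda>Q i W. shift d (fst (W r)) \<le> A r \<and>
     Q i (W(r := (shift d (fst (W r)), snd (W r)))))"
| "wp0 x A B (PSeq p q) = (\<lambda>Q. wp0 x A B p (wp0 x A B q Q))"
| "wp0 x A B (PIf b p q) = (\<lambda>Q i W. if ptest x b i W then wp0 x A B p Q i W else wp0 x A B q Q i W)"
| "wp0 x A B (PWhile b p) = (\<lambda>Q i W. \<exists>k\<le>B. while0 (wp0 x A B p) (ptest x b) Q k i W)"

lemma while0_mono:
  assumes F: "\<And>P P' i W. \<lbrakk>F P i W; \<And>i W. P i W \<Longrightarrow> P' i W\<rbrakk> \<Longrightarrow> F P' i W"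
    and Q: "\<And>i W. Q i W \<Longrightarrow> Q' i W"
  shows "while0 F b Q k i W \<Longrightarrow> while0 F b Q' k i W"
  by (induction k arbitrary: i W) (auto intro: Q F split: if_splits)

lemma wp0_mono:
  "wp0 x A B p Q i W \<Longrightarrow> (\<And>i W. Q i W \<Longrightarrow> Q' i W) \<Longrightarrow> wp0 x A B p Q' i W"
proof (induction p arbitrary: Q Q' i W)
  case (PSeq p1 p2)
  then show ?case by simp
next
  case (PIf b p q)
  then show ?case by (auto split: if_splits)
next
  case (PWhile b p)
  from PWhile.prems(1) obtain k where k: "k \<le> B" "while0 (wp0 x A B p) (ptest x b) Q k i W"
    by auto
  have "while0 (wp0 x A B p) (ptest x b) Q' k i W"
    by (rule while0_mono[OF _ _ k(2)]) (auto intro: PWhile)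
  then show ?case using k(1) by auto
qed auto

fun prog_ok :: "nat \<Rightarrow> nat \<Rightarrow> prog \<Rightarrow> bool" where
  "prog_ok N b (PWr r a) \<longleftrightarrow> r < N \<and> a < b"
| "prog_ok N b (PMv r d) \<longleftrightarrow> r < N"
| "prog_ok N b (PSeq p q) \<longleftrightarrow> prog_ok N b p \<and> prog_ok N b q"
| "prog_ok N b (PIf t p q) \<longleftrightarrow> (\<forall>r S. t = PSym r S \<longrightarrow> r < N) \<and> prog_ok N b p \<and> prog_ok N b q"
| "prog_ok N b (PWhile t p) \<longleftrightarrow> (\<forall>r S. t = PSym r S \<longrightarrow> r < N) \<and> prog_ok N b p"
| "prog_ok N b _ \<longleftrightarrow> True"

text \<open>The variable of the polynomial is the common bound on the rounds of every loop
  execution. Each nesting of loops raises the degree by one, and the degree depends on the program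
  text alone.\<close>

primrec ptime :: "prog \<Rightarrow> nat poly" where
  "ptime PSkip = 1"
| "ptime (PMvIn d) = 1"
| "ptime (PWr r a) = 1"
| "ptime (PMv r d) = 1"
| "ptime (PSeq p q) = 1 + ptime p + ptime q"
| "ptime (PIf b p q) = 1 + ptime p + ptime q"
| "ptime (PWhile b p) = [:0, 1:] * (1 + ptime p) + 1"

text \<open>
  The states of the machine are the continuations of the program: the lists of the program
  parts that remain to be executed.
\<close>

primrec conts :: "prog \<Rightarrow> prog list \<Rightarrow> prog list set" where
  "conts PSkip K = {PSkip # K}"
| "conts (PMvIn d) K = {PMvIn d # K}"
| "conts (PWr r a) K = {PWr r a # K}"
| "conts (PMv r d) K = {PMv r d # K}"
| "conts (PSeq p q) K = insert (PSeq p q # K) (conts p (q # K) \<union> conts q K)"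
| "conts (PIf b p q) K = insert (PIf b p q # K) (conts p K \<union> conts q K)"
| "conts (PWhile b p) K = insert (PWhile b p # K) (conts p (PWhile b p # K))"

lemma finite_conts: "finite (conts p K)"
  by (induction p arbitrary: K) auto

lemma conts_self: "p # K \<in> conts p K"
  by (cases p) auto

fun ptest' :: "pcond \<Rightarrow> symbol cell \<Rightarrow> nat list \<Rightarrow> bool" where
  "ptest' (PIn S) a ss \<longleftrightarrow> a \<in> S"
| "ptest' (PSym r S) a ss \<longleftrightarrow> ss ! r \<in> S"

definition keep :: "nat list \<Rightarrow> (nat \<times> move) list" where
  "keep ss = map (\<lambda>s. (s, Stay)) ss"

fun next_cont :: "prog list \<Rightarrow> symbol cell \<Rightarrow> nat list \<Rightarrow> prog list \<times> move \<times> (nat \<times> move) list" where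
  "next_cont [] a ss = ([], Stay, keep ss)"
| "next_cont (PSkip # K) a ss = (K, Stay, keep ss)"
| "next_cont (PMvIn d # K) a ss = (K, d, keep ss)"
| "next_cont (PWr r b # K) a ss = (K, Stay, (keep ss)[r := (b, Stay)])"
| "next_cont (PMv r d # K) a ss = (K, Stay, (keep ss)[r := (ss ! r, d)])"
| "next_cont (PSeq p q # K) a ss = (p # q # K, Stay, keep ss)"
| "next_cont (PIf b p q # K) a ss = ((if ptest' b a ss then p else q) # K, Stay, keep ss)"
| "next_cont (PWhile b p # K) a ss =
     (if ptest' b a ss then p # PWhile b p # K else K, Stay, keep ss)"

definition all_conts :: "prog \<Rightarrow> prog list set" where
  "all_conts p = insert [] (conts p [])"

definition enc :: "prog \<Rightarrow> prog list \<Rightarrow> nat" where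
  "enc p K = 2 + to_nat_on (all_conts p) K"

definition dec :: "prog \<Rightarrow> nat \<Rightarrow> prog list" where
  "dec p q = from_nat_into (all_conts p) (q - 2)"

text \<open>
  States 0 and 1 accept and reject.  After the program has finished, the machine accepts iff it
  reads the symbol 1 on tape 0.
\<close>

definition compile :: "nat \<Rightarrow> nat \<Rightarrow> prog \<Rightarrow> symbol machine" where
  "compile N b p = \<lparr>ntapes = N, states = {0, 1} \<union> enc p ` all_conts p, work_symbols = {..<b},
     start = enc p [p], accept = 0, reject = 1,
     delta = (\<lambda>q a ss. if q < 2 then (q, Stay, keep ss)
       else if dec p q = [] then (if ss ! 0 = 1 then 0 else 1, Stay, keep ss)
       else case next_cont (dec p q) a ss of (K, d, acts) \<Rightarrow> (enc p K, d, acts))\<rparr>"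

section \<open>Finiteness and closure of the set of machine states\<close>

lemma countable_all_conts: "countable (all_conts p)"
  by (simp add: all_conts_def finite_conts countable_finite)

lemma dec_enc: "K \<in> all_conts p \<Longrightarrow> dec p (enc p K) = K"
  by (simp add: dec_def enc_def countable_all_conts)

text \<open>Execution inside a program part leaves its continuations only by dropping to
  \<open>K0\<close>; this closes a finite state set under the transition function.\<close>

lemma next_cont_conts:
  "K \<in> conts p K0 \<Longrightarrow> fst (next_cont K a ss) \<in> insert K0 (conts p K0)"
proof (induction p arbitrary: K0)
  case (PSeq p q)
  show ?case
    using PSeq.prems PSeq.IH(1)[of "q # K0"] PSeq.IH(2)[of K0] conts_self[of p "q # K0"] conts_self[of q K0]
    by auto
next
  case (PIf b p q)
  show ?case
    using PIf.prems PIf.IH[of K0] conts_self[of p K0] conts_self[of q K0] by auto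
next
  case (PWhile b p)
  show ?case
    using PWhile.prems PWhile.IH[of "PWhile b p # K0"] conts_self[of p "PWhile b p # K0"] by (auto split: if_splits)
qed auto

lemma next_cont_acts:
  assumes "K \<in> conts p K0" "prog_ok N b p" "length ss = N" "set ss \<subseteq> {..<b}"
  shows "length (snd (snd (next_cont K a ss))) = N \<and>
    fst ` set (snd (snd (next_cont K a ss))) \<subseteq> {..<b}"
  using assms
proof (induction p arbitrary: K0)
  case (PWr r c)
  then show ?case
    by (auto simp: keep_def dest!: subsetD[OF set_update_subset_insert])
next
  case (PMv r d)
  then show ?case
    by (auto simp: keep_def dest!: subsetD[OF set_update_subset_insert])
      (meson lessThan_iff nth_mem subsetD)
qed (auto simp: keep_def)

lemma wf_machine_compile:
  assumes "prog_ok N b p" "0 < b"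
  shows "wf_machine (compile N b p)"
proof -
  have fin: "finite (all_conts p)" by (simp add: all_conts_def finite_conts)
  have "[p] \<in> all_conts p" by (simp add: all_conts_def conts_self)
  have main: "q' \<in> states (compile N b p) \<and> length acts = N \<and> fst ` set acts \<subseteq> {..<b}"
    if q: "q \<in> states (compile N b p)" and ss: "length ss = N" "set ss \<subseteq> {..<b}"
      and d: "delta (compile N b p) q a ss = (q', d, acts)" for q a ss q' d acts
  proof -
    have k: "length (keep ss) = N" "fst ` set (keep ss) \<subseteq> {..<b}"
      using ss by (auto simp: keep_def)
    show ?thesis
    proof (cases "q < 2 \<or> dec p q = []")
      case True
      then show ?thesis using d k q by (auto simp: compile_def split: if_splits)
    next
      case False
      then obtain K where K: "q = enc p K" "K \<in> all_conts p" using q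
        by (auto simp: compile_def)
      with False have ne: "K \<noteq> []" "dec p q = K" "\<not> q < 2" by (auto simp: dec_enc)
      then have Kc: "K \<in> conts p []" using K by (auto simp: all_conts_def)
      obtain K' d' a' where n: "next_cont K a ss = (K', d', a')" by (metis prod_cases3)
      have "K' \<in> all_conts p" using next_cont_conts[OF Kc, of a ss] n by (auto simp: all_conts_def)
      moreover have "length a' = N \<and> fst ` set a' \<subseteq> {..<b}"
        using next_cont_acts[OF Kc assms(1) ss, of a] n by auto
      ultimately show ?thesis using d ne n by (simp add: compile_def) blast
    qed
  qed
  have "finite (states (compile N b p))" "work_symbols (compile N b p) = {..<b}"
    "{start (compile N b p), accept (compile N b p), reject (compile N b p)} \<subseteq> states (compile N b p)"
    "accept (compile N b p) \<noteq> reject (compile N b p)" "ntapes (compile N b p) = N"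
    using fin \<open>[p] \<in> all_conts p\<close> by (auto simp: compile_def)
  then show ?thesis
    unfolding wf_machine_def using assms(2) main
    by (intro conjI ballI allI impI) (simp_all, blast+)
qed

section \<open>Simulation by the machine, with time and head positions\<close>

definition reaches :: "symbol machine \<Rightarrow> symbol list \<Rightarrow> (nat \<Rightarrow> nat) \<Rightarrow> nat \<Rightarrow> config \<Rightarrow> config \<Rightarrow> bool" where
  "reaches M x A t c c' \<longleftrightarrow> (step M x ^^ t) c = c' \<and>
     (\<forall>t'\<le>t. \<forall>r<ntapes M. fst (works ((step M x ^^ t') c) ! r) \<le> A r)"

lemma reaches_trans:
  assumes "reaches M x A t c c'" "reaches M x A t' c' c''"
  shows "reaches M x A (t + t') c c''"
proof -
  have *: "(step M x ^^ (t + s)) c = (step M x ^^ s) c'" for s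
    using assms(1) by (simp add: reaches_def funpow_add add.commute[of t])
  show ?thesis
    unfolding reaches_def
  proof (intro conjI allI impI)
    show "(step M x ^^ (t + t')) c = c''" using * assms(2) by (simp add: reaches_def)
  next
    fix s r assume s: "s \<le> t + t'" "r < ntapes M"
    show "fst (works ((step M x ^^ s) c) ! r) \<le> A r"
    proof (cases "s \<le> t")
      case True
      then show ?thesis using assms(1) s by (simp add: reaches_def)
    next
      case False
      then have "s = t + (s - t)" "s - t \<le> t'" using s by auto
      then show ?thesis using *[of "s - t"] assms(2) s by (simp add: reaches_def)
    qed
  qed
qed

definition conf :: "nat \<Rightarrow> prog \<Rightarrow> prog list \<Rightarrow> nat \<Rightarrow> tapes \<Rightarrow> config" where
  "conf N p K i W = \<lparr>state = enc p K, input_pos = i, works = map W [0..<N]\<rparr>"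

lemma apply_keep:
  "map2 (\<lambda>(p, f) (a, e). (shift e p, f(p := a))) (map W [0..<N])
     (keep (map (sym \<circ> W) [0..<N])) = map W [0..<N]"
  by (rule nth_equalityI) (auto simp: keep_def sym_def split: prod.splits)

lemma apply_keep_update:
  assumes "r < N"
  shows "map2 (\<lambda>(p, f) (a, e). (shift e p, f(p := a))) (map W [0..<N])
     ((keep (map (sym \<circ> W) [0..<N]))[r := (a, e)]) =
     map (W(r := (shift e (fst (W r)), (snd (W r))(fst (W r) := a)))) [0..<N]"
  using assms
  by (intro nth_equalityI) (auto simp: keep_def sym_def nth_list_update split: prod.splits)

lemma step_conf:
  assumes K: "K \<in> all_conts p" "K \<noteq> []"
  shows "step (compile N b p) x (conf N p K i W) =
    (case next_cont K (input_cell x i) (map (sym \<circ> W) [0..<N]) of (K', d, acts) \<Rightarrow>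
      \<lparr>state = enc p K', input_pos = min (length x + 1) (shift d i),
       works = map2 (\<lambda>(p, f) (a, e). (shift e p, f(p := a))) (map W [0..<N]) acts\<rparr>)"
proof -
  have "enc p K \<ge> 2" by (simp add: enc_def)
  then show ?thesis
    using K by (simp add: step_def conf_def compile_def halted_def dec_enc sym_def split: prod.splits)
qed

lemma reaches_step:
  assumes "step M x c = c'" "\<forall>r<ntapes M. fst (works c ! r) \<le> A r"
    "\<forall>r<ntapes M. fst (works c' ! r) \<le> A r"
  shows "reaches M x A 1 c c'"
  using assms by (auto simp: reaches_def le_Suc_eq)

lemma ptest'_eq:
  assumes "\<forall>r S. b = PSym r S \<longrightarrow> r < N"
  shows "ptest' b (input_cell x i) (map (sym \<circ> W) [0..<N]) = ptest x b i W"
  using assms by (cases b) auto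

lemma ntapes_compile [simp]: "ntapes (compile N b p) = N"
  by (simp add: compile_def)

text \<open>Each construct costs one machine step on top of its parts, and a loop one step per test
  including the failing last one. The head bound is required of all intermediate configurations,
  because work space counts the cells visited and not the final positions.\<close>

lemma compile_correct:
  assumes "wp0 x A B p Q i W" "conts p K \<subseteq> all_conts P" "K \<in> all_conts P" "prog_ok N b p"
    "\<forall>r<N. fst (W r) \<le> A r" "i \<le> length x + 1"
  shows "\<exists>t\<le>poly (ptime p) B. \<exists>i' W'. Q i' W' \<and> i' \<le> length x + 1 \<and> (\<forall>r<N. fst (W' r) \<le> A r) \<and>
    reaches (compile N b P) x A t (conf N P (p # K) i W) (conf N P K i' W')"
  using assms
proof (induction p arbitrary: Q i W K)
  case PSkip
  then have "reaches (compile N b P) x A 1 (conf N P (PSkip # K) i W) (conf N P K i W)"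
    by (intro reaches_step) (simp_all add: step_conf apply_keep, simp_all add: conf_def)
  then show ?case using PSkip by (intro exI[of _ "1::nat"]) auto
next
  case (PMvIn d)
  let ?i = "min (length x + 1) (shift d i)"
  from PMvIn have "reaches (compile N b P) x A 1 (conf N P (PMvIn d # K) i W) (conf N P K ?i W)"
    by (intro reaches_step) (simp_all add: step_conf apply_keep, simp_all add: conf_def)
  moreover have "1 \<le> poly (ptime (PMvIn d)) B" "Q ?i W" "?i \<le> length x + 1"
    using PMvIn.prems by auto
  ultimately show ?case using PMvIn.prems(5) by blast
next
  case (PWr r a)
  let ?W = "W(r := (fst (W r), (snd (W r))(fst (W r) := a)))"
  from PWr have "reaches (compile N b P) x A 1 (conf N P (PWr r a # K) i W) (conf N P K i ?W)"
    by (intro reaches_step) (simp_all add: step_conf apply_keep_update, simp_all add: conf_def)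
  moreover have "1 \<le> poly (ptime (PWr r a)) B" "Q i ?W" "\<forall>r<N. fst (?W r) \<le> A r"
    using PWr.prems by auto
  ultimately show ?case using PWr.prems(6) by blast
next
  case (PMv r d)
  let ?W = "W(r := (shift d (fst (W r)), snd (W r)))"
  from PMv have "reaches (compile N b P) x A 1 (conf N P (PMv r d # K) i W) (conf N P K i ?W)"
    by (intro reaches_step) (simp_all add: step_conf apply_keep_update, simp_all add: conf_def sym_def case_prod_beta)
  moreover have "1 \<le> poly (ptime (PMv r d)) B" "Q i ?W" "\<forall>r<N. fst (?W r) \<le> A r"
    using PMv.prems by auto
  ultimately show ?case using PMv.prems(6) by blast
next
  case (PSeq p q)
  from PSeq.prems have 1: "reaches (compile N b P) x A 1 (conf N P (PSeq p q # K) i W) (conf N P (p # q # K) i W)"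
    by (intro reaches_step) (simp_all add: step_conf apply_keep, simp_all add: conf_def)
  have "q # K \<in> all_conts P" using PSeq.prems(2) conts_self[of q K] by auto
  with PSeq.IH(1)[of "wp0 x A B q Q" i W "q # K"] PSeq.prems
  obtain t1 i1 W1 where t1: "t1 \<le> poly (ptime p) B" "wp0 x A B q Q i1 W1" "i1 \<le> length x + 1"
    "\<forall>r<N. fst (W1 r) \<le> A r"
    "reaches (compile N b P) x A t1 (conf N P (p # q # K) i W) (conf N P (q # K) i1 W1)"
    by auto
  with PSeq.IH(2)[of Q i1 W1 K] PSeq.prems
  obtain t2 i2 W2 where t2: "t2 \<le> poly (ptime q) B" "Q i2 W2" "i2 \<le> length x + 1"
    "\<forall>r<N. fst (W2 r) \<le> A r"
    "reaches (compile N b P) x A t2 (conf N P (q # K) i1 W1) (conf N P K i2 W2)"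
    by auto
  show ?case
    using reaches_trans[OF 1 reaches_trans[OF t1(5) t2(5)]] t1(1) t2
    by (intro exI[of _ "1 + (t1 + t2)"]) auto
next
  case (PIf t p q)
  define c where "c = (if ptest x t i W then p else q)"
  from PIf.prems have 1: "reaches (compile N b P) x A 1 (conf N P (PIf t p q # K) i W) (conf N P (c # K) i W)"
    by (intro reaches_step) (simp_all add: step_conf apply_keep ptest'_eq c_def, simp_all add: conf_def)
  have "\<exists>s\<le>poly (ptime c) B. \<exists>i' W'. Q i' W' \<and> i' \<le> length x + 1 \<and> (\<forall>r<N. fst (W' r) \<le> A r) \<and>
    reaches (compile N b P) x A s (conf N P (c # K) i W) (conf N P K i' W')"
    using PIf.IH(1)[of Q i W K] PIf.IH(2)[of Q i W K] PIf.prems by (auto simp: c_def)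
  then obtain s i2 W2 where t2: "s \<le> poly (ptime c) B" "Q i2 W2" "i2 \<le> length x + 1"
    "\<forall>r<N. fst (W2 r) \<le> A r"
    "reaches (compile N b P) x A s (conf N P (c # K) i W) (conf N P K i2 W2)"
    by auto
  have "s \<le> poly (ptime p) B + poly (ptime q) B" using t2(1) by (auto simp: c_def split: if_splits)
  then show ?case
    using reaches_trans[OF 1 t2(5)] t2 by (intro exI[of _ "1 + s"]) auto
next
  case (PWhile t p)
  let ?L = "PWhile t p # K"
  have cont: "?L \<in> all_conts P" "p # ?L \<in> all_conts P"
    using PWhile.prems(2) conts_self[of p ?L] by auto
  have loop: "\<exists>s\<le>k * (1 + poly (ptime p) B) + 1. \<exists>i' W'. Q i' W' \<and> i' \<le> length x + 1 \<and> (\<forall>r<N. fst (W' r) \<le> A r) \<and>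
    reaches (compile N b P) x A s (conf N P ?L i W) (conf N P K i' W')"
    if "while0 (wp0 x A B p) (ptest x t) Q k i W" "\<forall>r<N. fst (W r) \<le> A r" "i \<le> length x + 1" for k i W
    using that
  proof (induction k arbitrary: i W)
    case 0
    with PWhile.prems cont have 1: "reaches (compile N b P) x A 1 (conf N P ?L i W) (conf N P K i W)"
      by (intro reaches_step) (simp_all add: step_conf apply_keep ptest'_eq, simp_all add: conf_def)
    then show ?case using 0 by (intro exI[of _ "1::nat"]) auto
  next
    case (Suc k)
    show ?case
    proof (cases "ptest x t i W")
      case True
      with PWhile.prems Suc.prems cont have 1: "reaches (compile N b P) x A 1 (conf N P ?L i W) (conf N P (p # ?L) i W)"
        by (intro reaches_step) (simp_all add: step_conf apply_keep ptest'_eq, simp_all add: conf_def)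
      have "wp0 x A B p (while0 (wp0 x A B p) (ptest x t) Q k) i W"
        using Suc.prems True by simp
      from PWhile.IH[OF this, of ?L] PWhile.prems cont Suc.prems
      obtain t1 i1 W1 where t1: "t1 \<le> poly (ptime p) B" "while0 (wp0 x A B p) (ptest x t) Q k i1 W1"
        "i1 \<le> length x + 1" "\<forall>r<N. fst (W1 r) \<le> A r"
        "reaches (compile N b P) x A t1 (conf N P (p # ?L) i W) (conf N P ?L i1 W1)"
        by auto
      from Suc.IH[OF t1(2,4,3)]
      obtain t2 i2 W2 where t2: "t2 \<le> k * (1 + poly (ptime p) B) + 1" "Q i2 W2" "i2 \<le> length x + 1"
        "\<forall>r<N. fst (W2 r) \<le> A r"
        "reaches (compile N b P) x A t2 (conf N P ?L i1 W1) (conf N P K i2 W2)"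
        by auto
      show ?thesis
        using reaches_trans[OF 1 reaches_trans[OF t1(5) t2(5)]] t1(1) t2
        by (intro exI[of _ "1 + (t1 + t2)"]) auto
    next
      case False
      with PWhile.prems Suc.prems cont have 1: "reaches (compile N b P) x A 1 (conf N P ?L i W) (conf N P K i W)"
        by (intro reaches_step) (simp_all add: step_conf apply_keep ptest'_eq, simp_all add: conf_def)
      then show ?thesis using Suc.prems False by (intro exI[of _ "1::nat"]) auto
    qed
  qed
  from PWhile.prems(1) obtain k where k: "k \<le> B" "while0 (wp0 x A B p) (ptest x t) Q k i W"
    by auto
  from loop[OF k(2) PWhile.prems(5,6)] obtain s where "s \<le> k * (1 + poly (ptime p) B) + 1"
    and s: "\<exists>i' W'. Q i' W' \<and> i' \<le> length x + 1 \<and> (\<forall>r<N. fst (W' r) \<le> A r) \<and>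
    reaches (compile N b P) x A s (conf N P ?L i W) (conf N P K i' W')"
    by blast
  moreover have "k * (1 + poly (ptime p) B) \<le> B * (1 + poly (ptime p) B)" by (rule mult_le_mono1[OF k(1)])
  ultimately have "s \<le> poly (ptime (PWhile t p)) B" by (simp add: algebra_simps)
  then show ?case using s by blast
qed

text \<open>One extra step leads from the empty continuation to acceptance or rejection. A head
  confined to the cells up to \<open>A r\<close> visits at most \<open>A r + 1\<close> of
  them.\<close>

lemma compile_decides:
  assumes wp: "wp0 x A B p (\<lambda>i W. sym (W 0) = 1 \<longleftrightarrow> ans) 0 (\<lambda>_. (0, \<lambda>_. 0))"
    and ok: "prog_ok N b p" "0 < N"
  shows "decides_within (compile N b p) x ans (poly (ptime p + 1) B) (real (\<Sum>r<N. A r + 1))"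
proof -
  let ?M = "compile N b p"
  have init: "initial ?M = conf N p [p] 0 (\<lambda>_. (0, \<lambda>_. 0))"
    by (simp add: initial_def conf_def compile_def map_replicate_const)
  from compile_correct[OF wp, of "[]" p N b] ok
  obtain t i W where t: "t \<le> poly (ptime p) B" "sym (W 0) = 1 \<longleftrightarrow> ans"
    "\<forall>r<N. fst (W r) \<le> A r" "reaches ?M x A t (initial ?M) (conf N p [] i W)"
    unfolding init by (auto simp: all_conts_def)
  define q where "q = (if sym (W 0) = 1 then 0 else 1 :: nat)"
  define c where "c = \<lparr>state = q, input_pos = min (length x + 1) i, works = map W [0..<N]\<rparr>"
  have "[] \<in> all_conts p" by (simp add: all_conts_def)
  then have "step ?M x (conf N p [] i W) = c"
    using \<open>0 < N\<close> apply_keep[of W N]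
    by (simp add: step_def halted_def dec_enc conf_def compile_def c_def q_def sym_def[symmetric])
      (simp add: enc_def)
  then have "reaches ?M x A 1 (conf N p [] i W) c"
    using t(3) by (intro reaches_step) (auto simp: conf_def c_def)
  from reaches_trans[OF t(4) this] have r: "reaches ?M x A (t + 1) (initial ?M) c" .
  have "run ?M x (t + 1) = c" using r by (simp add: reaches_def run_def)
  then have h: "halted ?M (run ?M x (t + 1))" "state (run ?M x (t + 1)) = accept ?M \<longleftrightarrow> ans"
    using t(2) by (auto simp: halted_def c_def q_def compile_def)
  have "{(i, fst (works (run ?M x t') ! i)) | i t'. i < ntapes ?M \<and> t' \<le> t + 1} \<subseteq> (SIGMA i:{..<N}. {..A i})"
    using r by (auto simp: reaches_def run_def)
  then have "work_space ?M x (t + 1) \<le> card (SIGMA i:{..<N}. {..A i})"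
    unfolding work_space_def by (intro card_mono) auto
  also have "\<dots> = (\<Sum>r<N. A r + 1)" by simp
  finally show ?thesis
    unfolding decides_within_def using h t(1) by (intro exI[of _ "t + 1"]) (auto simp del: of_nat_sum)
qed

section \<open>Register programs and binary counters\<close>

text \<open>
  Resolution may leave an updated function eta-expanded, and \<open>fun_upd_apply\<close> would then unfold the
  update.
\<close>

declare fun_upd_apply [simp del] fun_upd_same [simp] fun_upd_other [simp]

datatype cond = NZ nat | In "symbol cell set" | Tp nat "nat set"

datatype com =
    Skip
  | Inc nat
  | Dec nat
  | InM move
  | Wr nat nat
  | Mv nat move
  | Seq com com (infixr ";;" 60)
  | IfC cond com com
  | WhileC cond com

type_synonym regs = "nat \<Rightarrow> nat"
type_synonym pred = "regs \<Rightarrow> nat \<Rightarrow> (nat \<Rightarrow> nat) \<Rightarrow> (nat \<Rightarrow> nat \<Rightarrow> nat) \<Rightarrow> bool"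

fun test :: "symbol list \<Rightarrow> cond \<Rightarrow> pred" where
  "test x (NZ r) \<rho> i h m \<longleftrightarrow> \<rho> r \<noteq> 0"
| "test x (In S) \<rho> i h m \<longleftrightarrow> input_cell x i \<in> S"
| "test x (Tp j S) \<rho> i h m \<longleftrightarrow> m j (h j) \<in> S"

primrec while1 :: "(pred \<Rightarrow> pred) \<Rightarrow> pred \<Rightarrow> pred \<Rightarrow> nat \<Rightarrow> pred" where
  "while1 F b Q 0 = (\<lambda>\<rho> i h m. \<not> b \<rho> i h m \<and> Q \<rho> i h m)"
| "while1 F b Q (Suc k) = (\<lambda>\<rho> i h m. if b \<rho> i h m then F (while1 F b Q k) \<rho> i h m else Q \<rho> i h m)"

text \<open>
  The registers stay below \<open>V\<close>, the heads of the work tapes on the first \<open>A j + 1\<close> cells, and no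
  execution of a loop takes more than \<open>B\<close> rounds.  A register holding 0 must not be decremented.
\<close>

locale ram =
  fixes x :: "symbol list" and V B :: nat and A :: "nat \<Rightarrow> nat"
begin

primrec wp :: "com \<Rightarrow> pred \<Rightarrow> pred" where
  "wp Skip = (\<lambda>Q. Q)"
| "wp (Inc r) = (\<lambda>Q \<rho> i h m. Suc (\<rho> r) \<le> V \<and> Q (\<rho>(r := Suc (\<rho> r))) i h m)"
| "wp (Dec r) = (\<lambda>Q \<rho> i h m. 0 < \<rho> r \<and> Q (\<rho>(r := \<rho> r - 1)) i h m)"
| "wp (InM d) = (\<lambda>Q \<rho> i h m. Q \<rho> (min (length x + 1) (shift d i)) h m)"
| "wp (Wr j a) = (\<lambda>Q \<rho> i h m. Q \<rho> i h (m(j := (m j)(h j := a))))"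
| "wp (Mv j d) = (\<lambda>Q \<rho> i h m. shift d (h j) \<le> A j \<and> Q \<rho> i (h(j := shift d (h j))) m)"
| "wp (c ;; c') = (\<lambda>Q. wp c (wp c' Q))"
| "wp (IfC b c c') = (\<lambda>Q \<rho> i h m. if test x b \<rho> i h m then wp c Q \<rho> i h m else wp c' Q \<rho> i h m)"
| "wp (WhileC b c) = (\<lambda>Q \<rho> i h m. \<exists>k\<le>B. while1 (wp c) (test x b) Q k \<rho> i h m)"

lemma while1_mono_pred:
  assumes F: "\<And>P P' \<rho> i h m. \<lbrakk>F P \<rho> i h m; \<And>\<rho> i h m. P \<rho> i h m \<Longrightarrow> P' \<rho> i h m\<rbrakk> \<Longrightarrow> F P' \<rho> i h m"
    and Q: "\<And>\<rho> i h m. Q \<rho> i h m \<Longrightarrow> Q' \<rho> i h m"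
  shows "while1 F b Q k \<rho> i h m \<Longrightarrow> while1 F b Q' k \<rho> i h m"
  by (induction k arbitrary: \<rho> i h m) (auto intro: Q F split: if_splits)

lemma wp_mono:
  "wp c Q \<rho> i h m \<Longrightarrow> (\<And>\<rho> i h m. Q \<rho> i h m \<Longrightarrow> Q' \<rho> i h m) \<Longrightarrow> wp c Q' \<rho> i h m"
proof (induction c arbitrary: Q Q' \<rho> i h m)
  case (Seq c1 c2)
  then show ?case by simp
next
  case (IfC b p q)
  then show ?case by (auto split: if_splits)
next
  case (WhileC b c)
  from WhileC.prems(1) obtain k where k: "k \<le> B" "while1 (wp c) (test x b) Q k \<rho> i h m"
    by auto
  have "while1 (wp c) (test x b) Q' k \<rho> i h m"
    by (rule while1_mono_pred[OF _ _ k(2)]) (auto intro: WhileC)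
  then show ?case using k(1) by auto
qed auto

end

text \<open>
  Register \<open>r\<close> is kept on tape \<open>r + 2\<close> as a binary number, least significant bit first, with
  symbols 1 and 2 for the bits 0 and 1.  Cell 0 carries the marker 3.
\<close>

definition digits :: "bool list \<Rightarrow> nat \<Rightarrow> nat" where
  "digits ds = (\<lambda>i. if i = 0 then 3 else if i \<le> length ds then (if ds ! (i - 1) then 2 else 1) else 0)"

fun val :: "bool list \<Rightarrow> nat" where
  "val [] = 0"
| "val (d # ds) = of_bool d + 2 * val ds"

fun incr :: "bool list \<Rightarrow> bool list" where
  "incr [] = [True]"
| "incr (False # ds) = True # ds"
| "incr (True # ds) = False # incr ds"

fun decr :: "bool list \<Rightarrow> bool list" where
  "decr [] = []"
| "decr (True # ds) = False # ds"
| "decr (False # ds) = True # decr ds"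

section \<open>Binary increment and decrement\<close>

lemma val_incr [simp]: "val (incr ds) = Suc (val ds)"
  by (induction ds rule: incr.induct) auto

lemma val_decr: "0 < val ds \<Longrightarrow> val (decr ds) = val ds - 1"
  by (induction ds rule: decr.induct) auto

lemma length_decr [simp]: "length (decr ds) = length ds"
  by (induction ds rule: decr.induct) auto

text \<open>A numeral gets longer only if all its digits are one. Hence a counter whose value stays
  below \<open>2 ^ l\<close> never outgrows \<open>l\<close> digits, although \<open>decr\<close>
  leaves leading zeros behind.\<close>

lemma length_incr_cases:
  "length (incr ds) = length ds \<or> length (incr ds) = Suc (length ds) \<and> Suc (val ds) = 2 ^ length ds"
  by (induction ds rule: incr.induct) auto

lemma length_incr_le:
  assumes "length ds \<le> l" "Suc (val ds) < 2 ^ l"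
  shows "length (incr ds) \<le> l"
  using length_incr_cases[of ds] assms by (cases "length ds = l") auto

lemma digits_simps:
  "digits (pre @ d # ds) (Suc (length pre)) = (if d then 2 else 1)"
  "digits pre (Suc (length pre)) = 0"
  by (auto simp: digits_def)

lemma digits_0: "digits ds i = 3 \<longleftrightarrow> i = 0"
  by (auto simp: digits_def)

lemma digits_upd:
  "(digits (pre @ d # ds))(Suc (length pre) := 2) = digits (pre @ True # ds)"
  "(digits (pre @ d # ds))(Suc (length pre) := 1) = digits (pre @ False # ds)"
  "(digits pre)(Suc (length pre) := 2) = digits (pre @ [True])"
  by (auto simp: digits_def nth_append nth_Cons' fun_eq_iff fun_upd_apply)

definition ret :: "nat \<Rightarrow> prog" where
  "ret j = PWhile (PSym j (- {3})) (PMv j MoveLeft)"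

text \<open>As leading zeros occur, a register is zero iff the first symbol other than 1 behind the
  marker is the blank. The head stays on that symbol, where a test can read it.\<close>

definition scan :: "nat \<Rightarrow> prog" where
  "scan j = PSeq (PMv j MoveRight) (PWhile (PSym j {1}) (PMv j MoveRight))"

definition inc_prog :: "nat \<Rightarrow> prog" where
  "inc_prog j = PSeq (PMv j MoveRight) (PSeq (PWhile (PSym j {2}) (PSeq (PWr j 1) (PMv j MoveRight)))
     (PSeq (PWr j 2) (ret j)))"

definition dec_prog :: "nat \<Rightarrow> prog" where
  "dec_prog j = PSeq (PMv j MoveRight) (PSeq (PWhile (PSym j {1}) (PSeq (PWr j 2) (PMv j MoveRight)))
     (PSeq (PWr j 1) (ret j)))"

text \<open>A tape loop tests only the scanned symbol. For a test on a register, \<open>scan\<close>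
  therefore parks the head where the answer is visible, once before the loop and again at the end of
  each round, and \<open>ret\<close> sends it home before anything else happens.\<close>

primrec tr :: "com \<Rightarrow> prog" where
  "tr Skip = PSkip"
| "tr (Inc r) = inc_prog (r + 2)"
| "tr (Dec r) = dec_prog (r + 2)"
| "tr (InM d) = PMvIn d"
| "tr (Wr j a) = PWr j a"
| "tr (Mv j d) = PMv j d"
| "tr (c ;; c') = PSeq (tr c) (tr c')"
| "tr (IfC b c c') = (case b of
     NZ r \<Rightarrow> PSeq (scan (r + 2)) (PIf (PSym (r + 2) {2}) (PSeq (ret (r + 2)) (tr c)) (PSeq (ret (r + 2)) (tr c')))
   | In S \<Rightarrow> PIf (PIn S) (tr c) (tr c')
   | Tp j S \<Rightarrow> PIf (PSym j S) (tr c) (tr c'))"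
| "tr (WhileC b c) = (case b of
     NZ r \<Rightarrow> PSeq (scan (r + 2)) (PSeq
       (PWhile (PSym (r + 2) {2}) (PSeq (ret (r + 2)) (PSeq (tr c) (scan (r + 2))))) (ret (r + 2)))
   | In S \<Rightarrow> PWhile (PIn S) (tr c)
   | Tp j S \<Rightarrow> PWhile (PSym j S) (tr c))"

fun cond_ok :: "nat \<Rightarrow> cond \<Rightarrow> bool" where
  "cond_ok N (NZ r) \<longleftrightarrow> r < N"
| "cond_ok N (In S) \<longleftrightarrow> True"
| "cond_ok N (Tp j S) \<longleftrightarrow> j < 2"

fun com_ok :: "nat \<Rightarrow> com \<Rightarrow> bool" where
  "com_ok N (Inc r) \<longleftrightarrow> r < N"
| "com_ok N (Dec r) \<longleftrightarrow> r < N"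
| "com_ok N (Wr j a) \<longleftrightarrow> j < 2 \<and> a < 10"
| "com_ok N (Mv j d) \<longleftrightarrow> j < 2"
| "com_ok N (c ;; c') \<longleftrightarrow> com_ok N c \<and> com_ok N c'"
| "com_ok N (IfC b c c') \<longleftrightarrow> cond_ok N b \<and> com_ok N c \<and> com_ok N c'"
| "com_ok N (WhileC b c) \<longleftrightarrow> cond_ok N b \<and> com_ok N c"
| "com_ok N _ \<longleftrightarrow> True"

lemma prog_ok_tr: "com_ok N c \<Longrightarrow> prog_ok (N + 2) 10 (tr c)"
  by (induction c) (auto simp: ret_def scan_def inc_prog_def dec_prog_def split: cond.splits)

primrec prologue :: "nat \<Rightarrow> prog" where
  "prologue 0 = PSkip"
| "prologue (Suc N) = PSeq (prologue N) (PWr (N + 2) 3)"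

text \<open>Passing over a numeral of at most \<open>l\<close> digits takes at most
  \<open>l + 1\<close> moves, so the loops inside the counter operations obey the same bound
  \<open>B\<close> as those of the program.\<close>

locale binary_counters =
  fixes x :: "symbol list" and A :: "nat \<Rightarrow> nat" and B l :: nat
  assumes B: "l + 1 \<le> B"
begin

abbreviation A' :: "nat \<Rightarrow> nat" where
  "A' j \<equiv> if j < 2 then A j else l + 1"

lemma sym_simp [simp]: "sym (p, f) = f p"
  by (simp add: sym_def)

lemma while0_stop: "\<not> b i W \<Longrightarrow> Q i W \<Longrightarrow> while0 F b Q k i W"
  by (cases k) auto

lemma while0_step: "b i W \<Longrightarrow> F (while0 F b Q k) i W \<Longrightarrow> while0 F b Q (Suc k) i W"
  by simp

lemma wp0_PMvI:
  "W r = (p, f) \<Longrightarrow> shift d p \<le> C r \<Longrightarrow> Q i (W(r := (shift d p, f))) \<Longrightarrow> wp0 x C B (PMv r d) Q i W"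
  by simp

lemma wp0_PWrI:
  "W r = (p, f) \<Longrightarrow> Q i (W(r := (p, f(p := a)))) \<Longrightarrow> wp0 x C B (PWr r a) Q i W"
  by simp

lemma wp0_PSeqI: "wp0 x C B p (wp0 x C B q Q) i W \<Longrightarrow> wp0 x C B (PSeq p q) Q i W"
  by simp

lemma wp0_PWhileI: "while0 (wp0 x C B p) (ptest x b) Q k i W \<Longrightarrow> k \<le> B \<Longrightarrow> wp0 x C B (PWhile b p) Q i W"
  by auto

lemma wp0_ret:
  assumes "W j = (p, digits ds)" "p \<le> l + 1" "2 \<le> j" "Q i (W(j := (0, digits ds)))"
  shows "wp0 x A' B (ret j) Q i W"
proof -
  have "while0 (wp0 x A' B (PMv j MoveLeft)) (ptest x (PSym j (- {3}))) Q p i W"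
    if "W j = (p, digits ds)" "p \<le> l + 1" "Q i (W(j := (0, digits ds)))" for p W
    using that
  proof (induction p arbitrary: W)
    case 0
    have "W(j := (0, digits ds)) = W" using 0(1) by (simp add: fun_upd_idem)
    then show ?case using 0 by (intro while0_stop) (simp_all add: digits_0)
  next
    case (Suc p)
    have "while0 (wp0 x A' B (PMv j MoveLeft)) (ptest x (PSym j (- {3}))) Q p i (W(j := (p, digits ds)))"
      by (rule Suc.IH) (use Suc.prems in auto)
    then show ?case using Suc.prems(1,2) assms(3)
      by (intro while0_step[where b = "ptest x (PSym j (- {3}))"] wp0_PMvI[where p = "Suc p" and f = "digits ds"])
        (simp add: digits_0, simp_all del: ptest.simps wp0.simps)
  qed
  then show ?thesis unfolding ret_def using assms B by (intro wp0_PWhileI[where k = p]) auto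
qed

lemma wp0_inc:
  assumes W: "W j = (0, digits ds)" and j: "2 \<le> j" and l: "length ds \<le> l" "length (incr ds) \<le> l"
    and Q: "Q i (W(j := (0, digits (incr ds))))"
  shows "wp0 x A' B (inc_prog j) Q i W"
proof -
  \<comment> \<open>\<open>pre\<close> holds the digits that the head has passed, in which the carry
    has already been written; \<open>ds\<close> is what remains to be incremented.\<close>
  have "while0 (wp0 x A' B (PSeq (PWr j 1) (PMv j MoveRight))) (ptest x (PSym j {2}))
      (wp0 x A' B (PSeq (PWr j 2) (ret j)) Q) (length ds) i W"
    if "W j = (Suc (length pre), digits (pre @ ds))" "length (pre @ ds) \<le> l"
      "length (pre @ incr ds) \<le> l" "Q i (W(j := (0, digits (pre @ incr ds))))" for W pre ds
    using that
  proof (induction ds arbitrary: pre W rule: incr.induct)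
    case 1
    have upd: "(digits pre)(Suc (length pre) := 2) = digits (pre @ [True])" by (rule digits_upd)
    have "wp0 x A' B (ret j) Q i (W(j := (Suc (length pre), (digits pre)(Suc (length pre) := 2))))"
      unfolding upd by (rule wp0_ret[of _ _ "Suc (length pre)" "pre @ [True]"]) (use 1 j in auto)
    then show ?case using 1(1)
      by (intro while0_stop wp0_PSeqI wp0_PWrI[where f = "digits (pre @ [])"])
        (simp_all add: digits_simps del: wp0.simps)
  next
    case (2 ds)
    have upd: "(digits (pre @ False # ds))(Suc (length pre) := 2) = digits (pre @ True # ds)"
      by (rule digits_upd)
    have "wp0 x A' B (ret j) Q i (W(j := (Suc (length pre), (digits (pre @ False # ds))(Suc (length pre) := 2))))"
      unfolding upd by (rule wp0_ret[of _ _ "Suc (length pre)" "pre @ True # ds"]) (use 2 j in auto)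
    then show ?case using 2(1)
      by (intro while0_stop wp0_PSeqI wp0_PWrI[where f = "digits (pre @ False # ds)"])
        (simp_all add: digits_simps del: wp0.simps)
  next
    case (3 ds)
    have "while0 (wp0 x A' B (PSeq (PWr j 1) (PMv j MoveRight))) (ptest x (PSym j {2}))
      (wp0 x A' B (PSeq (PWr j 2) (ret j)) Q) (length ds) i
      (W(j := (Suc (length (pre @ [False])), digits ((pre @ [False]) @ ds))))"
      by (rule 3(1)[of _ "pre @ [False]"]) (use 3(2-5) in auto)
    then show ?case unfolding list.size(4) Nat.add_Suc_right add_0_right
      using j 3(2,3)
      by (intro while0_step[where b = "ptest x (PSym j {2})"] wp0_PSeqI wp0_PWrI[where f = "digits (pre @ True # ds)" and p = "Suc (length pre)"]
            wp0_PMvI[where f = "digits (pre @ False # ds)" and p = "Suc (length pre)"])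
        (simp add: digits_simps, simp_all add: digits_upd digits_upd[unfolded One_nat_def] del: ptest.simps wp0.simps)
  qed
  from this[of "W(j := (Suc 0, digits ds))" "[]" ds]
  have "while0 (wp0 x A' B (PSeq (PWr j 1) (PMv j MoveRight))) (ptest x (PSym j {2}))
      (wp0 x A' B (PSeq (PWr j 2) (ret j)) Q) (length ds) i (W(j := (Suc 0, digits ds)))"
    using l Q by simp
  then show ?thesis unfolding inc_prog_def using W j l B
    by (intro wp0_PSeqI[where p = "PMv j MoveRight"] wp0_PSeqI[where p = "PWhile b p" for b p] wp0_PMvI[where p = 0] wp0_PWhileI[where k = "length ds"])
      (auto simp del: wp0.simps)
qed

lemma wp0_dec:
  assumes W: "W j = (0, digits ds)" and j: "2 \<le> j" and l: "length ds \<le> l" and v: "0 < val ds"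
    and Q: "Q i (W(j := (0, digits (decr ds))))"
  shows "wp0 x A' B (dec_prog j) Q i W"
proof -
  have "while0 (wp0 x A' B (PSeq (PWr j 2) (PMv j MoveRight))) (ptest x (PSym j {1}))
      (wp0 x A' B (PSeq (PWr j 1) (ret j)) Q) (length ds) i W"
    if "W j = (Suc (length pre), digits (pre @ ds))" "length (pre @ ds) \<le> l" "0 < val ds"
      "Q i (W(j := (0, digits (pre @ decr ds))))" for W pre ds
    using that
  proof (induction ds arbitrary: pre W rule: decr.induct)
    case 1
    then show ?case by simp
  next
    case (2 ds)
    have upd: "(digits (pre @ True # ds))(Suc (length pre) := 1) = digits (pre @ False # ds)"
      by (rule digits_upd)
    have "wp0 x A' B (ret j) Q i (W(j := (Suc (length pre), (digits (pre @ True # ds))(Suc (length pre) := 1))))"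
      unfolding upd by (rule wp0_ret[of _ _ "Suc (length pre)" "pre @ False # ds"]) (use 2 j in auto)
    then show ?case using 2(1)
      by (intro while0_stop wp0_PSeqI wp0_PWrI[where f = "digits (pre @ True # ds)"])
        (simp_all add: digits_simps del: wp0.simps)
  next
    case (3 ds)
    have "while0 (wp0 x A' B (PSeq (PWr j 2) (PMv j MoveRight))) (ptest x (PSym j {1}))
      (wp0 x A' B (PSeq (PWr j 1) (ret j)) Q) (length ds) i
      (W(j := (Suc (length (pre @ [True])), digits ((pre @ [True]) @ ds))))"
      by (rule 3(1)[of _ "pre @ [True]"]) (use 3(2-5) in auto)
    then show ?case unfolding list.size(4) Nat.add_Suc_right add_0_right
      using j 3(2,3)
      by (intro while0_step[where b = "ptest x (PSym j {1})"] wp0_PSeqI wp0_PWrI[where f = "digits (pre @ False # ds)" and p = "Suc (length pre)"]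
            wp0_PMvI[where f = "digits (pre @ True # ds)" and p = "Suc (length pre)"])
        (simp add: digits_simps, simp_all add: digits_upd digits_upd[unfolded One_nat_def] del: ptest.simps wp0.simps)
  qed
  from this[of "W(j := (Suc 0, digits ds))" "[]" ds]
  have "while0 (wp0 x A' B (PSeq (PWr j 2) (PMv j MoveRight))) (ptest x (PSym j {1}))
      (wp0 x A' B (PSeq (PWr j 1) (ret j)) Q) (length ds) i (W(j := (Suc 0, digits ds)))"
    using l Q v by simp
  then show ?thesis unfolding dec_prog_def using W j l B
    by (intro wp0_PSeqI[where p = "PMv j MoveRight"] wp0_PSeqI[where p = "PWhile b p" for b p] wp0_PMvI[where p = 0] wp0_PWhileI[where k = "length ds"])
      (auto simp del: wp0.simps)
qed

text \<open>Where the head stops is left open; callers learn only that it sees 2 or the blank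
  according to the value, which is all that a test needs.\<close>

lemma wp0_scan:
  assumes W: "W j = (0, digits ds)" and j: "2 \<le> j" and l: "length ds \<le> l"
    and Q: "\<And>p. p \<le> l + 1 \<Longrightarrow> digits ds p = (if val ds = 0 then 0 else 2) \<Longrightarrow> Q i (W(j := (p, digits ds)))"
  shows "wp0 x A' B (scan j) Q i W"
proof -
  have "while0 (wp0 x A' B (PMv j MoveRight)) (ptest x (PSym j {1})) Q (length ds) i W"
    if "W j = (Suc (length pre), digits (pre @ ds))" "length (pre @ ds) \<le> l"
      "\<And>p. p \<le> l + 1 \<Longrightarrow> digits (pre @ ds) p = (if val ds = 0 then 0 else 2) \<Longrightarrow>
        Q i (W(j := (p, digits (pre @ ds))))" for W pre ds
    using that
  proof (induction ds arbitrary: pre W)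
    case Nil
    have "W(j := (Suc (length pre), digits pre)) = W" using Nil(1) by (simp add: fun_upd_idem)
    then show ?case using Nil(1,2) Nil(3)[of "Suc (length pre)"]
      by (intro while0_stop) (simp_all add: digits_simps)
  next
    case (Cons d ds)
    show ?case
    proof (cases d)
      case True
      have "W(j := (Suc (length pre), digits (pre @ d # ds))) = W" using Cons.prems(1) by (simp add: fun_upd_idem)
      then show ?thesis using True Cons.prems(1,2) Cons.prems(3)[of "Suc (length pre)"]
        by (intro while0_stop) (simp_all add: digits_simps)
    next
      case False
      have "while0 (wp0 x A' B (PMv j MoveRight)) (ptest x (PSym j {1})) Q (length ds) i
         (W(j := (Suc (length (pre @ [False])), digits ((pre @ [False]) @ ds))))"
        by (rule Cons.IH[of _ "pre @ [False]"]) (use Cons.prems False in auto)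
      then show ?thesis unfolding list.size(4) Nat.add_Suc_right add_0_right
        using j False Cons.prems(1,2)
        by (intro while0_step[where b = "ptest x (PSym j {1})"] wp0_PMvI[where p = "Suc (length pre)" and f = "digits (pre @ False # ds)"])
          (simp add: digits_simps, simp_all del: ptest.simps wp0.simps)
    qed
  qed
  from this[of "W(j := (Suc 0, digits ds))" "[]" ds]
  have "while0 (wp0 x A' B (PMv j MoveRight)) (ptest x (PSym j {1})) Q (length ds) i (W(j := (Suc 0, digits ds)))"
    using l Q by simp
  then show ?thesis unfolding scan_def using W j l B
    by (intro wp0_PSeqI wp0_PMvI[where p = 0] wp0_PWhileI[where k = "length ds"])
      (auto simp del: wp0.simps)
qed

section \<open>Simulation of register programs by tape programs\<close>

definition rep :: "nat \<Rightarrow> regs \<Rightarrow> (nat \<Rightarrow> nat) \<Rightarrow> (nat \<Rightarrow> nat \<Rightarrow> nat) \<Rightarrow> tapes \<Rightarrow> bool" where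
  "rep N \<rho> h m W \<longleftrightarrow> (\<forall>j<2. W j = (h j, m j)) \<and>
     (\<forall>r<N. \<exists>ds. W (r + 2) = (0, digits ds) \<and> val ds = \<rho> r \<and> length ds \<le> l)"

lemma rep_reg:
  assumes "rep N \<rho> h m W" "r < N"
  obtains ds where "W (r + 2) = (0, digits ds)" "val ds = \<rho> r" "length ds \<le> l"
  using assms by (auto simp: rep_def fun_upd_apply)

lemma rep_upd:
  assumes "rep N \<rho> h m W" "val ds = v" "length ds \<le> l"
  shows "rep N (\<rho>(r := v)) h m (W(r + 2 := (0, digits ds)))"
  using assms by (auto simp: rep_def fun_upd_apply)

lemma rep_test:
  assumes "rep N \<rho> h m W" "cond_ok N b"
  shows "b = Tp j S \<Longrightarrow> ptest x (PSym j S) i W = test x b \<rho> i h m"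
    "b = In S' \<Longrightarrow> ptest x (PIn S') i W = test x b \<rho> i h m"
  using assms by (auto simp: rep_def sym_def)

text \<open>Between instructions every counter head rests on its marker. The digits are hidden
  behind an existential quantifier in \<open>rep\<close>, since the same value may be stored with
  different numbers of leading zeros.\<close>

lemma wp0_tr:
  assumes "ram.wp x V B A c Q \<rho> i h m" "V < 2 ^ l" "com_ok N c" "rep N \<rho> h m W"
  shows "wp0 x A' B (tr c) (\<lambda>i' W'. \<exists>\<rho>' h' m'. rep N \<rho>' h' m' W' \<and> Q \<rho>' i' h' m') i W"
proof -
  interpret ram x V B A .
  show ?thesis using assms
  proof (induction c arbitrary: Q \<rho> i h m W)
    case Skip
    then show ?case by auto
  next
    case (Inc r)
    from Inc.prems(3,4) obtain ds where ds: "W (r + 2) = (0, digits ds)" "val ds = \<rho> r" "length ds \<le> l"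
      by (auto elim: rep_reg)
    have l: "length (incr ds) \<le> l" using Inc.prems ds by (intro length_incr_le) auto
    have "rep N (\<rho>(r := Suc (\<rho> r))) h m (W(r + 2 := (0, digits (incr ds))))"
      using Inc.prems ds l by (intro rep_upd) auto
    then show ?case unfolding tr.simps
      by (intro wp0_inc[where j = "r + 2" and ds = ds]) (use Inc.prems ds l in auto)
  next
    case (Dec r)
    from Dec.prems(3,4) obtain ds where ds: "W (r + 2) = (0, digits ds)" "val ds = \<rho> r" "length ds \<le> l"
      by (auto elim: rep_reg)
    have "rep N (\<rho>(r := \<rho> r - 1)) h m (W(r + 2 := (0, digits (decr ds))))"
      using Dec.prems ds by (intro rep_upd) (auto simp: val_decr)
    then show ?case unfolding tr.simps
      by (intro wp0_dec[where j = "r + 2" and ds = ds]) (use Dec.prems ds in auto)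
  next
    case (InM d)
    then show ?case by auto
  next
    case (Wr j a)
    have "rep N \<rho> h (m(j := (m j)(h j := a))) (W(j := (fst (W j), (snd (W j))(fst (W j) := a))))"
      using Wr by (auto simp: rep_def fun_upd_apply)
    then show ?case using Wr by auto
  next
    case (Mv j d)
    have "rep N \<rho> (h(j := shift d (h j))) m (W(j := (shift d (fst (W j)), snd (W j))))"
      using Mv by (auto simp: rep_def fun_upd_apply)
    moreover have "fst (W j) = h j" using Mv by (auto simp: rep_def fun_upd_apply)
    ultimately show ?case using Mv by auto
  next
    case (Seq c1 c2)
    have "wp0 x A' B (tr c1) (\<lambda>i' W'. \<exists>\<rho>' h' m'. rep N \<rho>' h' m' W' \<and> wp c2 Q \<rho>' i' h' m') i W"
      using Seq by simp
    then show ?case unfolding tr.simps wp0.simps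
      by (rule wp0_mono) (use Seq in auto)
  next
    case (IfC b c1 c2)
    show ?case
    proof (cases b)
      case (NZ r)
      with IfC.prems(3,4) obtain ds where ds: "W (r + 2) = (0, digits ds)" "val ds = \<rho> r" "length ds \<le> l"
        by (auto elim: rep_reg)
      have "W(r + 2 := (0, digits ds)) = W" using ds(1) by (rule fun_upd_idem)
      then have "wp0 x A' B (PIf (PSym (r + 2) {2}) (PSeq (ret (r + 2)) (tr c1)) (PSeq (ret (r + 2)) (tr c2)))
          (\<lambda>i' W'. \<exists>\<rho>' h' m'. rep N \<rho>' h' m' W' \<and> Q \<rho>' i' h' m') i (W(r + 2 := (p, digits ds)))"
        if "p \<le> l + 1" "digits ds p = (if val ds = 0 then 0 else 2)" for p
        using that IfC NZ ds
        by (auto simp: sym_def intro!: wp0_ret[of _ "Suc (Suc r)" p ds] split: if_splits)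
      then show ?thesis using NZ ds by (auto intro!: wp0_scan)
    next
      case (In S)
      then show ?thesis using IfC by (auto split: if_splits)
    next
      case (Tp j S)
      then show ?thesis using IfC rep_test(1)[OF IfC.prems(4)] by (auto split: if_splits)
    qed
  next
    case (WhileC b c)
    let ?Q = "\<lambda>i' W'. \<exists>\<rho>' h' m'. rep N \<rho>' h' m' W' \<and> Q \<rho>' i' h' m'"
    from WhileC.prems(1) obtain k where k: "k \<le> B" "while1 (wp c) (test x b) Q k \<rho> i h m"
      by auto
    show ?case
    proof (cases b)
      case (NZ r)
      let ?b = "PSeq (ret (r + 2)) (PSeq (tr c) (scan (r + 2)))"
      \<comment> \<open>At each test the counter head stands at the place \<open>p\<close> where
        \<open>scan\<close> stopped, whereas \<open>rep\<close> describes the tapes with that head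
        back on its marker.\<close>
      have loop: "while0 (wp0 x A' B ?b) (ptest x (PSym (r + 2) {2})) (wp0 x A' B (ret (r + 2)) ?Q) k i (W(r + 2 := (p, digits ds)))"
        if "while1 (wp c) (test x b) Q k \<rho> i h m" "rep N \<rho> h m W" "W (r + 2) = (0, digits ds)"
          "val ds = \<rho> r" "length ds \<le> l" "p \<le> l + 1" "digits ds p = (if val ds = 0 then 0 else 2)"
        for k \<rho> i h m W p ds
        using that
      proof (induction k arbitrary: \<rho> i h m W p ds)
        case 0
        have "W(r + 2 := (0, digits ds)) = W" using 0(3) by (rule fun_upd_idem)
        then show ?case using 0 NZ
          by (auto simp: sym_def intro!: wp0_ret[of _ "Suc (Suc r)" p ds]) blast
      next
        case (Suc k)
        have W: "W(r + 2 := (0, digits ds)) = W" using Suc.prems(3) by (rule fun_upd_idem)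
        show ?case
        proof (cases "\<rho> r = 0")
          case True
          then show ?thesis using Suc.prems NZ W
            by (auto simp: sym_def intro!: wp0_ret[of _ "Suc (Suc r)" p ds]) blast
        next
          case False
          have "wp0 x A' B (tr c) (\<lambda>i' W'. \<exists>\<rho>' h' m'. rep N \<rho>' h' m' W' \<and>
              while1 (wp c) (test x b) Q k \<rho>' i' h' m') i W"
            using Suc.prems False NZ WhileC.prems by (intro WhileC.IH) auto
          then have "wp0 x A' B (tr c) (wp0 x A' B (scan (r + 2)) (while0 (wp0 x A' B ?b) (ptest x (PSym (r + 2) {2}))
              (wp0 x A' B (ret (r + 2)) ?Q) k)) i W"
          proof (rule wp0_mono, elim exE conjE)
            fix i' W' \<rho>' h' m' assume r': "rep N \<rho>' h' m' W'" "while1 (wp c) (test x b) Q k \<rho>' i' h' m'"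
            obtain ds' where ds': "W' (r + 2) = (0, digits ds')" "val ds' = \<rho>' r" "length ds' \<le> l"
              using rep_reg[OF r'(1)] WhileC.prems(3) NZ by auto
            show "wp0 x A' B (scan (r + 2)) (while0 (wp0 x A' B ?b) (ptest x (PSym (r + 2) {2}))
              (wp0 x A' B (ret (r + 2)) ?Q) k) i' W'"
            proof (rule wp0_scan[where j = "r + 2" and ds = ds'])
              fix p assume "p \<le> l + 1" "digits ds' p = (if val ds' = 0 then 0 else 2)"
              from Suc.IH[OF r'(2,1) ds' this]
              show "while0 (wp0 x A' B ?b) (ptest x (PSym (r + 2) {2})) (wp0 x A' B (ret (r + 2)) ?Q) k i'
                (W'(r + 2 := (p, digits ds')))" .
            qed (use ds' in auto)
          qed
          then have rest: "wp0 x A' B (PSeq (tr c) (scan (r + 2))) (while0 (wp0 x A' B ?b)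
              (ptest x (PSym (r + 2) {2})) (wp0 x A' B (ret (r + 2)) ?Q) k) i W"
            by (rule wp0_PSeqI)
          have "wp0 x A' B ?b (while0 (wp0 x A' B ?b) (ptest x (PSym (r + 2) {2}))
              (wp0 x A' B (ret (r + 2)) ?Q) k) i (W(r + 2 := (p, digits ds)))"
          proof (rule wp0_PSeqI, rule wp0_ret[where j = "r + 2" and p = p and ds = ds])
            show "wp0 x A' B (PSeq (tr c) (scan (r + 2))) (while0 (wp0 x A' B ?b)
              (ptest x (PSym (r + 2) {2})) (wp0 x A' B (ret (r + 2)) ?Q) k) i
              ((W(r + 2 := (p, digits ds)))(r + 2 := (0, digits ds)))"
              unfolding fun_upd_upd W by (rule rest)
          qed (use Suc.prems in simp_all)
          then show ?thesis
            by (intro while0_step) (use Suc.prems False in \<open>simp\<close>)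
        qed
      qed
      from NZ WhileC.prems(3,4) obtain ds where ds: "W (r + 2) = (0, digits ds)" "val ds = \<rho> r" "length ds \<le> l"
        by (auto elim: rep_reg)
      have "wp0 x A' B (scan (r + 2)) (wp0 x A' B (PWhile (PSym (r + 2) {2}) ?b) (wp0 x A' B (ret (r + 2)) ?Q)) i W"
        by (rule wp0_scan[where j = "r + 2" and ds = ds]) (use ds loop[OF k(2) WhileC.prems(4) ds] k(1) in auto)
      then show ?thesis using NZ by simp
    next
      case (In S)
      have "while0 (wp0 x A' B (tr c)) (ptest x (PIn S)) ?Q k i W"
        if "while1 (wp c) (test x b) Q k \<rho> i h m" "rep N \<rho> h m W" for k \<rho> i h m W
        using that
      proof (induction k arbitrary: \<rho> i h m W)
        case 0
        then show ?case using In by auto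
      next
        case (Suc k)
        have loop: "wp0 x A' B (tr c) (while0 (wp0 x A' B (tr c)) (ptest x (PIn S)) ?Q k) i W"
          if "test x b \<rho> i h m"
          by (rule wp0_mono[OF WhileC.IH[of "while1 (wp c) (test x b) Q k" \<rho> i h m W]])
            (use Suc that WhileC.prems in \<open>auto simp del: ptest.simps\<close>)
        show ?case
        proof (cases "test x b \<rho> i h m")
          case True
          then have "ptest x (PIn S) i W" using In by simp
          then show ?thesis by (rule while0_step) (rule loop[OF True])
        next
          case False
          then have "\<not> ptest x (PIn S) i W" using In by simp
          moreover have "?Q i W" using Suc.prems False by auto
          ultimately show ?thesis by (rule while0_stop)
        qed
      qed
      then show ?thesis using k WhileC.prems In by auto
    next
      case (Tp j S)
      have "while0 (wp0 x A' B (tr c)) (ptest x (PSym j S)) ?Q k i W"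
        if "while1 (wp c) (test x b) Q k \<rho> i h m" "rep N \<rho> h m W" for k \<rho> i h m W
        using that
      proof (induction k arbitrary: \<rho> i h m W)
        case 0
        then show ?case using Tp rep_test(1)[OF 0(2), of b j S i] WhileC.prems by auto
      next
        case (Suc k)
        have loop: "wp0 x A' B (tr c) (while0 (wp0 x A' B (tr c)) (ptest x (PSym j S)) ?Q k) i W"
          if "test x b \<rho> i h m"
          by (rule wp0_mono[OF WhileC.IH[of "while1 (wp c) (test x b) Q k" \<rho> i h m W]])
            (use Suc that WhileC.prems in \<open>auto simp del: ptest.simps\<close>)
        show ?case
        proof (cases "test x b \<rho> i h m")
          case True
          then have "ptest x (PSym j S) i W" using Tp rep_test(1)[OF Suc.prems(2), of b j S i] WhileC.prems by simp
          then show ?thesis by (rule while0_step) (rule loop[OF True])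
        next
          case False
          then have "\<not> ptest x (PSym j S) i W" using Tp rep_test(1)[OF Suc.prems(2), of b j S i] WhileC.prems by simp
          moreover have "?Q i W" using Suc.prems False by auto
          ultimately show ?thesis by (rule while0_stop)
        qed
      qed
      then show ?thesis using k WhileC.prems Tp by auto
    qed
  qed
qed

lemma wp0_prologue:
  assumes "rep N (\<lambda>_. 0) (\<lambda>_. 0) (\<lambda>_ _. 0) (\<lambda>j. (0, if 2 \<le> j \<and> j < N + 2 then digits [] else (\<lambda>_. 0))) \<Longrightarrow> 
    Q i (\<lambda>j. (0, if 2 \<le> j \<and> j < N + 2 then digits [] else (\<lambda>_. 0)))"
  shows "wp0 x A' B (prologue N) Q i (\<lambda>_. (0, \<lambda>_. 0))"
proof -
  have "wp0 x A' B (prologue n) Q i (\<lambda>_. (0, \<lambda>_. 0))"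
    if "Q i (\<lambda>j. (0, if 2 \<le> j \<and> j < n + 2 then digits [] else (\<lambda>_. 0)))" for n Q
    using that
  proof (induction n arbitrary: Q)
    case 0
    have "(\<lambda>j. (0::nat, if 2 \<le> j \<and> j < (0::nat) + 2 then digits [] else (\<lambda>_. 0))) = (\<lambda>_. (0, \<lambda>_. 0))"
      by (rule ext) auto
    then show ?case using 0 by simp
  next
    case (Suc n)
    have "(\<lambda>j. (0::nat, if 2 \<le> j \<and> j < n + 2 then digits [] else (\<lambda>_. 0)))(n + 2 := (0, (\<lambda>_. 0)(0 := 3)))
      = (\<lambda>j. (0, if 2 \<le> j \<and> j < Suc n + 2 then digits [] else (\<lambda>_. 0)))"
      by (auto simp: fun_eq_iff digits_def fun_upd_apply)
    then show ?case using Suc.prems by (auto intro!: Suc.IH)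
  qed
  moreover have "rep N (\<lambda>_. 0) (\<lambda>_. 0) (\<lambda>_ _. 0) (\<lambda>j. (0, if 2 \<le> j \<and> j < N + 2 then digits [] else (\<lambda>_. 0)))"
    by (auto simp: rep_def intro!: exI[of _ "[]"])
  ultimately show ?thesis using assms by auto
qed

end

definition machine_of :: "nat \<Rightarrow> com \<Rightarrow> symbol machine" where
  "machine_of N c = compile (N + 2) 10 (PSeq (prologue N) (tr c))"

lemma prog_ok_prologue: "n \<le> N \<Longrightarrow> prog_ok (N + 2) 10 (prologue n)"
  by (induction n) auto

lemma wf_machine_of: "com_ok N c \<Longrightarrow> wf_machine (machine_of N c)"
  unfolding machine_of_def
  by (intro wf_machine_compile) (simp_all add: prog_ok_prologue prog_ok_tr del: add_2_eq_Suc')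

text \<open>A counter uses the marker cell, \<open>l\<close> digits and one blank beyond them, which
  gives \<open>l + 2\<close> cells for each of the \<open>N\<close> registers.\<close>

lemma machine_of_decides:
  assumes wp: "ram.wp x V B A c (\<lambda>\<rho> i h m. m 0 (h 0) = 1 \<longleftrightarrow> ans) (\<lambda>_. 0) 0 (\<lambda>_. 0) (\<lambda>_ _. 0)"
    and bounds: "V < 2 ^ l" "l + 1 \<le> B" and ok: "com_ok N c"
  shows "decides_within (machine_of N c) x ans
    (poly (ptime (PSeq (prologue N) (tr c)) + 1) B) (real (A 0 + A 1 + 2 + N * (l + 2)))"
proof -
  interpret binary_counters x A B l by unfold_locales (rule bounds)
  have "wp0 x A' B (PSeq (prologue N) (tr c)) (\<lambda>i W. sym (W 0) = 1 \<longleftrightarrow> ans) 0 (\<lambda>_. (0, \<lambda>_. 0))"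
    unfolding wp0.simps
  proof (rule wp0_prologue)
    let ?W = "\<lambda>j. (0, if 2 \<le> j \<and> j < N + 2 then digits [] else (\<lambda>_. 0))"
    assume "rep N (\<lambda>_. 0) (\<lambda>_. 0) (\<lambda>_ _. 0) ?W"
    from wp0_tr[OF wp bounds(1) ok this]
    show "wp0 x A' B (tr c) (\<lambda>i W. sym (W 0) = 1 \<longleftrightarrow> ans) 0 ?W"
      by (rule wp0_mono) (auto simp: rep_def)
  qed
  from compile_decides[OF this, of "N + 2" 10] prog_ok_prologue[of N N] prog_ok_tr[OF ok]
  have "decides_within (machine_of N c) x ans (poly (ptime (PSeq (prologue N) (tr c)) + 1) B)
      (real (\<Sum>r<N + 2. A' r + 1))"
    by (simp only: machine_of_def prog_ok.simps)
  moreover have "(\<Sum>r<N + 2. A' r + 1) = A 0 + A 1 + 2 + N * (l + 2)"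
  proof -
    have "{..<N + 2} = {0, 1} \<union> {2..<N + 2}" by auto
    then have "(\<Sum>r<N + 2. A' r + 1) = (\<Sum>r\<in>{0, 1}. A' r + 1) + (\<Sum>r\<in>{2..<N+2}. A' r + 1)"
      by (simp only:) (rule sum.union_disjoint, auto)
    then show ?thesis by simp
  qed
  ultimately show ?thesis by (simp only:)
qed

section \<open>Subroutines\<close>

text \<open>
  \<open>rRoot\<close>, \<open>rPU\<close> and \<open>rPV\<close> point to the tree and just before the vectors of \<open>u\<close> and \<open>v\<close> on the input;
  \<open>rC\<close>, \<open>rB\<close> and \<open>rKK\<close> describe the current call: the position of its node, the cell before its marks
  and the binary logarithm of the length bound.
\<close>

abbreviation (input) "rN \<equiv> 0 :: nat"
abbreviation (input) "rK0 \<equiv> 1 :: nat"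
abbreviation (input) "rRoot \<equiv> 2 :: nat"
abbreviation (input) "rPU \<equiv> 3 :: nat"
abbreviation (input) "rPV \<equiv> 4 :: nat"
abbreviation (input) "rT \<equiv> 5 :: nat"
abbreviation (input) "rP \<equiv> 6 :: nat"
abbreviation (input) "rM \<equiv> 7 :: nat"
abbreviation (input) "rY \<equiv> 8 :: nat"
abbreviation (input) "rCY \<equiv> 9 :: nat"
abbreviation (input) "rK \<equiv> 10 :: nat"
abbreviation (input) "rX \<equiv> 11 :: nat"
abbreviation (input) "rCX \<equiv> 12 :: nat"
abbreviation (input) "rZ \<equiv> 13 :: nat"
abbreviation (input) "rCZ \<equiv> 14 :: nat"
abbreviation (input) "rC \<equiv> 15 :: nat"
abbreviation (input) "rB \<equiv> 16 :: nat"
abbreviation (input) "rKK \<equiv> 17 :: nat"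
abbreviation (input) "rC0 \<equiv> 18 :: nat"
abbreviation (input) "rB0 \<equiv> 19 :: nat"
abbreviation (input) "rD \<equiv> 20 :: nat"
abbreviation (input) "rE \<equiv> 21 :: nat"
abbreviation (input) "rW \<equiv> 22 :: nat"
abbreviation (input) "rF \<equiv> 23 :: nat"

definition MOVE :: "nat \<Rightarrow> nat \<Rightarrow> com" where
  "MOVE a b = WhileC (NZ a) (Dec a ;; Inc b)"

text \<open>The \<open>Skip\<close> gives the loop the shape \<open>Dec r ;; c\<close> that the rule
  \<open>wp_count\<close> expects.\<close>

definition CLR :: "nat \<Rightarrow> com" where
  "CLR a = WhileC (NZ a) (Dec a ;; Skip)"

text \<open>A register can be read only by counting it down. Since \<open>a\<close> has to survive,
  a second copy goes to \<open>rT\<close>, from which \<open>a\<close> is refilled.\<close>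

definition ADD :: "nat \<Rightarrow> nat \<Rightarrow> com" where
  "ADD a b = WhileC (NZ a) (Dec a ;; Inc b ;; Inc rT) ;; MOVE rT a"

definition REW :: com where
  "REW = WhileC (In (- {LeftEnd})) (InM MoveLeft)"

definition GOTO :: "nat \<Rightarrow> com" where
  "GOTO a = REW ;; WhileC (NZ a) (Dec a ;; Inc rT ;; InM MoveRight) ;; MOVE rT a"

text \<open>The marker 9 serves as origin. Cell 0 never holds a mark, so the value \<open>a\<close>
  leads to cell \<open>a + 1\<close>.\<close>

definition TGOTO :: "nat \<Rightarrow> com" where
  "TGOTO a = WhileC (Tp 1 (- {9})) (Mv 1 MoveLeft) ;; Mv 1 MoveRight ;;
     WhileC (NZ a) (Dec a ;; Inc rT ;; Mv 1 MoveRight) ;; MOVE rT a"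

definition PEEK :: "nat \<Rightarrow> nat \<Rightarrow> com" where
  "PEEK a b = ADD a rP ;; ADD b rP ;; GOTO rP ;; CLR rP ;; InM MoveRight"

definition FOR :: "nat \<Rightarrow> nat \<Rightarrow> nat \<Rightarrow> com \<Rightarrow> com" where
  "FOR y l c p = ADD l c ;; WhileC (NZ c) (Dec c ;; p ;; Inc y) ;; CLR y"

definition TESTBIT :: "nat \<Rightarrow> nat \<Rightarrow> com" where
  "TESTBIT a y = IfC (NZ rM) Skip (PEEK a y ;; IfC (In {Sym One}) (Inc rM) Skip)"

definition MEM :: "nat \<Rightarrow> nat \<Rightarrow> com" where
  "MEM c y = TESTBIT c y ;; TESTBIT rPU y ;; TESTBIT rPV y"

text \<open>The rank of a vertex in the enlarged bag is the offset of its mark. With ranks instead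
  of vertex numbers a bag takes as many cells as it has vertices.\<close>

definition RANK :: "nat \<Rightarrow> nat \<Rightarrow> nat \<Rightarrow> com" where
  "RANK c y k = FOR rY y rCY (MEM c rY ;; MOVE rM k)"

definition ADDR :: "nat \<Rightarrow> nat \<Rightarrow> nat \<Rightarrow> com" where
  "ADDR c b y = ADD b rK ;; RANK c y rK ;; TGOTO rK ;; CLR rK"

lemma input_cell_LeftEnd: "input_cell x i = LeftEnd \<longleftrightarrow> i = 0"
  by (simp add: input_cell_def)

section \<open>Weakest preconditions of the elementary subroutines\<close>

locale ram_bounds = ram +
  assumes VB: "V \<le> B" and LB: "length x + 1 \<le> B"
begin

text \<open>Keep the simplifier out of the postconditions.\<close>

lemma while1_weak_cong [cong]:
  "k = k' \<Longrightarrow> \<rho> = \<rho>' \<Longrightarrow> i = i' \<Longrightarrow> h = h' \<Longrightarrow> m = m' \<Longrightarrow> while1 F b Q k \<rho> i h m = while1 F b Q k' \<rho>' i' h' m'"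
  by simp

lemma wp_weak_cong [cong]:
  "\<rho> = \<rho>' \<Longrightarrow> i = i' \<Longrightarrow> h = h' \<Longrightarrow> m = m' \<Longrightarrow> wp c Q \<rho> i h m = wp c Q \<rho>' i' h' m'"
  by simp

lemma wp_SeqI: "wp p (wp q Q) \<rho> i h m \<Longrightarrow> wp (p ;; q) Q \<rho> i h m"
  by simp

lemma wp_WhileI: "while1 (wp c) (test x b) Q k \<rho> i h m \<Longrightarrow> k \<le> B \<Longrightarrow> wp (WhileC b c) Q \<rho> i h m"
  by auto

text \<open>The number of rounds is the initial value of the counter, hence at most \<open>V\<close>
  and thus at most \<open>B\<close>: countdown loops meet the round bound without a separate
  argument.\<close>

lemma wp_count:
  assumes "\<rho> r = N" "N \<le> V" "I 0 \<rho> i h m"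
    and body: "\<And>j \<rho> i h m. \<lbrakk>j < N; I j \<rho> i h m; \<rho> r = N - j\<rbrakk> \<Longrightarrow>
      wp c (\<lambda>\<rho>' i' h' m'. I (Suc j) \<rho>' i' h' m' \<and> \<rho>' r = N - Suc j) (\<rho>(r := N - Suc j)) i h m"
    and Q: "\<And>\<rho> i h m. I N \<rho> i h m \<Longrightarrow> \<rho> r = 0 \<Longrightarrow> Q \<rho> i h m"
  shows "wp (WhileC (NZ r) (Dec r ;; c)) Q \<rho> i h m"
proof -
  have "while1 (wp (Dec r ;; c)) (test x (NZ r)) Q k \<rho> i h m"
    if "k \<le> N" "\<rho> r = k" "I (N - k) \<rho> i h m" for k \<rho> i h m
    using that
  proof (induction k arbitrary: \<rho> i h m)
    case 0
    then show ?case using Q by simp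
  next
    case (Suc k)
    have "wp c (\<lambda>\<rho>' i' h' m'. I (Suc (N - Suc k)) \<rho>' i' h' m' \<and> \<rho>' r = N - Suc (N - Suc k))
        (\<rho>(r := N - Suc (N - Suc k))) i h m"
      using Suc.prems by (intro body) auto
    then have "wp c (while1 (wp (Dec r ;; c)) (test x (NZ r)) Q k) (\<rho>(r := N - Suc (N - Suc k))) i h m"
      by (rule wp_mono) (use Suc.IH Suc.prems in \<open>auto simp: Suc_diff_Suc\<close>)
    moreover have "N - Suc (N - Suc k) = \<rho> r - 1" using Suc.prems by simp
    ultimately show ?case using Suc.prems(2) by (simp del: One_nat_def)
  qed
  from this[of N \<rho> i h m] show ?thesis using assms(1-3) VB by (intro wp_WhileI[where k = N]) auto
qed

lemma wp_MOVE:
  assumes "a \<noteq> b" "\<rho> b + \<rho> a \<le> V" "Q (\<rho>(a := 0, b := \<rho> b + \<rho> a)) i h m"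
  shows "wp (MOVE a b) Q \<rho> i h m"
  unfolding MOVE_def
proof (rule wp_count[where I = "\<lambda>j \<rho>' i' h' m'. \<rho>' = \<rho>(a := \<rho> a - j, b := \<rho> b + j) \<and> i' = i \<and> h' = h \<and> m' = m"])
  fix j \<rho>' i' h' m'
  assume "j < \<rho> a" "\<rho>' = \<rho>(a := \<rho> a - j, b := \<rho> b + j) \<and> i' = i \<and> h' = h \<and> m' = m"
  then show "wp (Inc b) (\<lambda>\<rho>' i' h' m'. (\<rho>' = \<rho>(a := \<rho> a - Suc j, b := \<rho> b + Suc j) \<and> i' = i \<and> h' = h \<and> m' = m)
     \<and> \<rho>' a = \<rho> a - Suc j) (\<rho>'(a := \<rho> a - Suc j)) i' h' m'"
    using assms(1,2) by (auto simp: fun_eq_iff fun_upd_apply)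
qed (use assms in \<open>auto simp: fun_upd_idem\<close>)

lemma wp_CLR:
  assumes "\<rho> a \<le> V" "Q (\<rho>(a := 0)) i h m"
  shows "wp (CLR a) Q \<rho> i h m"
  unfolding CLR_def
  by (rule wp_count[where I = "\<lambda>j \<rho>' i' h' m'. \<rho>' = \<rho>(a := \<rho> a - j) \<and> i' = i \<and> h' = h \<and> m' = m"])
    (use assms in \<open>auto simp: fun_upd_idem\<close>)

lemma wp_ADD:
  assumes "a \<noteq> b" "a \<noteq> rT" "b \<noteq> rT" "\<rho> rT = 0" "\<rho> b + \<rho> a \<le> V" "Q (\<rho>(b := \<rho> b + \<rho> a)) i h m"
  shows "wp (ADD a b) Q \<rho> i h m"
  unfolding ADD_def wp.simps(7)
proof (rule wp_count[where I = "\<lambda>j \<rho>' i' h' m'. \<rho>' = \<rho>(a := \<rho> a - j, b := \<rho> b + j, rT := j) \<and> i' = i \<and> h' = h \<and> m' = m"])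
  fix j \<rho>' i' h' m'
  assume "j < \<rho> a" "\<rho>' = \<rho>(a := \<rho> a - j, b := \<rho> b + j, rT := j) \<and> i' = i \<and> h' = h \<and> m' = m"
  then show "wp (Inc b;; Inc rT) (\<lambda>\<rho>' i' h' m'. (\<rho>' = \<rho>(a := \<rho> a - Suc j, b := \<rho> b + Suc j, rT := Suc j) \<and> i' = i \<and> h' = h \<and> m' = m)
     \<and> \<rho>' a = \<rho> a - Suc j) (\<rho>'(a := \<rho> a - Suc j)) i' h' m'"
    using assms(1-5) by (auto simp: fun_eq_iff fun_upd_apply)
next
  fix \<rho>' i' h' m'
  assume 1: "\<rho>' = \<rho>(a := \<rho> a - \<rho> a, b := \<rho> b + \<rho> a, rT := \<rho> a) \<and> i' = i \<and> h' = h \<and> m' = m"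
  have "\<rho>'(rT := 0, a := \<rho>' a + \<rho>' rT) = \<rho>(b := \<rho> b + \<rho> a)"
    using 1 assms(1-4) by (auto simp: fun_eq_iff fun_upd_apply)
  then show "wp (MOVE rT a) Q \<rho>' i' h' m'"
    by (intro wp_MOVE) (use 1 assms in auto)
qed (use assms in \<open>auto simp: fun_upd_idem fun_upd_twist\<close>)

lemma wp_REW:
  assumes "i \<le> length x + 1" "Q \<rho> 0 h m"
  shows "wp REW Q \<rho> i h m"
proof -
  have "while1 (wp (InM MoveLeft)) (test x (In (- {LeftEnd}))) Q i \<rho> i h m"
    if "i \<le> length x + 1" for i
    using that
  proof (induction i)
    case 0
    then show ?case using assms(2) by (simp add: input_cell_LeftEnd)
  next
    case (Suc i)
    then have "min (length x + 1) (shift MoveLeft (Suc i)) = i" by simp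
    then have "wp (InM MoveLeft) (while1 (wp (InM MoveLeft)) (test x (In (- {LeftEnd}))) Q i) \<rho> (Suc i) h m"
      using Suc by (simp only: wp.simps)
    then show ?case by (simp only: while1.simps) (simp add: input_cell_LeftEnd)
  qed
  then show ?thesis using assms(1) LB unfolding REW_def by (intro wp_WhileI[where k = i]) auto
qed

lemma wp_GOTO:
  assumes "a \<noteq> rT" "\<rho> rT = 0" "\<rho> a \<le> V" "i \<le> length x + 1" "Q \<rho> (min (length x + 1) (\<rho> a)) h m"
  shows "wp (GOTO a) Q \<rho> i h m"
  unfolding GOTO_def wp.simps(7)
proof (rule wp_REW[OF assms(4)], rule wp_count[where I = "\<lambda>j \<rho>' i' h' m'. \<rho>' = \<rho>(a := \<rho> a - j, rT := j) \<and>
    i' = min (length x + 1) j \<and> h' = h \<and> m' = m"])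
  fix j \<rho>' i' h' m'
  assume "j < \<rho> a" "\<rho>' = \<rho>(a := \<rho> a - j, rT := j) \<and> i' = min (length x + 1) j \<and> h' = h \<and> m' = m"
  then show "wp (Inc rT ;; InM MoveRight) (\<lambda>\<rho>' i' h' m'. (\<rho>' = \<rho>(a := \<rho> a - Suc j, rT := Suc j) \<and>
      i' = min (length x + 1) (Suc j) \<and> h' = h \<and> m' = m)
     \<and> \<rho>' a = \<rho> a - Suc j) (\<rho>'(a := \<rho> a - Suc j)) i' h' m'"
    using assms(1-3) by (auto simp: fun_eq_iff fun_upd_apply)
next
  fix \<rho>' i' h' m'
  assume 1: "\<rho>' = \<rho>(a := \<rho> a - \<rho> a, rT := \<rho> a) \<and> i' = min (length x + 1) (\<rho> a) \<and> h' = h \<and> m' = m"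
  have "\<rho>'(rT := 0, a := \<rho>' a + \<rho>' rT) = \<rho>"
    using 1 assms(1-4) by (auto simp: fun_eq_iff fun_upd_apply)
  then show "wp (MOVE rT a) Q \<rho>' i' h' m'"
    by (intro wp_MOVE) (use 1 assms in auto)
qed (use assms in \<open>auto simp: fun_upd_idem\<close>)

lemma wp_PEEK:
  assumes "a \<notin> {rT, rP}" "b \<notin> {rT, rP}" "\<rho> rT = 0" "\<rho> rP = 0" "\<rho> a + \<rho> b \<le> V"
    "\<rho> a + \<rho> b \<le> length x" "i \<le> length x + 1" "Q \<rho> (Suc (\<rho> a + \<rho> b)) h m"
  shows "wp (PEEK a b) Q \<rho> i h m"
  unfolding PEEK_def wp.simps(7)
  by (intro wp_ADD wp_GOTO wp_CLR) (use assms in \<open>auto simp: fun_upd_idem\<close>)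

text \<open>The invariant is evaluated with both loop variables reset to 0. A body that restores all
  other registers is then described simply by equality with the initial register contents.\<close>

lemma wp_FOR:
  assumes "\<rho> c = 0" "\<rho> y = 0" "\<rho> rT = 0" "y \<noteq> c" "l \<noteq> c" "l \<noteq> rT" "c \<noteq> rT" "\<rho> l = N" "N \<le> V" "I 0 \<rho> i h m"
    and body: "\<And>j \<rho> i h m. \<lbrakk>j < N; I j \<rho> i h m; \<rho> c = 0; \<rho> y = 0\<rbrakk> \<Longrightarrow>
      wp p (\<lambda>\<rho>' i' h' m'. \<rho>' c = N - Suc j \<and> \<rho>' y = j \<and> I (Suc j) (\<rho>'(c := 0, y := 0)) i' h' m')
        (\<rho>(c := N - Suc j, y := j)) i h m"
    and Q: "\<And>\<rho> i h m. I N \<rho> i h m \<Longrightarrow> \<rho> c = 0 \<Longrightarrow> \<rho> y = 0 \<Longrightarrow> Q \<rho> i h m"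
  shows "wp (FOR y l c p) Q \<rho> i h m"
  unfolding FOR_def wp.simps(7)
proof (rule wp_ADD)
  show "wp (WhileC (NZ c) (Dec c ;; p ;; Inc y)) (wp (CLR y) Q) (\<rho>(c := \<rho> c + \<rho> l)) i h m"
  proof (rule wp_count[where N = N and I = "\<lambda>j \<rho>' i' h' m'. \<rho>' c = N - j \<and> \<rho>' y = j \<and> I j (\<rho>'(c := 0, y := 0)) i' h' m'"])
    fix j \<rho>' i' h' m'
    assume j: "j < N" "\<rho>' c = N - j \<and> \<rho>' y = j \<and> I j (\<rho>'(c := 0, y := 0)) i' h' m'"
    have "wp p (\<lambda>\<rho>' i' h' m'. \<rho>' c = N - Suc j \<and> \<rho>' y = j \<and> I (Suc j) (\<rho>'(c := 0, y := 0)) i' h' m')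
        ((\<rho>'(c := 0, y := 0))(c := N - Suc j, y := j)) i' h' m'"
      by (rule body) (use j assms(4) in auto)
    moreover have "(\<rho>'(c := 0, y := 0))(c := N - Suc j, y := j) = \<rho>'(c := N - Suc j)"
      using j assms(4) by (auto simp: fun_eq_iff fun_upd_apply)
    ultimately have "wp p (\<lambda>\<rho>' i' h' m'. \<rho>' c = N - Suc j \<and> \<rho>' y = j \<and> I (Suc j) (\<rho>'(c := 0, y := 0)) i' h' m')
        (\<rho>'(c := N - Suc j)) i' h' m'" by simp
    then have "wp p (wp (Inc y) (\<lambda>\<rho>' i' h' m'. (\<rho>' c = N - Suc j \<and> \<rho>' y = Suc j \<and> I (Suc j) (\<rho>'(c := 0, y := 0)) i' h' m')
        \<and> \<rho>' c = N - Suc j)) (\<rho>'(c := N - Suc j)) i' h' m'"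
    proof (rule wp_mono)
      fix \<rho>1 i1 h1 m1
      assume 1: "\<rho>1 c = N - Suc j \<and> \<rho>1 y = j \<and> I (Suc j) (\<rho>1(c := 0, y := 0)) i1 h1 m1"
      have "(\<rho>1(y := Suc j))(c := 0, y := 0) = \<rho>1(c := 0, y := 0)"
        using assms(4) by (auto simp: fun_eq_iff fun_upd_apply)
      then show "wp (Inc y) (\<lambda>\<rho>' i' h' m'. (\<rho>' c = N - Suc j \<and> \<rho>' y = Suc j \<and> I (Suc j) (\<rho>'(c := 0, y := 0)) i' h' m')
        \<and> \<rho>' c = N - Suc j) \<rho>1 i1 h1 m1"
        using 1 j assms(4,9) by simp
    qed
    then show "wp (p ;; Inc y) (\<lambda>\<rho>' i' h' m'. (\<rho>' c = N - Suc j \<and> \<rho>' y = Suc j \<and> I (Suc j) (\<rho>'(c := 0, y := 0)) i' h' m')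
        \<and> \<rho>' c = N - Suc j) (\<rho>'(c := N - Suc j)) i' h' m'"
      by (rule wp_SeqI)
  next
    fix \<rho>' i' h' m'
    assume j: "\<rho>' c = N - N \<and> \<rho>' y = N \<and> I N (\<rho>'(c := 0, y := 0)) i' h' m'"
    have "\<rho>'(c := 0, y := 0) = \<rho>'(y := 0)" using j assms(4) by (auto simp: fun_eq_iff fun_upd_apply)
    then have "I N (\<rho>'(y := 0)) i' h' m'" using j by simp
    then show "wp (CLR y) Q \<rho>' i' h' m'"
      using Q[of "\<rho>'(y := 0)" i' h' m'] j assms(4,9) by (intro wp_CLR) auto
  next
    have "(\<rho>(c := \<rho> c + \<rho> l))(c := 0, y := 0) = \<rho>"
      using assms by (auto simp: fun_eq_iff fun_upd_apply)
    then show "(\<rho>(c := \<rho> c + \<rho> l)) c = N - 0 \<and> (\<rho>(c := \<rho> c + \<rho> l)) y = 0 \<and>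
       I 0 ((\<rho>(c := \<rho> c + \<rho> l))(c := 0, y := 0)) i h m"
      using assms by simp
  qed (use assms in auto)
qed (use assms in auto)

end

text \<open>Positions count from 1, because cell 0 is the left end marker.\<close>

definition inp :: "symbol list \<Rightarrow> nat \<Rightarrow> symbol list \<Rightarrow> bool" where
  "inp x p ys \<longleftrightarrow> (\<exists>pre post. x = pre @ ys @ post \<and> p = Suc (length pre))"

lemma inp_Cons: "inp x p (a # ys) \<Longrightarrow> input_cell x p = Sym a \<and> inp x (Suc p) ys"
proof -
  assume "inp x p (a # ys)"
  then obtain pre post where *: "x = pre @ (a # ys) @ post" "p = Suc (length pre)"
    by (auto simp: inp_def)
  then have "x = (pre @ [a]) @ ys @ post" "Suc p = Suc (length (pre @ [a]))" by auto
  then have "inp x (Suc p) ys" unfolding inp_def by blast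
  then show ?thesis using * by (auto simp: input_cell_def nth_append)
qed

lemma inp_append: "inp x p (ys @ zs) \<Longrightarrow> inp x p ys \<and> inp x (p + length ys) zs"
proof -
  assume "inp x p (ys @ zs)"
  then obtain pre post where *: "x = pre @ (ys @ zs) @ post" "p = Suc (length pre)"
    by (auto simp: inp_def)
  then have "x = pre @ ys @ (zs @ post)" "x = (pre @ ys) @ zs @ post"
    "p + length ys = Suc (length (pre @ ys))" by auto
  then show ?thesis using * unfolding inp_def by blast
qed

lemma inp_nth: "inp x p ys \<Longrightarrow> k < length ys \<Longrightarrow> input_cell x (p + k) = Sym (ys ! k)"
  by (auto simp: inp_def input_cell_def nth_append)

lemma inp_length: "inp x p ys \<Longrightarrow> 0 < p \<and> p + length ys \<le> Suc (length x)"
  by (auto simp: inp_def)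

definition bit_at :: "symbol list \<Rightarrow> nat \<Rightarrow> bool" where
  "bit_at x p \<longleftrightarrow> input_cell x p = Sym One"

lemma length_encode_set [simp]: "length (encode_set n S) = Suc n"
  by (simp add: encode_set_def)

lemma inp_encode_set: "inp x p (encode_set n S) \<Longrightarrow> y < n \<Longrightarrow> bit_at x (p + y) \<longleftrightarrow> y \<in> S"
  using inp_nth[of x p "encode_set n S" y]
  by (auto simp: bit_at_def encode_set_def nth_append)

text \<open>Passing over a tree in preorder needs no stack: \<open>rD\<close> is the number of trees
  still to be read. A node replaces one pending tree by two and takes \<open>n + 2\<close> cells for
  tag, bag and separator; a leaf finishes one tree.\<close>

definition SKIP :: "nat \<Rightarrow> com" where
  "SKIP r = Inc rD ;; WhileC (NZ rD) (GOTO r ;;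
     IfC (In {Sym One}) (Inc rD ;; ADD rN r ;; Inc r ;; Inc r) (Dec rD ;; Inc r))"

locale ram_main = ram_bounds +
  fixes n pu pv :: nat
  assumes LV: "length x + 1 \<le> V" and AB: "A 0 \<le> B" "A 1 \<le> B"
    and pu: "pu + n < length x" and pv: "pv + n < length x"
begin

text \<open>
  The bag at position \<open>c\<close> is enlarged by the vertices \<open>u\<close> and \<open>v\<close>, whose characteristic vectors
  start after the positions \<open>pu\<close> and \<open>pv\<close>.
\<close>

definition mem :: "nat \<Rightarrow> nat \<Rightarrow> bool" where
  "mem c y \<longleftrightarrow> bit_at x (Suc (c + y)) \<or> bit_at x (Suc (pu + y)) \<or> bit_at x (Suc (pv + y))"

definition rank :: "nat \<Rightarrow> nat \<Rightarrow> nat" where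
  "rank c y = card {z. z < y \<and> mem c z}"

lemma rank_0 [simp]: "rank c 0 = 0"
  by (simp add: rank_def)

lemma rank_Suc: "rank c (Suc y) = rank c y + of_bool (mem c y)"
proof -
  have "{z. z < Suc y \<and> mem c z} = {z. z < y \<and> mem c z} \<union> (if mem c y then {y} else {})"
    by (auto simp: less_Suc_eq)
  then show ?thesis by (auto simp: rank_def)
qed

lemma rank_mono: "y \<le> z \<Longrightarrow> rank c y \<le> rank c z"
  by (induction z) (auto simp: rank_Suc le_Suc_eq)

lemma rank_less: "mem c y \<Longrightarrow> y < z \<Longrightarrow> rank c y < rank c z"
  using rank_mono[of "Suc y" z c] by (simp add: rank_Suc)

text \<open>Different vertices of a bag own different cells, so writing one mark leaves the others
  alone.\<close>

lemma rank_inj: "mem c y \<Longrightarrow> mem c z \<Longrightarrow> rank c y = rank c z \<Longrightarrow> y = z"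
  using rank_less[of c y z] rank_less[of c z y] by (cases y z rule: linorder_cases) auto

lemma wp_TESTBIT:
  assumes "a \<notin> {rT, rP}" "y \<notin> {rT, rP}" "\<rho> rT = 0" "\<rho> rP = 0" "\<rho> rM \<le> 1"
    "\<rho> a + n < length x" "\<rho> y < n" "i \<le> length x + 1"
    and Q: "\<And>i. i \<le> length x + 1 \<Longrightarrow> Q (\<rho>(rM := of_bool (\<rho> rM = 1 \<or> bit_at x (Suc (\<rho> a + \<rho> y))))) i h m"
  shows "wp (TESTBIT a y) Q \<rho> i h m"
proof (cases "\<rho> rM = 0")
  case True
  have "wp (PEEK a y) (wp (IfC (In {Sym One}) (Inc rM) Skip) Q) \<rho> i h m"
    using assms(1-8) LV True Q[of "Suc (\<rho> a + \<rho> y)"]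
    by (intro wp_PEEK) (auto simp: bit_at_def fun_upd_idem)
  then have "wp (PEEK a y ;; IfC (In {Sym One}) (Inc rM) Skip) Q \<rho> i h m" by (rule wp_SeqI)
  then show ?thesis unfolding TESTBIT_def using True by (simp del: wp.simps(7))
next
  case False
  then show ?thesis unfolding TESTBIT_def using Q[OF assms(8)] assms(5)
    by (auto simp: fun_upd_idem le_Suc_eq)
qed

lemma wp_MEM:
  assumes "c \<notin> {rT, rP, rM}" "y \<notin> {rT, rP, rM}" "\<rho> rT = 0" "\<rho> rP = 0" "\<rho> rM = 0" "\<rho> rPU = pu" "\<rho> rPV = pv"
    "\<rho> c + n < length x" "\<rho> y < n" "i \<le> length x + 1"
    and Q: "\<And>i. i \<le> length x + 1 \<Longrightarrow> Q (\<rho>(rM := of_bool (mem (\<rho> c) (\<rho> y)))) i h m"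
  shows "wp (MEM c y) Q \<rho> i h m"
  unfolding MEM_def wp.simps(7)
  by (intro wp_TESTBIT) (use assms pu pv in \<open>auto simp: mem_def simp del: of_bool_or_iff of_bool_eq_1_iff\<close>)

lemma wp_RANK:
  assumes "c \<notin> {rT, rP, rM, rY, rCY, k}" "y \<notin> {rT, rP, rM, rY, rCY, k}" "k \<notin> {rT, rP, rM, rY, rCY, rPU, rPV}"
    "\<rho> rT = 0" "\<rho> rP = 0" "\<rho> rM = 0" "\<rho> rY = 0" "\<rho> rCY = 0" "\<rho> rPU = pu" "\<rho> rPV = pv"
    "\<rho> c + n < length x" "\<rho> y \<le> n" "i \<le> length x + 1" "\<rho> k + rank (\<rho> c) (\<rho> y) \<le> V"
    and Q: "\<And>i. i \<le> length x + 1 \<Longrightarrow> Q (\<rho>(k := \<rho> k + rank (\<rho> c) (\<rho> y))) i h m"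
  shows "wp (RANK c y k) Q \<rho> i h m"
  unfolding RANK_def
proof (rule wp_FOR[where N = "\<rho> y" and I = "\<lambda>j \<rho>' i' h' m'. \<rho>' = \<rho>(k := \<rho> k + rank (\<rho> c) j) \<and>
    i' \<le> length x + 1 \<and> h' = h \<and> m' = m"])
  fix j \<rho>' i' h' m'
  assume j: "j < \<rho> y" "\<rho>' = \<rho>(k := \<rho> k + rank (\<rho> c) j) \<and> i' \<le> length x + 1 \<and> h' = h \<and> m' = m"
  have le: "\<rho> k + rank (\<rho> c) (Suc j) \<le> V"
    using assms(14) rank_mono[of "Suc j" "\<rho> y" "\<rho> c"] j(1) by simp
  let ?Q = "\<lambda>\<rho>' i' h' m'. \<rho>' rCY = \<rho> y - Suc j \<and> \<rho>' rY = j \<and>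
      \<rho>'(rCY := 0, rY := 0) = \<rho>(k := \<rho> k + rank (\<rho> c) (Suc j)) \<and> i' \<le> length x + 1 \<and> h' = h \<and> m' = m"
  show "wp (MEM c rY ;; MOVE rM k) ?Q (\<rho>'(rCY := \<rho> y - Suc j, rY := j)) i' h' m'"
    unfolding wp.simps(7)
  proof (rule wp_MEM)
    fix i1 assume "i1 \<le> length x + 1"
    then show "wp (MOVE rM k) ?Q
     ((\<rho>'(rCY := \<rho> y - Suc j, rY := j))(rM := of_bool (mem ((\<rho>'(rCY := \<rho> y - Suc j, rY := j)) c)
         ((\<rho>'(rCY := \<rho> y - Suc j, rY := j)) rY)))) i1 h' m'"
      using assms j le
      by (intro wp_MOVE) (auto simp: rank_Suc fun_eq_iff fun_upd_apply)
  qed (use assms j in auto)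
next
  show "\<rho> y \<le> V" using assms LV by linarith
qed (use assms in \<open>auto simp: fun_upd_idem\<close>)

definition marks_ok :: "(nat \<Rightarrow> nat) \<Rightarrow> bool" where
  "marks_ok f \<longleftrightarrow> f 0 = 9 \<and> (\<forall>p>0. f p \<le> 1)"

lemma wp_TGOTO:
  assumes "a \<noteq> rT" "\<rho> rT = 0" "\<rho> a \<le> V" "Suc (\<rho> a) \<le> A 1" "marks_ok (m 1)" "h 1 \<le> A 1"
    "Q \<rho> i (h(1 := Suc (\<rho> a))) m"
  shows "wp (TGOTO a) Q \<rho> i h m"
proof -
  let ?Q' = "wp (Mv 1 MoveRight ;; WhileC (NZ a) (Dec a ;; Inc rT ;; Mv 1 MoveRight) ;; MOVE rT a) Q"
  have z: "m 1 p = 9 \<longleftrightarrow> p = 0" for p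
    using assms(5) unfolding marks_ok_def by (cases "p = 0") (auto dest!: spec[of _ p])
  have "?Q' \<rho> i (h(1 := 0)) m"
    unfolding wp.simps(6,7)
  proof (intro conjI, goal_cases)
    case 1
    show ?case using assms(4) by simp
  next
    case 2
    show ?case
    proof (rule wp_count[where I = "\<lambda>j \<rho>' i' h' m'. \<rho>' = \<rho>(a := \<rho> a - j, rT := j) \<and>
        i' = i \<and> h' = h(1 := Suc j) \<and> m' = m"])
      fix j \<rho>' i' h' m'
      assume "j < \<rho> a" "\<rho>' = \<rho>(a := \<rho> a - j, rT := j) \<and> i' = i \<and> h' = h(1 := Suc j) \<and> m' = m"
      then show "wp (Inc rT ;; Mv 1 MoveRight) (\<lambda>\<rho>' i' h' m'. (\<rho>' = \<rho>(a := \<rho> a - Suc j, rT := Suc j) \<and>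
          i' = i \<and> h' = h(1 := Suc (Suc j)) \<and> m' = m)
         \<and> \<rho>' a = \<rho> a - Suc j) (\<rho>'(a := \<rho> a - Suc j)) i' h' m'"
        using assms(1-4) by (auto simp: fun_eq_iff fun_upd_apply)
    next
      fix \<rho>' i' h' m'
      assume 1: "\<rho>' = \<rho>(a := \<rho> a - \<rho> a, rT := \<rho> a) \<and> i' = i \<and> h' = h(1 := Suc (\<rho> a)) \<and> m' = m"
      have "\<rho>'(rT := 0, a := \<rho>' a + \<rho>' rT) = \<rho>"
        using 1 assms(1-4) by (auto simp: fun_eq_iff fun_upd_apply)
      then show "wp (MOVE rT a) Q \<rho>' i' h' m'"
        by (intro wp_MOVE) (use 1 assms in auto)
    qed (use assms in \<open>auto simp: fun_upd_idem\<close>)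
  qed
  moreover have "while1 (wp (Mv 1 MoveLeft)) (test x (Tp 1 (- {9}))) Q' p \<rho> i (h(1 := p)) m"
    if "Q' \<rho> i (h(1 := 0)) m" "p \<le> A 1" for p Q'
    using that(2)
  proof (induction p)
    case 0
    then show ?case using that(1) z by simp
  next
    case (Suc p)
    then show ?case using z by simp
  qed
  ultimately have "while1 (wp (Mv 1 MoveLeft)) (test x (Tp 1 (- {9}))) ?Q' (h 1) \<rho> i (h(1 := h 1)) m"
    using assms(6) by blast
  then have "\<exists>k\<le>B. while1 (wp (Mv 1 MoveLeft)) (test x (Tp 1 (- {9}))) ?Q' k \<rho> i h m"
    using assms(6) AB by (intro exI[of _ "h 1"]) (auto simp: fun_upd_idem)
  then have "wp (WhileC (Tp 1 (- {9})) (Mv 1 MoveLeft)) ?Q' \<rho> i h m"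
    by (simp only: wp.simps)
  then show ?thesis unfolding TGOTO_def by (rule wp_SeqI)
qed

lemma wp_ADDR:
  assumes "c \<notin> {rT, rP, rM, rY, rCY, rK}" "y \<notin> {rT, rP, rM, rY, rCY, rK}" "b \<notin> {rT, rK}"
    "\<rho> rT = 0" "\<rho> rP = 0" "\<rho> rM = 0" "\<rho> rY = 0" "\<rho> rCY = 0" "\<rho> rK = 0" "\<rho> rPU = pu" "\<rho> rPV = pv"
    "\<rho> c + n < length x" "\<rho> y \<le> n" "i \<le> length x + 1" "\<rho> b + rank (\<rho> c) (\<rho> y) \<le> V"
    "Suc (\<rho> b + rank (\<rho> c) (\<rho> y)) \<le> A 1" "marks_ok (m 1)" "h 1 \<le> A 1"
    and Q: "\<And>i. i \<le> length x + 1 \<Longrightarrow> Q \<rho> i (h(1 := Suc (\<rho> b + rank (\<rho> c) (\<rho> y)))) m"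
  shows "wp (ADDR c b y) Q \<rho> i h m"
  unfolding ADDR_def wp.simps(7)
  by (intro wp_ADD wp_RANK wp_TGOTO wp_CLR) (use assms in \<open>auto simp: fun_upd_idem\<close>)

lemma wp_SKIP:
  assumes t: "inp x (\<rho> r) (encode_tree n t)" and r: "r \<notin> {rT, rD, rN}" and z: "\<rho> rT = 0" "\<rho> rD = 0" "\<rho> rN = n"
    and i: "i \<le> length x + 1"
    and Q: "\<And>i. i \<le> length x + 1 \<Longrightarrow> Q (\<rho>(r := \<rho> r + length (encode_tree n t))) i h m"
  shows "wp (SKIP r) Q \<rho> i h m"
proof -
  let ?c = "GOTO r ;; IfC (In {Sym One}) (Inc rD ;; ADD rN r ;; Inc r ;; Inc r) (Dec rD ;; Inc r)"
  \<comment> \<open>The claim is generalised to \<open>d\<close> further trees waiting behind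
    \<open>t\<close> and to \<open>k\<close> rounds for what follows. The bound
    \<open>Suc d + length (encode_tree n t) \<le> V\<close> keeps \<open>rD\<close> in range, as a
    node adds one pending tree but consumes more than one cell.\<close>
  have loop: "\<exists>k'\<le>k + length (encode_tree n t). while1 (wp ?c) (test x (NZ rD)) Q k' (\<rho>(rD := Suc d, r := p)) i h m"
    if "inp x p (encode_tree n t)" "Suc d + length (encode_tree n t) \<le> V" "i \<le> length x + 1"
      "\<And>i. i \<le> length x + 1 \<Longrightarrow> \<exists>k'\<le>k. while1 (wp ?c) (test x (NZ rD)) Q k' (\<rho>(rD := d, r := p + length (encode_tree n t))) i h m"
    for d p i k t
    using that
  proof (induction t arbitrary: d p i k)
    case Leaf
    then have c: "input_cell x p = Sym Zero" "p \<le> length x"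
      using inp_Cons inp_length[OF Leaf(1)] by fastforce+
    have "wp ?c (\<lambda>\<rho>' i' h' m'. \<rho>' = \<rho>(rD := d, r := Suc p) \<and> i' = p \<and> h' = h \<and> m' = m) (\<rho>(rD := Suc d, r := p)) i h m"
      unfolding wp.simps(7)
      by (rule wp_GOTO) (use r z c LV Leaf(3) in \<open>auto simp: fun_eq_iff fun_upd_apply\<close>)
    moreover obtain k' where "k' \<le> k" "while1 (wp ?c) (test x (NZ rD)) Q k' (\<rho>(rD := d, r := Suc p)) p h m"
      using Leaf(4)[of p] c(2) by auto
    ultimately have "while1 (wp ?c) (test x (NZ rD)) Q (Suc k') (\<rho>(rD := Suc d, r := p)) i h m"
      using r by (simp only: while1.simps test.simps fun_upd_other fun_upd_same) (auto elim!: wp_mono)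
    then show ?case using \<open>k' \<le> k\<close> by (intro exI[of _ "Suc k'"]) auto
  next
    case (Node l S r')
    have at: "input_cell x p = Sym One" "inp x (p + Suc (Suc n)) (encode_tree n l)"
      "inp x (p + Suc (Suc n) + length (encode_tree n l)) (encode_tree n r')" "p + Suc (Suc n) \<le> Suc (length x)"
      using Node.prems(1) inp_length[OF Node.prems(1)]
      by (auto dest!: inp_Cons inp_append simp: add_ac)
    have 2: "\<exists>k'\<le>k + length (encode_tree n r'). while1 (wp ?c) (test x (NZ rD)) Q k'
        (\<rho>(rD := Suc d, r := p + Suc (Suc n) + length (encode_tree n l))) i h m" if "i \<le> length x + 1" for i
      by (rule Node.IH(2)[OF at(3)]) (use Node.prems that in \<open>auto simp: add_ac\<close>)
    have 3: "\<exists>k'\<le>k + length (encode_tree n r') + length (encode_tree n l). while1 (wp ?c) (test x (NZ rD)) Q k'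
        (\<rho>(rD := Suc (Suc d), r := p + Suc (Suc n))) p h m"
      by (rule Node.IH(1)[OF at(2)]) (use Node.prems 2 at(4) in \<open>auto simp: add_ac\<close>)
    then obtain k' where k': "k' \<le> k + length (encode_tree n r') + length (encode_tree n l)"
      "while1 (wp ?c) (test x (NZ rD)) Q k' (\<rho>(rD := Suc (Suc d), r := p + Suc (Suc n))) p h m" by blast
    have "wp ?c (\<lambda>\<rho>' i' h' m'. \<rho>' = \<rho>(rD := Suc (Suc d), r := p + Suc (Suc n)) \<and> i' = p \<and> h' = h \<and> m' = m)
        (\<rho>(rD := Suc d, r := p)) i h m"
      unfolding wp.simps(7)
      apply (rule wp_GOTO)
      using r z at LV Node.prems apply (simp_all del: encode_tree.simps)
      apply (intro conjI wp_ADD)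
      using r z at LV Node.prems(2) apply (auto simp: fun_eq_iff fun_upd_apply)
      done
    with k'(2) have "while1 (wp ?c) (test x (NZ rD)) Q (Suc k') (\<rho>(rD := Suc d, r := p)) i h m"
      using r by (simp only: while1.simps test.simps fun_upd_other fun_upd_same) (auto elim!: wp_mono)
    then show ?case using k'(1) by (intro exI[of _ "Suc k'"]) auto
  qed
  have len: "Suc (length (encode_tree n t)) \<le> length x + 1" using inp_length[OF t] by simp
  have "\<exists>k'\<le>0 + length (encode_tree n t). while1 (wp ?c) (test x (NZ rD)) Q k' (\<rho>(rD := Suc 0, r := \<rho> r)) i h m"
  proof (rule loop[OF t])
    show "\<exists>k'\<le>0. while1 (wp ?c) (test x (NZ rD)) Q k' (\<rho>(rD := 0, r := \<rho> r + length (encode_tree n t))) i h m"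
      if "i \<le> length x + 1" for i
      using Q[OF that] r z by (auto simp: fun_upd_idem)
  qed (use len LV i in auto)
  then obtain k where k: "k \<le> 0 + length (encode_tree n t)"
    "while1 (wp ?c) (test x (NZ rD)) Q k (\<rho>(rD := Suc 0, r := \<rho> r)) i h m"
    by blast
  have eq: "\<rho>(rD := Suc 0, r := \<rho> r) = \<rho>(rD := Suc (\<rho> rD))"
    using r z by (auto simp: fun_eq_iff fun_upd_apply)
  have "k \<le> B" using k(1) len LB by simp
  then have "wp (WhileC (NZ rD) ?c) Q (\<rho>(rD := Suc (\<rho> rD))) i h m" using k(2) unfolding eq by (intro wp_WhileI)
  then have "wp (Inc rD) (wp (WhileC (NZ rD) ?c) Q) \<rho> i h m" using LV z by simp
  then show ?thesis unfolding SKIP_def by (rule wp_SeqI)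
qed

end

section \<open>Operations on the marks of a bag\<close>

definition IFMEM :: "nat \<Rightarrow> nat \<Rightarrow> com \<Rightarrow> com \<Rightarrow> com" where
  "IFMEM c y p q = MEM c y ;; IfC (NZ rM) (CLR rM ;; p) q"

definition SET :: "nat \<Rightarrow> nat \<Rightarrow> nat \<Rightarrow> nat \<Rightarrow> com" where
  "SET c b y a = ADDR c b y ;; Wr 1 a"

definition IFSET :: "nat \<Rightarrow> nat \<Rightarrow> nat \<Rightarrow> com \<Rightarrow> com \<Rightarrow> com" where
  "IFSET c b y p q = ADDR c b y ;; IfC (Tp 1 {1}) p q"

text \<open>A row of the adjacency matrix takes \<open>n + 1\<close> cells with its separator, so
  the entry for \<open>y\<close> and \<open>z\<close> has offset \<open>y * Suc n + z\<close>; the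
  product is formed by repeated addition.\<close>

definition EDGE :: "com \<Rightarrow> com \<Rightarrow> com" where
  "EDGE p q = ADD rZ rP ;; ADD rX rW ;; WhileC (NZ rW) (Dec rW ;; (ADD rN rP ;; Inc rP)) ;;
     GOTO rP ;; CLR rP ;; InM MoveRight ;; IfC (In {Sym One}) p q"

text \<open>The flag decides about vertices of the target bag that the source bag lacks. On the way
  down they are unmarked, since the cells of the child hold leftovers of earlier calls; on the way
  up they keep the marks of the parent.\<close>

definition TRANSFER :: "bool \<Rightarrow> nat \<Rightarrow> nat \<Rightarrow> nat \<Rightarrow> nat \<Rightarrow> com" where
  "TRANSFER z c0 b0 c1 b1 = FOR rX rN rCX (IFMEM c1 rX
     (IFMEM c0 rX (IFSET c0 b0 rX (SET c1 b1 rX 1) (SET c1 b1 rX 0))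
       (if z then SET c1 b1 rX 0 else Skip)) Skip)"

definition EDGES :: "nat \<Rightarrow> nat \<Rightarrow> com" where
  "EDGES c b = FOR rX rN rCX (IFMEM c rX (IFSET c b rX
     (FOR rZ rN rCZ (IFMEM c rZ (EDGE (SET c b rZ 1) Skip) Skip)) Skip) Skip)"

locale ram_graph = ram_main +
  assumes gn: "n * Suc n < length x"
begin

definition edge :: "nat \<Rightarrow> nat \<Rightarrow> bool" where
  "edge y z \<longleftrightarrow> bit_at x (Suc (y * Suc n + z))"

definition clean1 :: "regs \<Rightarrow> bool" where
  "clean1 \<rho> \<longleftrightarrow> \<rho> rT = 0 \<and> \<rho> rP = 0 \<and> \<rho> rM = 0 \<and> \<rho> rY = 0 \<and> \<rho> rCY = 0 \<and> \<rho> rK = 0 \<and>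
     \<rho> rPU = pu \<and> \<rho> rPV = pv \<and> \<rho> rN = n"

definition clean :: "regs \<Rightarrow> bool" where
  "clean \<rho> \<longleftrightarrow> clean1 \<rho> \<and> \<rho> rX = 0 \<and> \<rho> rCX = 0 \<and> \<rho> rZ = 0 \<and> \<rho> rCZ = 0 \<and> \<rho> rD = 0 \<and> \<rho> rE = 0 \<and> \<rho> rW = 0"

text \<open>The marks of the bag at \<open>c\<close> are stored in the cells following cell \<open>b\<close>.\<close>

definition frame :: "nat \<Rightarrow> nat \<Rightarrow> nat set \<Rightarrow> (nat \<Rightarrow> nat) \<Rightarrow> bool" where
  "frame c b S f \<longleftrightarrow> (\<forall>y<n. mem c y \<longrightarrow> f (Suc (b + rank c y)) = of_bool (y \<in> S))"

definition outside_eq :: "nat \<Rightarrow> nat \<Rightarrow> (nat \<Rightarrow> nat) \<Rightarrow> (nat \<Rightarrow> nat) \<Rightarrow> bool" where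
  "outside_eq c b f f' \<longleftrightarrow> (\<forall>p. p \<le> b \<or> b + rank c n < p \<longrightarrow> f' p = f p)"

lemma outside_eq_trans: "outside_eq c b f f' \<Longrightarrow> outside_eq c b f' f'' \<Longrightarrow> outside_eq c b f f''"
  by (auto simp: outside_eq_def)

lemma outside_eq_refl [simp]: "outside_eq c b f f"
  by (auto simp: outside_eq_def)

lemma outside_eq_upd: "mem c y \<Longrightarrow> y < n \<Longrightarrow> outside_eq c b f (f(Suc (b + rank c y) := a))"
  using rank_less[of c y n] by (auto simp: outside_eq_def fun_upd_apply)

lemma frame_insert: "frame c b S f \<Longrightarrow> mem c y \<Longrightarrow> frame c b (insert y S) (f(Suc (b + rank c y) := 1))"
  by (auto simp: frame_def fun_upd_apply dest: rank_inj)

lemma frame_remove: "frame c b S f \<Longrightarrow> mem c y \<Longrightarrow> frame c b (S - {y}) (f(Suc (b + rank c y) := 0))"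
  by (auto simp: frame_def fun_upd_apply dest: rank_inj)

lemma frame_outside:
  assumes "frame c b S f" "outside_eq c' b' f f'" "b + rank c n \<le> b' \<or> b' + rank c' n \<le> b"
  shows "frame c b S f'"
  unfolding frame_def
proof (intro allI impI)
  fix y assume y: "y < n" "mem c y"
  then have "rank c y < rank c n" by (simp add: rank_less)
  then have "Suc (b + rank c y) \<le> b' \<or> b' + rank c' n < Suc (b + rank c y)"
    using assms(3) by linarith
  then have "f' (Suc (b + rank c y)) = f (Suc (b + rank c y))"
    using assms(2) unfolding outside_eq_def by blast
  then show "f' (Suc (b + rank c y)) = of_bool (y \<in> S)" using assms(1) y by (simp add: frame_def)
qed

text \<open>Arbitrary leftovers can be read as the marks of some set, which makes
  \<open>wp_TRANSFER\<close> applicable to a region that has not been initialised.\<close>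

lemma frame_exists: "marks_ok f \<Longrightarrow> \<exists>S. frame c b S f"
proof
  assume m: "marks_ok f"
  show "frame c b {y. f (Suc (b + rank c y)) = 1} f"
    unfolding frame_def
  proof (intro allI impI)
    fix y
    have "f (Suc (b + rank c y)) \<le> 1" using m by (simp add: marks_ok_def)
    then show "f (Suc (b + rank c y)) = of_bool (y \<in> {y. f (Suc (b + rank c y)) = 1})" by auto
  qed
qed

lemma marks_ok_upd: "marks_ok f \<Longrightarrow> a \<le> 1 \<Longrightarrow> marks_ok (f(Suc p := a))"
  by (auto simp: marks_ok_def fun_upd_apply)

text \<open>Registers 0 to 4 hold constants, and 5 to 10 are scratch for the membership test and the
  addressing of marks; operands therefore have to come from registers above them.\<close>

lemma wp_IFMEM:
  assumes "clean1 \<rho>" "11 \<le> c" "11 \<le> y" "\<rho> c + n < length x" "\<rho> y < n" "i \<le> length x + 1"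
    and p: "\<And>i. i \<le> length x + 1 \<Longrightarrow> mem (\<rho> c) (\<rho> y) \<Longrightarrow> wp p Q \<rho> i h m"
    and q: "\<And>i. i \<le> length x + 1 \<Longrightarrow> \<not> mem (\<rho> c) (\<rho> y) \<Longrightarrow> wp q Q \<rho> i h m"
  shows "wp (IFMEM c y p q) Q \<rho> i h m"
  unfolding IFMEM_def
proof (rule wp_SeqI, rule wp_MEM)
  fix i assume i: "i \<le> length x + 1"
  have "wp (CLR rM ;; p) Q (\<rho>(rM := 1)) i h m" if "mem (\<rho> c) (\<rho> y)"
    by (rule wp_SeqI, rule wp_CLR) (use LV p[OF i that] assms(1) in \<open>auto simp: clean1_def fun_upd_idem\<close>)
  moreover have "wp q Q (\<rho>(rM := 0)) i h m" if "\<not> mem (\<rho> c) (\<rho> y)"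
    using q[OF i that] assms(1) by (simp add: clean1_def fun_upd_idem)
  ultimately show "wp (IfC (NZ rM) (CLR rM ;; p) q) Q (\<rho>(rM := of_bool (mem (\<rho> c) (\<rho> y)))) i h m"
    by (simp del: wp.simps(7))
qed (use assms in \<open>auto simp: clean1_def\<close>)

lemma wp_SET:
  assumes "clean1 \<rho>" "11 \<le> c" "11 \<le> y" "11 \<le> b" "\<rho> c + n < length x" "\<rho> y < n" "mem (\<rho> c) (\<rho> y)"
    "i \<le> length x + 1" "\<rho> b + rank (\<rho> c) n \<le> V" "\<rho> b + rank (\<rho> c) n \<le> A 1" "marks_ok (m 1)" "h 1 \<le> A 1"
    and Q: "\<And>i h'. i \<le> length x + 1 \<Longrightarrow> h' 0 = h 0 \<Longrightarrow> h' 1 \<le> A 1 \<Longrightarrow>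
      Q \<rho> i h' (m(1 := (m 1)(Suc (\<rho> b + rank (\<rho> c) (\<rho> y)) := a)))"
  shows "wp (SET c b y a) Q \<rho> i h m"
  unfolding SET_def
proof (rule wp_SeqI, rule wp_ADDR)
  have "rank (\<rho> c) (\<rho> y) < rank (\<rho> c) n" by (rule rank_less) (use assms in auto)
  then show *: "\<rho> b + rank (\<rho> c) (\<rho> y) \<le> V" "Suc (\<rho> b + rank (\<rho> c) (\<rho> y)) \<le> A 1"
    using assms(9,10) by auto
  fix i assume i: "i \<le> length x + 1"
  show "wp (Wr 1 a) Q \<rho> i (h(1 := Suc (\<rho> b + rank (\<rho> c) (\<rho> y)))) m"
    using Q[OF i, of "h(1 := Suc (\<rho> b + rank (\<rho> c) (\<rho> y)))"] * by simp
qed (use assms in \<open>auto simp: clean1_def\<close>)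

lemma wp_IFSET:
  assumes "clean1 \<rho>" "11 \<le> c" "11 \<le> y" "11 \<le> b" "\<rho> c + n < length x" "\<rho> y < n" "mem (\<rho> c) (\<rho> y)"
    "i \<le> length x + 1" "\<rho> b + rank (\<rho> c) n \<le> V" "\<rho> b + rank (\<rho> c) n \<le> A 1" "marks_ok (m 1)" "h 1 \<le> A 1"
    and p: "\<And>i h'. i \<le> length x + 1 \<Longrightarrow> h' 0 = h 0 \<Longrightarrow> h' 1 \<le> A 1 \<Longrightarrow>
      m 1 (Suc (\<rho> b + rank (\<rho> c) (\<rho> y))) = 1 \<Longrightarrow> wp p Q \<rho> i h' m"
    and q: "\<And>i h'. i \<le> length x + 1 \<Longrightarrow> h' 0 = h 0 \<Longrightarrow> h' 1 \<le> A 1 \<Longrightarrow>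
      m 1 (Suc (\<rho> b + rank (\<rho> c) (\<rho> y))) = 0 \<Longrightarrow> wp q Q \<rho> i h' m"
  shows "wp (IFSET c b y p q) Q \<rho> i h m"
  unfolding IFSET_def
proof (rule wp_SeqI, rule wp_ADDR)
  have "rank (\<rho> c) (\<rho> y) < rank (\<rho> c) n" by (rule rank_less) (use assms in auto)
  then show *: "\<rho> b + rank (\<rho> c) (\<rho> y) \<le> V" "Suc (\<rho> b + rank (\<rho> c) (\<rho> y)) \<le> A 1"
    using assms(9,10) by auto
  fix i assume i: "i \<le> length x + 1"
  let ?h = "h(1 := Suc (\<rho> b + rank (\<rho> c) (\<rho> y)))"
  have "m 1 (Suc (\<rho> b + rank (\<rho> c) (\<rho> y))) \<le> 1"
    using assms(11) by (simp add: marks_ok_def)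
  then show "wp (IfC (Tp 1 {1}) p q) Q \<rho> i ?h m"
    using p[OF i, of ?h] q[OF i, of ?h] * by auto
qed (use assms in \<open>auto simp: clean1_def\<close>)

lemma wp_EDGE:
  assumes "clean1 \<rho>" "\<rho> rW = 0" "\<rho> rX < n" "\<rho> rZ < n" "i \<le> length x + 1"
    and p: "\<And>i. i \<le> length x + 1 \<Longrightarrow> edge (\<rho> rX) (\<rho> rZ) \<Longrightarrow> wp p Q \<rho> i h m"
    and q: "\<And>i. i \<le> length x + 1 \<Longrightarrow> \<not> edge (\<rho> rX) (\<rho> rZ) \<Longrightarrow> wp q Q \<rho> i h m"
  shows "wp (EDGE p q) Q \<rho> i h m"
proof -
  let ?x = "\<rho> rX" let ?z = "\<rho> rZ"
  have "Suc ?x * Suc n \<le> n * Suc n" using assms(3) by (intro mult_le_mono1) simp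
  then have le: "?x * Suc n + ?z < length x" using assms(4) gn by simp
  have lej: "?z + j * Suc n < length x" if "j \<le> ?x" for j
    using le mult_le_mono1[OF that, of "Suc n"] by simp
  show ?thesis
    unfolding EDGE_def wp.simps(7)
  proof (rule wp_ADD)
    let ?\<rho>1 = "\<rho>(rP := \<rho> rP + \<rho> rZ)"
    let ?R = "wp (GOTO rP) (wp (CLR rP) (wp (InM MoveRight) (wp (IfC (In {Sym One}) p q) Q)))"
    show "wp (ADD rX rW) (wp (WhileC (NZ rW) (Dec rW ;; (ADD rN rP ;; Inc rP))) ?R) ?\<rho>1 i h m"
    proof (rule wp_ADD)
      let ?\<rho>2 = "?\<rho>1(rW := ?\<rho>1 rW + ?\<rho>1 rX)"
      show "wp (WhileC (NZ rW) (Dec rW ;; (ADD rN rP ;; Inc rP))) ?R ?\<rho>2 i h m"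
      proof (rule wp_count[where N = ?x and I = "\<lambda>j \<rho>' i' h' m'. \<rho>' = \<rho>(rP := ?z + j * Suc n, rW := ?x - j) \<and>
          i' = i \<and> h' = h \<and> m' = m"])
        fix j \<rho>' i' h' m'
        assume j: "j < ?x" "\<rho>' = \<rho>(rP := ?z + j * Suc n, rW := ?x - j) \<and> i' = i \<and> h' = h \<and> m' = m"
        show "wp (ADD rN rP ;; Inc rP) (\<lambda>\<rho>' i' h' m'. (\<rho>' = \<rho>(rP := ?z + Suc j * Suc n, rW := ?x - Suc j) \<and>
          i' = i \<and> h' = h \<and> m' = m) \<and> \<rho>' rW = ?x - Suc j) (\<rho>'(rW := ?x - Suc j)) i' h' m'"
          apply (rule wp_SeqI, rule wp_ADD)
          using j lej[of "Suc j"] assms LV apply (auto simp: clean1_def fun_eq_iff fun_upd_apply)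
          done
      next
        fix \<rho>' i' h' m'
        assume 1: "\<rho>' = \<rho>(rP := ?z + ?x * Suc n, rW := ?x - ?x) \<and> i' = i \<and> h' = h \<and> m' = m"
        have "wp (IfC (In {Sym One}) p q) Q \<rho> (Suc (?x * Suc n + ?z)) h m"
          using p[of "Suc (?x * Suc n + ?z)"] q[of "Suc (?x * Suc n + ?z)"] le
          by (auto simp: edge_def bit_at_def)
        then show "?R \<rho>' i' h' m'"
          apply (intro wp_GOTO wp_CLR)
          using 1 assms le LV
          apply (simp_all add: clean1_def fun_upd_idem fun_upd_twist[of rW rP] add_ac)
          done
      qed (use assms LV lej[of 0] le in \<open>auto simp: clean1_def fun_eq_iff fun_upd_apply\<close>)
    qed (use assms LV le in \<open>auto simp: clean1_def\<close>)
  qed (use assms LV le in \<open>auto simp: clean1_def\<close>)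
qed

lemma wp_TRANSFER:
  assumes cl: "clean \<rho>" and regs: "{c0, b0, c1, b1} \<subseteq> {15..19}"
    and pos: "\<rho> c0 + n < length x" "\<rho> c1 + n < length x"
    and bnd: "\<rho> b0 + rank (\<rho> c0) n \<le> V" "\<rho> b0 + rank (\<rho> c0) n \<le> A 1" "\<rho> b1 + rank (\<rho> c1) n \<le> V" "\<rho> b1 + rank (\<rho> c1) n \<le> A 1"
    and dis: "\<rho> b0 + rank (\<rho> c0) n \<le> \<rho> b1 \<or> \<rho> b1 + rank (\<rho> c1) n \<le> \<rho> b0"
    and i: "i \<le> length x + 1" and m: "marks_ok (m 1)" "h 1 \<le> A 1"
    and fr: "frame (\<rho> c0) (\<rho> b0) S (m 1)" "frame (\<rho> c1) (\<rho> b1) S1 (m 1)"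
    and Q: "\<And>i h' m'. \<lbrakk>i \<le> length x + 1; h' 0 = h 0; h' 1 \<le> A 1; m' 0 = m 0; marks_ok (m' 1);
      outside_eq (\<rho> c1) (\<rho> b1) (m 1) (m' 1);
      frame (\<rho> c1) (\<rho> b1) {y. if mem (\<rho> c0) y then y \<in> S else \<not> z \<and> y \<in> S1} (m' 1)\<rbrakk> \<Longrightarrow> Q \<rho> i h' m'"
  shows "wp (TRANSFER z c0 b0 c1 b1) Q \<rho> i h m"
proof -
  define new where "new = {y. if mem (\<rho> c0) y then y \<in> S else \<not> z \<and> y \<in> S1}"
  \<comment> \<open>Vertices are treated in increasing order: those below \<open>j\<close> have
    their new marks, the others still their old ones.\<close>
  let ?I = "\<lambda>j \<rho>' i' (h' :: nat \<Rightarrow> nat) (m' :: nat \<Rightarrow> nat \<Rightarrow> nat). \<rho>' = \<rho> \<and> i' \<le> length x + 1 \<and> h' 0 = h 0 \<and> h' 1 \<le> A 1 \<and> m' 0 = m 0 \<and>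
    marks_ok (m' 1) \<and> outside_eq (\<rho> c1) (\<rho> b1) (m 1) (m' 1) \<and>
    frame (\<rho> c1) (\<rho> b1) {y. if y < j then y \<in> new else y \<in> S1} (m' 1)"
  have reg: "15 \<le> c0" "15 \<le> b0" "15 \<le> c1" "15 \<le> b1" "c0 \<le> 19" "b0 \<le> 19" "c1 \<le> 19" "b1 \<le> 19"
    using regs by auto
  have z: "\<rho> rX = 0" "\<rho> rCX = 0" "\<rho> rT = 0" "\<rho> rN = n" using cl by (auto simp: clean_def clean1_def)
  show ?thesis
    unfolding TRANSFER_def
  proof (rule wp_FOR[where N = n and I = ?I])
    fix j \<rho>' i' h' m'
    assume j: "j < n" "?I j \<rho>' i' h' m'"
    let ?\<rho> = "\<rho>'(rCX := n - Suc j, rX := j)"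
    let ?Q = "\<lambda>\<rho>'' i'' h'' m''. \<rho>'' rCX = n - Suc j \<and> \<rho>'' rX = j \<and> ?I (Suc j) (\<rho>''(rCX := 0, rX := 0)) i'' h'' m''"
    have \<rho>: "?\<rho> c0 = \<rho> c0" "?\<rho> b0 = \<rho> b0" "?\<rho> c1 = \<rho> c1" "?\<rho> b1 = \<rho> b1" "?\<rho> rX = j" "?\<rho> rCX = n - Suc j"
      "?\<rho>(rCX := 0, rX := 0) = \<rho>" "clean1 ?\<rho>"
      using j reg z cl by (auto simp: clean_def clean1_def fun_eq_iff fun_upd_apply)
    \<comment> \<open>The two regions are disjoint, so the source remains readable while the target
      is rewritten.\<close>
    have fr0: "frame (\<rho> c0) (\<rho> b0) S (m' 1)"
      using j(2) frame_outside[OF fr(1)] dis by blast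
    have upd: "?I (Suc j) \<rho> i'' h'' (m'(1 := (m' 1)(Suc (\<rho> b1 + rank (\<rho> c1) j) := of_bool (j \<in> new))))"
      if "i'' \<le> length x + 1" "h'' 0 = h 0" "h'' 1 \<le> A 1" "mem (\<rho> c1) j" for i'' and h'' :: "nat \<Rightarrow> nat"
    proof -
      have "frame (\<rho> c1) (\<rho> b1) {y. if y < Suc j then y \<in> new else y \<in> S1}
          ((m' 1)(Suc (\<rho> b1 + rank (\<rho> c1) j) := of_bool (j \<in> new)))"
      proof (cases "j \<in> new")
        case True
        have "insert j {y. if y < j then y \<in> new else y \<in> S1} = {y. if y < Suc j then y \<in> new else y \<in> S1}"
          using True by (auto simp: less_Suc_eq)
        then show ?thesis using frame_insert[of "\<rho> c1" "\<rho> b1" _ "m' 1" j] j(2) that True by fastforce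
      next
        case False
        have "{y. if y < j then y \<in> new else y \<in> S1} - {j} = {y. if y < Suc j then y \<in> new else y \<in> S1}"
          using False by (auto simp: less_Suc_eq)
        then show ?thesis using frame_remove[of "\<rho> c1" "\<rho> b1" _ "m' 1" j] j(2) that False by fastforce
      qed
      moreover have "outside_eq (\<rho> c1) (\<rho> b1) (m 1) ((m' 1)(Suc (\<rho> b1 + rank (\<rho> c1) j) := of_bool (j \<in> new)))"
        using outside_eq_upd[OF that(4) j(1)] j(2) outside_eq_trans by blast
      ultimately show ?thesis using that j(2) by (simp add: marks_ok_upd)
    qed
    have set: "wp (SET c1 b1 rX a) ?Q ?\<rho> i'' h'' m'"
      if "a = of_bool (j \<in> new)" "i'' \<le> length x + 1" "h'' 0 = h 0" "h'' 1 \<le> A 1" "mem (\<rho> c1) j" for a i'' and h'' :: "nat \<Rightarrow> nat"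
    proof (rule wp_SET)
      fix i3 and h3 :: "nat \<Rightarrow> nat" assume 3: "i3 \<le> length x + 1" "h3 0 = h'' 0" "h3 1 \<le> A 1"
      have "?I (Suc j) \<rho> i3 h3 (m'(1 := (m' 1)(Suc (\<rho> b1 + rank (\<rho> c1) j) := a)))"
        unfolding that(1) by (rule upd) (use 3 that in auto)
      then show "?Q ?\<rho> i3 h3 (m'(1 := (m' 1)(Suc (?\<rho> b1 + rank (?\<rho> c1) (?\<rho> rX)) := a)))"
        unfolding \<rho> by blast
    qed (use that \<rho> j reg pos bnd in simp_all)
    have skip: "wp Skip ?Q ?\<rho> i'' h'' m'"
      if "i'' \<le> length x + 1" "h'' 0 = h 0" "h'' 1 \<le> A 1" "mem (\<rho> c1) j \<Longrightarrow> j \<in> new \<longleftrightarrow> j \<in> S1" for i'' and h'' :: "nat \<Rightarrow> nat"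
    proof -
      have "frame (\<rho> c1) (\<rho> b1) {y. if y < Suc j then y \<in> new else y \<in> S1} (m' 1)"
        using j(2) that(4) unfolding frame_def by (auto simp: less_Suc_eq)
      then show ?thesis using j(2) that(1-3) \<rho> by simp
    qed
    show "wp (IFMEM c1 rX (IFMEM c0 rX (IFSET c0 b0 rX (SET c1 b1 rX 1) (SET c1 b1 rX 0))
       (if z then SET c1 b1 rX 0 else Skip)) Skip) ?Q ?\<rho> i' h' m'"
    proof (rule wp_IFMEM)
      fix i1 assume 1: "i1 \<le> length x + 1" "mem (?\<rho> c1) (?\<rho> rX)"
      show "wp (IFMEM c0 rX (IFSET c0 b0 rX (SET c1 b1 rX 1) (SET c1 b1 rX 0))
       (if z then SET c1 b1 rX 0 else Skip)) ?Q ?\<rho> i1 h' m'"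
      proof (rule wp_IFMEM)
        fix i2 assume 2: "i2 \<le> length x + 1" "mem (?\<rho> c0) (?\<rho> rX)"
        have new: "j \<in> new \<longleftrightarrow> m' 1 (Suc (\<rho> b0 + rank (\<rho> c0) j)) = 1"
          using fr0 2 \<rho> j(1) by (auto simp: new_def frame_def)
        show "wp (IFSET c0 b0 rX (SET c1 b1 rX 1) (SET c1 b1 rX 0)) ?Q ?\<rho> i2 h' m'"
        proof (rule wp_IFSET)
          fix i3 and h3 :: "nat \<Rightarrow> nat"
          assume 3: "i3 \<le> length x + 1" "h3 0 = h' 0" "h3 1 \<le> A 1"
          show "wp (SET c1 b1 rX 1) ?Q ?\<rho> i3 h3 m'" if "m' 1 (Suc (?\<rho> b0 + rank (?\<rho> c0) (?\<rho> rX))) = 1"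
            by (rule set) (use 1 3 j new that \<rho> in simp_all)
          show "wp (SET c1 b1 rX 0) ?Q ?\<rho> i3 h3 m'" if "m' 1 (Suc (?\<rho> b0 + rank (?\<rho> c0) (?\<rho> rX))) = 0"
            by (rule set) (use 1 3 j new that \<rho> in simp_all)
        qed (use \<rho> 2 j reg pos bnd in simp_all)
      next
        fix i2 assume 2: "i2 \<le> length x + 1" "\<not> mem (?\<rho> c0) (?\<rho> rX)"
        show "wp (if z then SET c1 b1 rX 0 else Skip) ?Q ?\<rho> i2 h' m'"
        proof (cases z)
          case True
          then have "wp (SET c1 b1 rX 0) ?Q ?\<rho> i2 h' m'"
            by (intro set) (use 1 2 j \<rho> in \<open>simp_all add: new_def\<close>)
          then show ?thesis using True by simp
        next
          case False
          then have "wp Skip ?Q ?\<rho> i2 h' m'"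
            by (intro skip) (use 1 2 j \<rho> in \<open>simp_all add: new_def\<close>)
          then show ?thesis using False by (simp del: wp.simps)
        qed
      qed (use \<rho> 1 j reg pos in simp_all)
    next
      fix i1 assume 1: "i1 \<le> length x + 1" "\<not> mem (?\<rho> c1) (?\<rho> rX)"
      show "wp Skip ?Q ?\<rho> i1 h' m'"
        by (rule skip) (use 1 j \<rho> in simp_all)
    qed (use \<rho> j reg pos in simp_all)
  next
    show "n \<le> V" using pu LV by simp
  next
    fix \<rho>' i' h' m'
    assume "?I n \<rho>' i' h' m'"
    moreover from this have "frame (\<rho> c1) (\<rho> b1) new (m' 1)" by (auto simp: frame_def)
    ultimately show "Q \<rho>' i' h' m'" using Q[of i' h' m'] unfolding new_def by simp
  qed (use z i m fr in \<open>auto simp: frame_def\<close>)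
qed

text \<open>A vertex marked during the scan may itself be expanded later in the same scan, so the
  exact result depends on the order of the vertices. It is only bounded: from below by the edges
  leaving \<open>S\<close> inside the bag, from above by an edge-closed set
  \<open>R\<close>.\<close>

lemma wp_EDGES:
  assumes cl: "clean \<rho>" and regs: "{c, b} \<subseteq> {15..19}"
    and pos: "\<rho> c + n < length x" and bnd: "\<rho> b + rank (\<rho> c) n \<le> V" "\<rho> b + rank (\<rho> c) n \<le> A 1"
    and i: "i \<le> length x + 1" and m: "marks_ok (m 1)" "h 1 \<le> A 1"
    and fr: "frame (\<rho> c) (\<rho> b) S (m 1)"
    and R: "S \<subseteq> R" "\<And>y z. y \<in> R \<Longrightarrow> y < n \<Longrightarrow> z < n \<Longrightarrow> edge y z \<Longrightarrow> z \<in> R"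
    and Q: "\<And>i h' m' S'. \<lbrakk>i \<le> length x + 1; h' 0 = h 0; h' 1 \<le> A 1; m' 0 = m 0; marks_ok (m' 1);
      outside_eq (\<rho> c) (\<rho> b) (m 1) (m' 1); frame (\<rho> c) (\<rho> b) S' (m' 1); S \<subseteq> S'; S' \<subseteq> R;
      \<And>y z. \<lbrakk>y \<in> S; y < n; z < n; mem (\<rho> c) y; mem (\<rho> c) z; edge y z\<rbrakk> \<Longrightarrow> z \<in> S'\<rbrakk> \<Longrightarrow> Q \<rho> i h' m'"
  shows "wp (EDGES c b) Q \<rho> i h m"
proof -
  let ?G = "\<lambda>S' i' (h' :: nat \<Rightarrow> nat) (m' :: nat \<Rightarrow> nat \<Rightarrow> nat). i' \<le> length x + 1 \<and> h' 0 = h 0 \<and> h' 1 \<le> A 1 \<and> m' 0 = m 0 \<and>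
    marks_ok (m' 1) \<and> outside_eq (\<rho> c) (\<rho> b) (m 1) (m' 1) \<and> frame (\<rho> c) (\<rho> b) S' (m' 1) \<and> S \<subseteq> S' \<and> S' \<subseteq> R"
  let ?D = "\<lambda>j S'. \<forall>y<j. \<forall>z<n. y \<in> S \<and> mem (\<rho> c) y \<and> mem (\<rho> c) z \<and> edge y z \<longrightarrow> z \<in> S'"
  let ?I = "\<lambda>j \<rho>' i' h' m'. \<rho>' = \<rho> \<and> (\<exists>S'. ?G S' i' h' m' \<and> ?D j S')"
  have reg: "15 \<le> c" "15 \<le> b" "c \<le> 19" "b \<le> 19" using regs by auto
  have z: "\<rho> rX = 0" "\<rho> rCX = 0" "\<rho> rZ = 0" "\<rho> rCZ = 0" "\<rho> rT = 0" "\<rho> rN = n"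
    using cl by (auto simp: clean_def clean1_def)
  have nV: "n \<le> V" using pu LV by simp
  show ?thesis
    unfolding EDGES_def
  proof (rule wp_FOR[where N = n and I = ?I])
    fix j \<rho>' i' h' m'
    assume j: "j < n" "?I j \<rho>' i' h' m'"
    then obtain S' where S': "?G S' i' h' m'" "?D j S'" and \<rho>': "\<rho>' = \<rho>" by blast
    let ?\<rho> = "\<rho>(rCX := n - Suc j, rX := j)"
    let ?Q = "\<lambda>\<rho>'' i'' h'' m''. \<rho>'' rCX = n - Suc j \<and> \<rho>'' rX = j \<and> ?I (Suc j) (\<rho>''(rCX := 0, rX := 0)) i'' h'' m''"
    have \<rho>: "?\<rho> c = \<rho> c" "?\<rho> b = \<rho> b" "?\<rho> rX = j" "?\<rho> rCX = n - Suc j" "?\<rho> rCZ = 0" "?\<rho> rZ = 0" "?\<rho> rT = 0" "?\<rho> rN = n"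
      "?\<rho>(rCX := 0, rX := 0) = \<rho>" "clean1 ?\<rho>"
      using reg z cl by (auto simp: clean_def clean1_def fun_eq_iff fun_upd_apply)
    have skip: "wp Skip ?Q ?\<rho> i'' h'' m'"
      if "i'' \<le> length x + 1" "h'' 0 = h 0" "h'' 1 \<le> A 1" "j \<notin> S \<or> \<not> mem (\<rho> c) j" for i'' and h'' :: "nat \<Rightarrow> nat"
    proof -
      have "?G S' i'' h'' m' \<and> ?D (Suc j) S'" using S' that by (auto simp: less_Suc_eq)
      then show ?thesis using \<rho> by auto
    qed
    have "wp (IFMEM c rX (IFSET c b rX (FOR rZ rN rCZ (IFMEM c rZ (EDGE (SET c b rZ 1) Skip) Skip)) Skip) Skip) ?Q ?\<rho> i' h' m'"
    proof (rule wp_IFMEM)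
      fix i1 assume 1: "i1 \<le> length x + 1" "mem (?\<rho> c) (?\<rho> rX)"
      show "wp (IFSET c b rX (FOR rZ rN rCZ (IFMEM c rZ (EDGE (SET c b rZ 1) Skip) Skip)) Skip) ?Q ?\<rho> i1 h' m'"
      proof (rule wp_IFSET)
        fix i2 and h2 :: "nat \<Rightarrow> nat"
        assume 2: "i2 \<le> length x + 1" "h2 0 = h' 0" "h2 1 \<le> A 1"
          "m' 1 (Suc (?\<rho> b + rank (?\<rho> c) (?\<rho> rX))) = 0"
        \<comment> \<open>The current set contains \<open>S\<close>, so an unmarked vertex has no
          outgoing edges to be accounted for.\<close>
        then have "j \<notin> S'" using S'(1) 1 j(1) \<rho> by (auto simp: frame_def)
        then show "wp Skip ?Q ?\<rho> i2 h2 m'"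
          using 2 S'(1) by (intro skip) auto
      next
        fix i2 and h2 :: "nat \<Rightarrow> nat"
        assume 2: "i2 \<le> length x + 1" "h2 0 = h' 0" "h2 1 \<le> A 1"
          "m' 1 (Suc (?\<rho> b + rank (?\<rho> c) (?\<rho> rX))) = 1"
        then have jS': "j \<in> S'" using S'(1) 1 j(1) \<rho> by (cases "j \<in> S'") (auto simp: frame_def)
        let ?J = "\<lambda>k \<rho>'' i'' h'' m''. \<rho>'' = ?\<rho> \<and> (\<exists>S''. ?G S'' i'' h'' m'' \<and> ?D j S'' \<and> j \<in> S'' \<and>
           (\<forall>z<k. mem (\<rho> c) z \<and> edge j z \<longrightarrow> z \<in> S''))"
        show "wp (FOR rZ rN rCZ (IFMEM c rZ (EDGE (SET c b rZ 1) Skip) Skip)) ?Q ?\<rho> i2 h2 m'"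
        proof (rule wp_FOR[where N = n and I = ?J])
          fix k \<rho>3 i3 h3 m3
          assume k: "k < n" "?J k \<rho>3 i3 h3 m3"
          then obtain S3 where S3: "?G S3 i3 h3 m3" "?D j S3" "j \<in> S3" "\<forall>z<k. mem (\<rho> c) z \<and> edge j z \<longrightarrow> z \<in> S3"
            and \<rho>3: "\<rho>3 = ?\<rho>" by blast
          let ?\<rho>3 = "?\<rho>(rCZ := n - Suc k, rZ := k)"
          let ?Q3 = "\<lambda>\<rho>'' i'' h'' m''. \<rho>'' rCZ = n - Suc k \<and> \<rho>'' rZ = k \<and> ?J (Suc k) (\<rho>''(rCZ := 0, rZ := 0)) i'' h'' m''"
          have r3: "?\<rho>3 c = \<rho> c" "?\<rho>3 b = \<rho> b" "?\<rho>3 rX = j" "?\<rho>3 rZ = k" "?\<rho>3 rCZ = n - Suc k" "?\<rho>3 rW = 0"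
            "?\<rho>3(rCZ := 0, rZ := 0) = ?\<rho>" "clean1 ?\<rho>3"
            using reg z cl by (auto simp: clean_def clean1_def fun_eq_iff fun_upd_apply)
          have skip3: "wp Skip ?Q3 ?\<rho>3 i'' h3 m3"
            if "i'' \<le> length x + 1" "\<not> edge j k \<or> \<not> mem (\<rho> c) k" for i''
          proof -
            have "?G S3 i'' h3 m3 \<and> ?D j S3 \<and> j \<in> S3 \<and> (\<forall>z<Suc k. mem (\<rho> c) z \<and> edge j z \<longrightarrow> z \<in> S3)"
              using S3 that by (auto simp: less_Suc_eq)
            then show ?thesis using r3 by (simp del: fun_upd_apply) blast
          qed
          have "wp (IFMEM c rZ (EDGE (SET c b rZ 1) Skip) Skip) ?Q3 ?\<rho>3 i3 h3 m3"
          proof (rule wp_IFMEM)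
            fix i4 assume 4: "i4 \<le> length x + 1" "mem (?\<rho>3 c) (?\<rho>3 rZ)"
            show "wp (EDGE (SET c b rZ 1) Skip) ?Q3 ?\<rho>3 i4 h3 m3"
            proof (rule wp_EDGE)
              fix i5 assume 5: "i5 \<le> length x + 1" "edge (?\<rho>3 rX) (?\<rho>3 rZ)"
              show "wp (SET c b rZ 1) ?Q3 ?\<rho>3 i5 h3 m3"
              proof (rule wp_SET)
                fix i6 and h6 :: "nat \<Rightarrow> nat" assume 6: "i6 \<le> length x + 1" "h6 0 = h3 0" "h6 1 \<le> A 1"
                let ?m = "m3(1 := (m3 1)(Suc (\<rho> b + rank (\<rho> c) k) := 1))"
                have mk: "mem (\<rho> c) k" "edge j k" using 4 5 r3 by auto
                have "k \<in> R" using R(2)[of j k] S3 j(1) k(1) mk by auto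
                moreover have "outside_eq (\<rho> c) (\<rho> b) (m 1) (?m 1)"
                  using S3(1) outside_eq_upd[OF mk(1) k(1)] outside_eq_trans by (auto simp del: One_nat_def)
                moreover have "frame (\<rho> c) (\<rho> b) (insert k S3) (?m 1)"
                  using frame_insert[OF _ mk(1)] S3(1) by (simp del: One_nat_def)
                moreover have "marks_ok (?m 1)" using S3(1) by (simp add: marks_ok_upd)
                ultimately have "?G (insert k S3) i6 h6 ?m" using S3(1) 6 by (simp del: One_nat_def) blast
                moreover have "?D j (insert k S3) \<and> j \<in> insert k S3 \<and>
                   (\<forall>z<Suc k. mem (\<rho> c) z \<and> edge j z \<longrightarrow> z \<in> insert k S3)"
                  using S3 by (auto simp: less_Suc_eq)
                ultimately have "?J (Suc k) ?\<rho> i6 h6 ?m" by blast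
                then show "?Q3 ?\<rho>3 i6 h6 (m3(1 := (m3 1)(Suc (?\<rho>3 b + rank (?\<rho>3 c) (?\<rho>3 rZ)) := 1)))"
                  unfolding r3 by blast
              qed (use 4 5 r3 k S3 reg pos bnd in simp_all)
            next
              fix i5 assume 5: "i5 \<le> length x + 1" "\<not> edge (?\<rho>3 rX) (?\<rho>3 rZ)"
              then show "wp Skip ?Q3 ?\<rho>3 i5 h3 m3" using r3 by (intro skip3) auto
            qed (use 4 r3 k j in simp_all)
          next
            fix i4 assume 4: "i4 \<le> length x + 1" "\<not> mem (?\<rho>3 c) (?\<rho>3 rZ)"
            then show "wp Skip ?Q3 ?\<rho>3 i4 h3 m3" using r3 by (intro skip3) auto
          qed (use r3 k S3 reg pos in simp_all)
          then show "wp (IFMEM c rZ (EDGE (SET c b rZ 1) Skip) Skip) ?Q3 (\<rho>3(rCZ := n - Suc k, rZ := k)) i3 h3 m3"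
            unfolding \<rho>3 .
        next
          have "?G S' i2 h2 m'" using S'(1) 2 by auto
          then show "?J 0 ?\<rho> i2 h2 m'" using S'(2) jS' by blast
        next
          fix \<rho>3 i3 h3 m3
          assume "?J n \<rho>3 i3 h3 m3"
          then obtain S3 where S3: "?G S3 i3 h3 m3" "?D j S3" "\<forall>z<n. mem (\<rho> c) z \<and> edge j z \<longrightarrow> z \<in> S3"
            and \<rho>3: "\<rho>3 = ?\<rho>" by blast
          have "?D (Suc j) S3" using S3(2,3) by (auto simp: less_Suc_eq)
          then have "?I (Suc j) \<rho> i3 h3 m3" using S3(1) by blast
          then show "?Q \<rho>3 i3 h3 m3" unfolding \<rho>3 \<rho> by blast
        qed (use \<rho> nV in simp_all)
      qed (use \<rho> 1 j S' reg pos bnd in simp_all)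
    next
      fix i1 assume 1: "i1 \<le> length x + 1" "\<not> mem (?\<rho> c) (?\<rho> rX)"
      then show "wp Skip ?Q ?\<rho> i1 h' m'"
        using \<rho> S'(1) by (intro skip) auto
    qed (use \<rho> j S' reg pos in simp_all)
    then show "wp (IFMEM c rX (IFSET c b rX (FOR rZ rN rCZ (IFMEM c rZ (EDGE (SET c b rZ 1) Skip) Skip)) Skip) Skip) ?Q
       (\<rho>'(rCX := n - Suc j, rX := j)) i' h' m'" unfolding \<rho>' .
  next
    show "?I 0 \<rho> i h m" using i m fr R by auto
  next
    fix \<rho>' i' h' m'
    assume "?I n \<rho>' i' h' m'"
    then obtain S' where S': "?G S' i' h' m'" "?D n S'" and \<rho>': "\<rho>' = \<rho>" by blast
    show "Q \<rho>' i' h' m'" unfolding \<rho>' by (rule Q[of i' h' m' S']) (use S' in auto)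
  qed (use z nV in simp_all)
qed

end

section \<open>The recursion stack\<close>

text \<open>
  Work tape 0 is the stack, work tape 1 stores the marks, and cell 0 of both carries the marker 9.
  A stack symbol is the stage that its call has reached.  Symbols 4 and 6 stand for a pending
  call on the left and on the right child, symbols 2 and 8 for a pending call with half the
  length bound; the position of the call on top of the stack is recomputed from the symbols below.
\<close>

definition CHILD :: "bool \<Rightarrow> com" where
  "CHILD d = RANK rC rN rB ;; ADD rN rC ;; Inc rC ;; Inc rC ;; (if d then SKIP rC else Skip)"

text \<open>The symbols below the top one tell where the current call takes place. The top symbol is
  only the stage of that call, and \<open>Dec rE\<close> excludes it from the replay.\<close>

definition LOCATE :: com where
  "LOCATE = ADD rRoot rC ;; ADD rK0 rKK ;; WhileC (Tp 0 (- {9})) (Mv 0 MoveLeft ;; Inc rE) ;;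
     Dec rE ;; Mv 0 MoveRight ;;
     WhileC (NZ rE) (Dec rE ;;
       IfC (Tp 0 {4}) (CHILD False) (IfC (Tp 0 {6}) (CHILD True) (Dec rKK)) ;; Mv 0 MoveRight)"

definition SAVE :: com where
  "SAVE = ADD rC rC0 ;; ADD rB rB0"

definition RESTORE :: com where
  "RESTORE = CLR rC ;; CLR rB ;; MOVE rC0 rC ;; MOVE rB0 rB"

definition PUSH :: com where
  "PUSH = Mv 0 MoveRight ;; Wr 0 1"

definition HALVE :: "nat \<Rightarrow> com" where
  "HALVE a = Wr 0 a ;; IfC (NZ rKK) PUSH Skip"

definition DOWN :: "bool \<Rightarrow> nat \<Rightarrow> nat \<Rightarrow> com" where
  "DOWN d a a' = SAVE ;; CHILD d ;; GOTO rC ;;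
     IfC (In {Sym One}) (TRANSFER True rC0 rB0 rC rB ;; Wr 0 a ;; PUSH) (Wr 0 a') ;; RESTORE"

definition UP :: "bool \<Rightarrow> nat \<Rightarrow> com" where
  "UP d a = SAVE ;; CHILD d ;; TRANSFER False rC rB rC0 rB0 ;; Wr 0 a ;; RESTORE"

text \<open>Symbols 2, 4, 6 and 8 have two readings: below another symbol they say which call is
  pending, on top they say that this call has returned (or that a halving was skipped at
  \<open>k = 0\<close>), and their action is what comes next. So popping the top symbol resumes the
  caller.\<close>

definition stage :: "nat \<Rightarrow> com" where
  "stage a = (if a = 1 then HALVE 2 else if a = 2 then EDGES rC rB ;; Wr 0 3
     else if a = 3 then DOWN False 4 5 else if a = 4 then UP False 5
     else if a = 5 then DOWN True 6 7 else if a = 6 then UP True 7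
     else if a = 7 then HALVE 8 else Mv 0 MoveLeft)"

primrec dispatch :: "nat list \<Rightarrow> com" where
  "dispatch [] = Skip"
| "dispatch (a # as) = IfC (Tp 0 {a}) (stage a) (dispatch as)"

definition BODY :: com where
  "BODY = LOCATE ;; dispatch [1, 2, 3, 4, 5, 6, 7, 8] ;; CLR rC ;; CLR rB ;; CLR rKK"

definition stack :: "nat list \<Rightarrow> (nat \<Rightarrow> nat) \<Rightarrow> nat \<Rightarrow> bool" where
  "stack ds f p \<longleftrightarrow> f 0 = 9 \<and> p = length ds \<and> (\<forall>i<length ds. f (Suc i) = ds ! i) \<and> 9 \<notin> set ds"

lemma stack_upd: "stack (ds @ [a]) f p \<Longrightarrow> a' \<noteq> 9 \<Longrightarrow> stack (ds @ [a']) (f(p := a')) p"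
  by (auto simp: stack_def fun_upd_apply nth_append)

lemma stack_push: "stack ds f p \<Longrightarrow> a \<noteq> 9 \<Longrightarrow> stack (ds @ [a]) (f(Suc p := a)) (Suc p)"
  by (auto simp: stack_def fun_upd_apply nth_append)

lemma stack_pop: "stack (ds @ [a]) f p \<Longrightarrow> stack ds f (p - 1)"
  by (auto simp: stack_def nth_append)

lemma stack_top: "stack (ds @ [a]) f p \<Longrightarrow> f p = a"
  by (auto simp: stack_def nth_append)

locale ram_tree = ram_graph +
  fixes T :: "nat set tree" and root k0 :: nat
  assumes inp_T: "inp x root (encode_tree n T)" and T: "T \<noteq> Leaf" and k0: "k0 \<le> V" and A0: "A 0 \<le> V"
begin

text \<open>
  \<open>loc ds t c b k\<close>: below the stack symbols \<open>ds\<close> lies a call on the subtree \<open>t\<close>, encoded at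
  position \<open>c\<close>, with marks following cell \<open>b\<close>, for walks of length \<open>2 ^ k\<close>.
\<close>

inductive loc :: "nat list \<Rightarrow> nat set tree \<Rightarrow> nat \<Rightarrow> nat \<Rightarrow> nat \<Rightarrow> bool" where
  loc_root: "loc [] T root 0 k0"
| loc_left: "loc ds \<langle>l, S, r\<rangle> c b k \<Longrightarrow> l \<noteq> Leaf \<Longrightarrow> loc (ds @ [4]) l (c + Suc (Suc n)) (b + rank c n) k"
| loc_right: "loc ds \<langle>l, S, r\<rangle> c b k \<Longrightarrow> r \<noteq> Leaf \<Longrightarrow>
    loc (ds @ [6]) r (c + Suc (Suc n) + length (encode_tree n l)) (b + rank c n) k"
| loc_half: "loc ds t c b (Suc k) \<Longrightarrow> d = 2 \<or> d = 8 \<Longrightarrow> loc (ds @ [d]) t c b k"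

lemma inp_node:
  assumes "inp x c (encode_tree n \<langle>l, S, r\<rangle>)"
  shows "inp x (c + Suc (Suc n)) (encode_tree n l)"
    "inp x (c + Suc (Suc n) + length (encode_tree n l)) (encode_tree n r)"
    "c + Suc (Suc n) + length (encode_tree n l) \<le> length x" "inp x (Suc c) (encode_set n S)" "bit_at x c"
proof -
  from inp_Cons[of x c One "encode_set n S @ encode_tree n l @ encode_tree n r"] assms
  have 1: "inp x (Suc c) (encode_set n S @ encode_tree n l @ encode_tree n r)" "bit_at x c"
    by (auto simp: bit_at_def)
  from inp_append[OF 1(1)] have 2: "inp x (Suc c) (encode_set n S)"
    "inp x (c + Suc (Suc n)) (encode_tree n l @ encode_tree n r)" by auto
  from inp_append[OF 2(2)] show 3: "inp x (c + Suc (Suc n)) (encode_tree n l)"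
    "inp x (c + Suc (Suc n) + length (encode_tree n l)) (encode_tree n r)" by auto
  have "encode_tree n r \<noteq> []" by (cases r) auto
  then show "c + Suc (Suc n) + length (encode_tree n l) \<le> length x"
    using inp_length[OF 3(2)] by (cases "encode_tree n r") auto
  show "inp x (Suc c) (encode_set n S)" "bit_at x c" by (fact 2 1)+
qed

lemma loc_inp: "loc ds t c b k \<Longrightarrow> inp x c (encode_tree n t) \<and> t \<noteq> Leaf"
  by (induction rule: loc.induct) (use inp_T T inp_node in auto)

lemma loc_pos: "loc ds t c b k \<Longrightarrow> c + Suc (Suc n) \<le> length x"
proof -
  assume "loc ds t c b k"
  then obtain l S r where "inp x c (encode_tree n \<langle>l, S, r\<rangle>)" using loc_inp by (metis tree.exhaust)
  from inp_node(3)[OF this] show ?thesis by simp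
qed

lemma wp_CHILD:
  assumes "inp x (\<rho> rC) (encode_tree n \<langle>l, S, r\<rangle>)" "clean1 \<rho>" "\<rho> rD = 0" "\<rho> rB + rank (\<rho> rC) n \<le> V" "i \<le> length x + 1"
    and Q: "\<And>i. i \<le> length x + 1 \<Longrightarrow> Q (\<rho>(rC := \<rho> rC + Suc (Suc n) + (if d then length (encode_tree n l) else 0),
      rB := \<rho> rB + rank (\<rho> rC) n)) i h m"
  shows "wp (CHILD d) Q \<rho> i h m"
  unfolding CHILD_def wp.simps(7)
proof (rule wp_RANK)
  note node = inp_node[OF assms(1)]
  note cl = assms(2)[unfolded clean1_def] assms(3)
  fix i1 assume i1: "i1 \<le> length x + 1"
  let ?\<rho>1 = "\<rho>(rB := \<rho> rB + rank (\<rho> rC) (\<rho> rN))"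
  show "wp (ADD rN rC) (wp (Inc rC) (wp (Inc rC) (wp (if d then SKIP rC else Skip) Q))) ?\<rho>1 i1 h m"
  proof (rule wp_ADD)
    let ?\<rho>2 = "\<rho>(rB := \<rho> rB + rank (\<rho> rC) n, rC := \<rho> rC + Suc (Suc n))"
    have eq: "?\<rho>2 = \<rho>(rC := \<rho> rC + Suc (Suc n), rB := \<rho> rB + rank (\<rho> rC) n)"
      by (simp add: fun_upd_twist)
    have "wp (if d then SKIP rC else Skip) Q ?\<rho>2 i1 h m"
    proof (cases d)
      case True
      have "wp (SKIP rC) Q ?\<rho>2 i1 h m"
        by (rule wp_SKIP[where t = l]) (use node cl i1 Q True in \<open>auto simp: fun_upd_twist\<close>)
      then show ?thesis using True by simp
    next
      case False
      then show ?thesis using Q[OF i1] eq by simp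
    qed
    moreover have "?\<rho>1(rC := ?\<rho>1 rC + ?\<rho>1 rN, rC := Suc (\<rho> rC + n), rC := Suc (Suc (\<rho> rC + n))) = ?\<rho>2"
      using cl by simp
    ultimately show "wp (Inc rC) (wp (Inc rC) (wp (if d then SKIP rC else Skip) Q)) (?\<rho>1(rC := ?\<rho>1 rC + ?\<rho>1 rN)) i1 h m"
      using node(3) LV cl by simp
  qed (use node(3) LV cl in auto)
qed (use assms inp_node(3)[OF assms(1)] in \<open>auto simp: clean1_def\<close>)

text \<open>\<open>loc\<close> grows at the far end of the stack, so the induction peels off the
  symbol that the replay treats last. The statement therefore allows \<open>r\<close> further rounds
  after those for \<open>ds\<close>.\<close>

lemma loc_run:
  fixes Q :: pred and \<rho> :: regs
  defines "F \<equiv> wp (Dec rE ;; IfC (Tp 0 {4}) (CHILD False) (IfC (Tp 0 {6}) (CHILD True) (Dec rKK)) ;; Mv 0 MoveRight)"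
  assumes "loc ds t c b k" "clean \<rho>" "\<forall>j<length ds. m 0 (Suc j) = ds ! j" "b \<le> V" "Suc (length ds) \<le> A 0" "i \<le> length x + 1"
    "\<And>i. i \<le> length x + 1 \<Longrightarrow> while1 F (test x (NZ rE)) Q r (\<rho>(rC := c, rB := b, rKK := k, rE := r)) i (h(0 := Suc (length ds))) m"
  shows "while1 F (test x (NZ rE)) Q (length ds + r) (\<rho>(rC := root, rB := 0, rKK := k0, rE := length ds + r)) i (h(0 := 1)) m"
proof -
  have F_I: "F P (\<rho>'(rE := Suc r)) i h' m"
    if "wp (IfC (Tp 0 {4}) (CHILD False) (IfC (Tp 0 {6}) (CHILD True) (Dec rKK))) (wp (Mv 0 MoveRight) P) (\<rho>'(rE := r)) i h' m"
    for P \<rho>' r i h'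
    unfolding F_def wp.simps(3,7) using that by simp
  show ?thesis
    using assms(2-)
proof (induction arbitrary: r i rule: loc.induct)
  case loc_root
  then show ?case by simp
next
  case (loc_left ds l S r' c b k)
  have inp: "inp x c (encode_tree n \<langle>l, S, r'\<rangle>)" using loc_inp[OF loc_left(1)] by simp
  have top: "m 0 (Suc (length ds)) = 4" using loc_left.prems(2) by (auto simp: nth_append)
  have "F (while1 F (test x (NZ rE)) Q r) (\<rho>(rC := c, rB := b, rKK := k, rE := Suc r)) i (h(0 := Suc (length ds))) m"
    if "i \<le> length x + 1" for i
  proof (rule F_I)
    have "wp (CHILD False) (wp (Mv 0 MoveRight) (while1 F (test x (NZ rE)) Q r)) (\<rho>(rC := c, rB := b, rKK := k, rE := r)) i (h(0 := Suc (length ds))) m"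
    proof (rule wp_CHILD)
      fix i assume i: "i \<le> length x + 1"
      have "(\<rho>(rC := c, rB := b, rKK := k, rE := r))(rC := c + Suc (Suc n), rB := b + rank c n) =
        \<rho>(rC := c + Suc (Suc n), rB := b + rank c n, rKK := k, rE := r)"
        by (simp add: fun_upd_twist)
      then show "wp (Mv 0 MoveRight) (while1 F (test x (NZ rE)) Q r) ((\<rho>(rC := c, rB := b, rKK := k, rE := r))
          (rC := (\<rho>(rC := c, rB := b, rKK := k, rE := r)) rC + Suc (Suc n) + (if False then length (encode_tree n l) else 0),
           rB := (\<rho>(rC := c, rB := b, rKK := k, rE := r)) rB + rank ((\<rho>(rC := c, rB := b, rKK := k, rE := r)) rC) n))
          i (h(0 := Suc (length ds))) m"
        using loc_left.prems(4,6) i by simp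
    qed (use inp loc_left.prems that in \<open>auto simp: clean_def clean1_def\<close>)
    then show "wp (IfC (Tp 0 {4}) (CHILD False) (IfC (Tp 0 {6}) (CHILD True) (Dec rKK)))
        (wp (Mv 0 MoveRight) (while1 F (test x (NZ rE)) Q r)) (\<rho>(rC := c, rB := b, rKK := k, rE := r)) i (h(0 := Suc (length ds))) m"
      using top by simp
  qed
  then have "while1 F (test x (NZ rE)) Q (length ds + Suc r) (\<rho>(rC := root, rB := 0, rKK := k0, rE := length ds + Suc r)) i (h(0 := 1)) m"
    by (intro loc_left.IH) (use loc_left.prems in \<open>auto simp: nth_append\<close>)
  then show ?case by simp
next
  case (loc_right ds l S r' c b k)
  have inp: "inp x c (encode_tree n \<langle>l, S, r'\<rangle>)" using loc_inp[OF loc_right(1)] by simp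
  have top: "m 0 (Suc (length ds)) = 6" using loc_right.prems(2) by (auto simp: nth_append)
  have "F (while1 F (test x (NZ rE)) Q r) (\<rho>(rC := c, rB := b, rKK := k, rE := Suc r)) i (h(0 := Suc (length ds))) m"
    if "i \<le> length x + 1" for i
  proof (rule F_I)
    have "wp (CHILD True) (wp (Mv 0 MoveRight) (while1 F (test x (NZ rE)) Q r)) (\<rho>(rC := c, rB := b, rKK := k, rE := r)) i (h(0 := Suc (length ds))) m"
    proof (rule wp_CHILD)
      fix i assume i: "i \<le> length x + 1"
      have "(\<rho>(rC := c, rB := b, rKK := k, rE := r))(rC := c + Suc (Suc n) + length (encode_tree n l), rB := b + rank c n) =
        \<rho>(rC := c + Suc (Suc n) + length (encode_tree n l), rB := b + rank c n, rKK := k, rE := r)"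
        by (simp add: fun_upd_twist)
      then show "wp (Mv 0 MoveRight) (while1 F (test x (NZ rE)) Q r) ((\<rho>(rC := c, rB := b, rKK := k, rE := r))
          (rC := (\<rho>(rC := c, rB := b, rKK := k, rE := r)) rC + Suc (Suc n) + (if True then length (encode_tree n l) else 0),
           rB := (\<rho>(rC := c, rB := b, rKK := k, rE := r)) rB + rank ((\<rho>(rC := c, rB := b, rKK := k, rE := r)) rC) n))
          i (h(0 := Suc (length ds))) m"
        using loc_right.prems(4,6) i by simp
    qed (use inp loc_right.prems that in \<open>auto simp: clean_def clean1_def\<close>)
    then show "wp (IfC (Tp 0 {4}) (CHILD False) (IfC (Tp 0 {6}) (CHILD True) (Dec rKK)))
        (wp (Mv 0 MoveRight) (while1 F (test x (NZ rE)) Q r)) (\<rho>(rC := c, rB := b, rKK := k, rE := r)) i (h(0 := Suc (length ds))) m"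
      using top by simp
  qed
  then have "while1 F (test x (NZ rE)) Q (length ds + Suc r) (\<rho>(rC := root, rB := 0, rKK := k0, rE := length ds + Suc r)) i (h(0 := 1)) m"
    by (intro loc_right.IH) (use loc_right.prems in \<open>auto simp: nth_append\<close>)
  then show ?case by simp
next
  case (loc_half ds t c b k d)
  have top: "m 0 (Suc (length ds)) = d" using loc_half.prems(2) by (auto simp: nth_append)
  have "F (while1 F (test x (NZ rE)) Q r) (\<rho>(rC := c, rB := b, rKK := Suc k, rE := Suc r)) i (h(0 := Suc (length ds))) m"
    if "i \<le> length x + 1" for i
  proof (rule F_I)
    have "\<rho>(rC := c, rB := b, rKK := Suc k, rE := r, rKK := k) = \<rho>(rC := c, rB := b, rKK := k, rE := r)"
      by (simp add: fun_upd_twist)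
    then show "wp (IfC (Tp 0 {4}) (CHILD False) (IfC (Tp 0 {6}) (CHILD True) (Dec rKK)))
        (wp (Mv 0 MoveRight) (while1 F (test x (NZ rE)) Q r)) (\<rho>(rC := c, rB := b, rKK := Suc k, rE := r)) i (h(0 := Suc (length ds))) m"
      using top loc_half.hyps(2) loc_half.prems(4,6) that by auto
  qed
  then have "while1 F (test x (NZ rE)) Q (length ds + Suc r) (\<rho>(rC := root, rB := 0, rKK := k0, rE := length ds + Suc r)) i (h(0 := 1)) m"
    by (intro loc_half.IH) (use loc_half.prems in \<open>auto simp: nth_append\<close>)
  then show ?case by simp
qed
qed

text \<open>Between two rounds all registers used by the loop are zero except for the constants: the
  state of the recursion lives on the two work tapes alone.\<close>

definition ready :: "regs \<Rightarrow> bool" where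
  "ready \<rho> \<longleftrightarrow> clean \<rho> \<and> \<rho> rRoot = root \<and> \<rho> rK0 = k0 \<and> \<rho> rC = 0 \<and> \<rho> rB = 0 \<and> \<rho> rKK = 0 \<and> \<rho> rC0 = 0 \<and> \<rho> rB0 = 0"

lemma wp_LOCATE:
  assumes "loc ds t c b k" "stack (ds @ [a]) (m 0) (h 0)" "ready \<rho>" "b \<le> V" "Suc (length ds) \<le> A 0" "i \<le> length x + 1"
    and Q: "\<And>i. i \<le> length x + 1 \<Longrightarrow> Q (\<rho>(rC := c, rB := b, rKK := k)) i h m"
  shows "wp LOCATE Q \<rho> i h m"
  unfolding LOCATE_def wp.simps(7)
proof (rule wp_ADD, goal_cases)
  case 6
  note rd = assms(3)[unfolded ready_def clean_def clean1_def]
  let ?L = "WhileC (NZ rE) (Dec rE ;;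
       IfC (Tp 0 {4}) (CHILD False) (IfC (Tp 0 {6}) (CHILD True) (Dec rKK)) ;; Mv 0 MoveRight)"
  let ?R = "wp (Dec rE) (wp (Mv 0 MoveRight) (wp ?L Q))"
  have h: "h 0 = Suc (length ds)" "m 0 0 = 9" and ds: "\<forall>j<length ds. m 0 (Suc j) = ds ! j"
    using assms(2) by (auto simp: stack_def nth_append)
  have ne: "m 0 (Suc j) \<noteq> 9" if "j < Suc (length ds)" for j
    using assms(2) that unfolding stack_def by (metis length_append_singleton nth_mem)
  let ?\<rho> = "\<rho>(rC := root, rKK := k0)"
  let ?W = "wp (Dec rE ;; IfC (Tp 0 {4}) (CHILD False) (IfC (Tp 0 {6}) (CHILD True) (Dec rKK)) ;; Mv 0 MoveRight)"
  have "while1 ?W (test x (NZ rE)) Q (length ds + 0) (\<rho>(rC := root, rB := 0, rKK := k0, rE := length ds + 0)) i (h(0 := 1)) m"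
  proof (rule loc_run[OF assms(1)])
    fix i assume i: "i \<le> length x + 1"
    have "\<rho>(rC := c, rB := b, rKK := k, rE := 0) = \<rho>(rC := c, rB := b, rKK := k)" "h(0 := Suc (length ds)) = h"
      using rd h by (auto simp: fun_upd_idem)
    then show "while1 ?W (test x (NZ rE)) Q 0 (\<rho>(rC := c, rB := b, rKK := k, rE := 0)) i (h(0 := Suc (length ds))) m"
      using Q[OF i] rd by simp
  qed (use assms ds in \<open>auto simp: ready_def\<close>)
  then have "wp ?L Q (\<rho>(rC := root, rB := 0, rKK := k0, rE := length ds)) i (h(0 := 1)) m"
    using assms(5) AB by (intro wp_WhileI[where k = "length ds"]) auto
  moreover have "\<rho>(rC := root, rB := 0, rKK := k0, rE := length ds) = ?\<rho>(rE := length ds)"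
    using rd by (auto simp: fun_eq_iff fun_upd_apply)
  ultimately have R: "?R (?\<rho>(rE := Suc (length ds))) i (h(0 := 0)) m"
    using assms(5) by simp
  have "while1 (wp (Mv 0 MoveLeft ;; Inc rE)) (test x (Tp 0 (- {9}))) ?R p (?\<rho>(rE := Suc (length ds) - p)) i (h(0 := p)) m"
    if "p \<le> Suc (length ds)" for p
    using that
  proof (induction p)
    case 0
    then show ?case using R h by simp
  next
    case (Suc p)
    have "Suc (length ds - p) = Suc (length ds) - p" using Suc.prems by simp
    then show ?case using Suc h ne[of p] assms(5) A0 by simp
  qed
  from this[of "Suc (length ds)"] have "while1 (wp (Mv 0 MoveLeft ;; Inc rE)) (test x (Tp 0 (- {9}))) ?R (Suc (length ds)) ?\<rho> i h m"
    using rd h by (simp add: fun_upd_idem)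
  then have "wp (WhileC (Tp 0 (- {9})) (Mv 0 MoveLeft ;; Inc rE)) ?R ?\<rho> i h m"
    by (rule wp_WhileI) (use assms(5) AB in simp)
  then show ?case
    by (intro wp_ADD) (use rd k0 in simp_all)
qed (use assms(3) loc_pos[OF loc_root] LV in \<open>auto simp: ready_def clean_def clean1_def\<close>)

definition st :: "nat list \<Rightarrow> (nat \<Rightarrow> nat) \<Rightarrow> nat \<Rightarrow> (nat \<Rightarrow> nat) \<Rightarrow> (nat \<Rightarrow> nat \<Rightarrow> nat) \<Rightarrow> bool" where
  "st ds f i h m \<longleftrightarrow> i \<le> length x + 1 \<and> stack ds (m 0) (h 0) \<and> h 1 \<le> A 1 \<and> m 1 = f \<and> marks_ok f"

lemma wp_dispatch:
  assumes "m 0 (h 0) = a" "a \<in> set as" "wp (stage a) Q \<rho> i h m"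
  shows "wp (dispatch as) Q \<rho> i h m"
  using assms
proof (induction as)
  case (Cons a' as)
  then show ?case unfolding dispatch.simps by (auto simp del: dispatch.simps)
qed simp

text \<open>The position is recomputed in every round and forgotten at its end; a stage only has to
  give back the registers as \<open>LOCATE\<close> left them.\<close>

lemma wp_BODY:
  assumes loc: "loc ds t c b k" and st: "st (ds @ [a]) f i h m" and a: "a \<in> {1, 2, 3, 4, 5, 6, 7, 8}"
    and rd: "ready \<rho>" and bd: "b \<le> V" "Suc (length ds) \<le> A 0" "k \<le> V"
    and stage: "\<And>i. st (ds @ [a]) f i h m \<Longrightarrow>
      wp (stage a) (\<lambda>\<rho>' i' h' m'. \<rho>' = \<rho>(rC := c, rB := b, rKK := k) \<and> Q \<rho> i' h' m') (\<rho>(rC := c, rB := b, rKK := k)) i h m"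
  shows "wp BODY Q \<rho> i h m"
  unfolding BODY_def wp.simps(7)
proof (rule wp_LOCATE[OF loc])
  let ?\<rho> = "\<rho>(rC := c, rB := b, rKK := k)"
  fix i' assume "i' \<le> length x + 1"
  then have st': "st (ds @ [a]) f i' h m" using st by (simp add: st_def)
  have "c \<le> V" using loc_pos[OF loc] LV by simp
  then have fin: "wp (CLR rC) (wp (CLR rB) (wp (CLR rKK) Q)) ?\<rho> i'' h'' m''" if "Q \<rho> i'' h'' m''" for i'' h'' m''
    using bd that rd by (intro wp_CLR) (auto simp: ready_def fun_upd_twist fun_upd_idem)
  have "wp (stage a) (wp (CLR rC) (wp (CLR rB) (wp (CLR rKK) Q))) ?\<rho> i' h m"
    by (rule wp_mono[OF stage[OF st']]) (use fin in blast)
  then show "wp (dispatch [1, 2, 3, 4, 5, 6, 7, 8]) (wp (CLR rC) (wp (CLR rB) (wp (CLR rKK) Q))) ?\<rho> i' h m"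
    by (rule wp_dispatch[rotated 2]) (use st a in \<open>auto simp: st_def dest: stack_top\<close>)
qed (use st rd bd in \<open>auto simp: st_def\<close>)

end

section \<open>Walks through a tree decomposition\<close>

definition bag_verts :: "'v set tree \<Rightarrow> 'v set" where
  "bag_verts t = \<Union> (set_tree t)"

fun root_bag :: "'v set tree \<Rightarrow> 'v set" where
  "root_bag \<langle>\<rangle> = {}"
| "root_bag \<langle>l, S, r\<rangle> = S"

text \<open>Connectivity of the decomposition in a form that speaks of a node and its children only,
  so that it passes to subtrees by definition.\<close>

fun separated :: "'v set tree \<Rightarrow> bool" where
  "separated \<langle>\<rangle> \<longleftrightarrow> True"
| "separated \<langle>l, S, r\<rangle> \<longleftrightarrow> bag_verts l \<inter> bag_verts r \<subseteq> S \<and> bag_verts l \<inter> S \<subseteq> root_bag l \<and>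
     bag_verts r \<inter> S \<subseteq> root_bag r \<and> separated l \<and> separated r"

definition covers :: "('v \<Rightarrow> 'v \<Rightarrow> bool) \<Rightarrow> 'v set tree \<Rightarrow> bool" where
  "covers E t \<longleftrightarrow> (\<forall>y\<in>bag_verts t. \<forall>z\<in>bag_verts t. E y z \<longrightarrow> (\<exists>S\<in>set_tree t. y \<in> S \<and> z \<in> S))"

definition walk :: "('v \<Rightarrow> 'v \<Rightarrow> bool) \<Rightarrow> 'v set \<Rightarrow> (nat \<Rightarrow> 'v) \<Rightarrow> nat \<Rightarrow> bool" where
  "walk E X z m \<longleftrightarrow> (\<forall>i\<le>m. z i \<in> X) \<and> (\<forall>i<m. E (z i) (z (Suc i)))"

text \<open>\<open>M'\<close> contains the vertices of the root bag reached from \<open>M\<close> by short walks inside the subtree.\<close>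

definition complete_marks :: "('v \<Rightarrow> 'v \<Rightarrow> bool) \<Rightarrow> 'v set tree \<Rightarrow> nat \<Rightarrow> 'v set \<Rightarrow> 'v set \<Rightarrow> bool" where
  "complete_marks E t k M M' \<longleftrightarrow>
     (\<forall>z m. m \<le> 2 ^ k \<longrightarrow> walk E (bag_verts t) z m \<longrightarrow> z 0 \<in> M \<longrightarrow> z m \<in> root_bag t \<longrightarrow> z m \<in> M')"

lemma bag_verts_Node [simp]: "bag_verts \<langle>l, S, r\<rangle> = bag_verts l \<union> S \<union> bag_verts r"
  by (auto simp: bag_verts_def)

lemma bag_verts_Leaf [simp]: "bag_verts \<langle>\<rangle> = {}"
  by (simp add: bag_verts_def)

text \<open>If the bag covering an edge of \<open>l\<close> is not a bag of \<open>l\<close>, then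
  both ends are shared by \<open>l\<close> with the rest of the tree; they lie in \<open>S\<close>
  and so in the root bag of \<open>l\<close>, which covers the edge instead.\<close>

lemma covers_left:
  assumes "covers E \<langle>l, S, r\<rangle>" "separated \<langle>l, S, r\<rangle>"
  shows "covers E l"
  unfolding covers_def
proof (intro ballI impI)
  fix y z assume *: "y \<in> bag_verts l" "z \<in> bag_verts l" "E y z"
  then obtain X where X: "X \<in> set_tree \<langle>l, S, r\<rangle>" "y \<in> X" "z \<in> X"
    using assms(1) unfolding covers_def by auto
  show "\<exists>S\<in>set_tree l. y \<in> S \<and> z \<in> S"
  proof (cases "X \<in> set_tree l")
    case False
    then have "y \<in> S \<and> z \<in> S" using X * assms(2) by (auto simp: bag_verts_def)
    then have "y \<in> root_bag l \<and> z \<in> root_bag l" using * assms(2) by auto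
    then show ?thesis by (cases l) auto
  qed (use X in auto)
qed

lemma covers_mirror: "covers E \<langle>l, S, r\<rangle> = covers E \<langle>r, S, l\<rangle>"
  by (auto simp: covers_def)

lemma separated_mirror: "separated \<langle>l, S, r\<rangle> = separated \<langle>r, S, l\<rangle>"
  by auto

lemma covers_right:
  "covers E \<langle>l, S, r\<rangle> \<Longrightarrow> separated \<langle>l, S, r\<rangle> \<Longrightarrow> covers E r"
  using covers_left[of E r S l] covers_mirror[of E l S r] separated_mirror[of l S r] by auto

text \<open>A vertex of \<open>l\<close> outside \<open>S\<close> occurs in bags of \<open>l\<close>
  only, so every edge at it is covered by a bag of \<open>l\<close> and leads to a vertex of
  \<open>l\<close>. As the inner vertices avoid \<open>S\<close>, membership in \<open>l\<close>
  spreads along the whole stretch, including its two ends.\<close>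

lemma walk_inside:
  assumes cov: "covers E \<langle>l, S, r\<rangle>" and sep: "separated \<langle>l, S, r\<rangle>"
    and w: "walk E (bag_verts \<langle>l, S, r\<rangle>) z m" and ab: "a < b" "b \<le> m"
    and avoid: "\<And>i. a < i \<Longrightarrow> i < b \<Longrightarrow> z i \<notin> S" and long: "Suc a < b" and l: "z (Suc a) \<in> bag_verts l"
  shows "\<forall>i. a \<le> i \<longrightarrow> i \<le> b \<longrightarrow> z i \<in> bag_verts l"
proof -
  have edge: "z i \<in> bag_verts l \<longleftrightarrow> z (Suc i) \<in> bag_verts l"
    if i: "a \<le> i" "i < b" and not_both: "(a < i \<and> z i \<in> bag_verts l) \<or> (Suc i < b \<and> z (Suc i) \<in> bag_verts l)" for i
  proof -
    have "E (z i) (z (Suc i))" "z i \<in> bag_verts \<langle>l, S, r\<rangle>" "z (Suc i) \<in> bag_verts \<langle>l, S, r\<rangle>"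
      using w i ab unfolding walk_def by auto
    then obtain X where X: "X \<in> set_tree \<langle>l, S, r\<rangle>" "z i \<in> X" "z (Suc i) \<in> X"
      using cov unfolding covers_def by blast
    from not_both have "X \<in> set_tree l"
    proof
      assume 1: "a < i \<and> z i \<in> bag_verts l"
      then have "z i \<notin> S" using avoid i by auto
      then show ?thesis using X 1 sep by (auto simp: bag_verts_def)
    next
      assume 1: "Suc i < b \<and> z (Suc i) \<in> bag_verts l"
      then have "z (Suc i) \<notin> S" using avoid i by auto
      then show ?thesis using X 1 sep by (auto simp: bag_verts_def)
    qed
    then show ?thesis using X by (auto simp: bag_verts_def)
  qed
  have up: "z (Suc a + j) \<in> bag_verts l" if "Suc a + j \<le> b" for j
    using that
  proof (induction j)
    case 0
    then show ?case using l by simp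
  next
    case (Suc j)
    then show ?case using edge[of "Suc a + j"] by auto
  qed
  have "z a \<in> bag_verts l" using edge[of a] l long by auto
  then show ?thesis
  proof (intro allI impI)
    fix i assume "a \<le> i" "i \<le> b" "z a \<in> bag_verts l"
    then show "z i \<in> bag_verts l" using up[of "i - Suc a"] by (cases "i = a") auto
  qed
qed

text \<open>The ends of the stretch lie in \<open>S\<close> and in the child, hence in the root bag
  of the child: exactly the vertices whose marks are exchanged.\<close>

lemma complete_marks_child:
  assumes cov: "covers E \<langle>l, S, r\<rangle>" and sep: "separated \<langle>l, S, r\<rangle>"
    and w: "walk E (bag_verts \<langle>l, S, r\<rangle>) z m" and ab: "Suc a < b" "b \<le> m" "m \<le> 2 ^ k"
    and avoid: "\<And>i. a < i \<Longrightarrow> i < b \<Longrightarrow> z i \<notin> S" and l: "z (Suc a) \<in> bag_verts l"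
    and ends: "z a \<in> S" "z b \<in> S" "z a \<in> M" and c: "complete_marks E l k (M \<inter> root_bag l) M'"
  shows "z b \<in> M'"
proof -
  have inl: "\<forall>i. a \<le> i \<longrightarrow> i \<le> b \<longrightarrow> z i \<in> bag_verts l"
    by (rule walk_inside[OF cov sep w _ ab(2) avoid ab(1) l]) (use ab in auto)
  then have "z a \<in> root_bag l" "z b \<in> root_bag l" using ends sep ab by auto
  moreover have "walk E (bag_verts l) (\<lambda>i. z (a + i)) (b - a)"
    using inl w ab unfolding walk_def by auto
  moreover have "b - a \<le> 2 ^ k" using ab by auto
  ultimately show ?thesis using c ends ab unfolding complete_marks_def
    by (auto dest!: spec[of _ "\<lambda>i. z (a + i)"] spec[of _ "b - a"])
qed

text \<open>
  Cut a walk at its last visit \<open>a\<close> of the root bag in the first half and at the next visit \<open>b\<close>: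
  the parts before \<open>a\<close> and after \<open>b\<close> have at most half the length, and the part between runs
  inside one child, unless it is a single edge.
\<close>

lemma complete_marks_combine:
  assumes cov: "covers E \<langle>l, S, r\<rangle>" and sep: "separated \<langle>l, S, r\<rangle>" and M: "M \<subseteq> S"
    and 1: "M \<subseteq> M1" "\<And>k'. k = Suc k' \<Longrightarrow> complete_marks E \<langle>l, S, r\<rangle> k' M M1"
    and 2: "M1 \<subseteq> M2" "\<And>y z. y \<in> M1 \<Longrightarrow> y \<in> S \<Longrightarrow> z \<in> S \<Longrightarrow> E y z \<Longrightarrow> z \<in> M2"
    and 3: "M2 \<subseteq> M3" "complete_marks E l k (M2 \<inter> root_bag l) NL" "NL \<inter> S \<subseteq> M3"
    and 4: "M3 \<subseteq> M4" "complete_marks E r k (M3 \<inter> root_bag r) NR" "NR \<inter> S \<subseteq> M4"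
    and 5: "M4 \<subseteq> M5" "\<And>k'. k = Suc k' \<Longrightarrow> complete_marks E \<langle>l, S, r\<rangle> k' M4 M5"
  shows "complete_marks E \<langle>l, S, r\<rangle> k M M5"
  unfolding complete_marks_def
proof (intro allI impI)
  fix z m assume m: "m \<le> 2 ^ k" and w: "walk E (bag_verts \<langle>l, S, r\<rangle>) z m" and z0: "z 0 \<in> M"
    and zm: "z m \<in> root_bag \<langle>l, S, r\<rangle>"
  \<comment> \<open>\<open>H\<close> is half of the length bound. For \<open>k = 0\<close> the walk
    has at most one edge and there are no calls with a smaller bound, so the first half is
    empty.\<close>
  define H :: nat where "H = (case k of 0 \<Rightarrow> 0 | Suc k' \<Rightarrow> 2 ^ k')"
  have H: "m \<le> 2 * H \<or> (k = 0 \<and> m \<le> 1 \<and> H = 0)" using m by (cases k) (auto simp: H_def)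
  define a where "a = Max {i. i \<le> min H m \<and> z i \<in> S}"
  have "z 0 \<in> S" using z0 M by auto
  then have "{i. i \<le> min H m \<and> z i \<in> S} \<noteq> {}" by auto
  then have a: "a \<le> H" "a \<le> m" "z a \<in> S" "\<And>i. i \<le> H \<Longrightarrow> i \<le> m \<Longrightarrow> z i \<in> S \<Longrightarrow> i \<le> a"
    using Max_in[of "{i. i \<le> min H m \<and> z i \<in> S}"] Max_ge[of "{i. i \<le> min H m \<and> z i \<in> S}"]
    unfolding a_def by auto
  have za: "z a \<in> M1"
  proof (cases k)
    case 0
    then show ?thesis using a z0 1 by (auto simp: H_def)
  next
    case (Suc k')
    have "walk E (bag_verts \<langle>l, S, r\<rangle>) z a" using w a unfolding walk_def by auto
    then show ?thesis using 1(2)[OF Suc] a z0 Suc unfolding complete_marks_def by (auto simp: H_def)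
  qed
  show "z m \<in> M5"
  proof (cases "a = m")
    case True
    then show ?thesis using za 1(1) 2(1) 3(1) 4(1) 5(1) by blast
  next
    case False
    define b where "b = (LEAST i. a < i \<and> z i \<in> S)"
    have ex: "a < m \<and> z m \<in> S" using False a zm by auto
    have b: "a < b" "z b \<in> S" "b \<le> m" "\<And>i. a < i \<Longrightarrow> i < b \<Longrightarrow> z i \<notin> S"
    proof -
      show "a < b" "z b \<in> S" using LeastI[of "\<lambda>i. a < i \<and> z i \<in> S", OF ex] unfolding b_def by blast+
      show "b \<le> m" unfolding b_def by (rule Least_le) (rule ex)
      show "z i \<notin> S" if "a < i" "i < b" for i
        using not_less_Least[of i "\<lambda>i. a < i \<and> z i \<in> S"] that unfolding b_def by blast
    qed
    \<comment> \<open>\<open>a\<close> was the last visit of the bag up to \<open>H\<close>, so the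
      next visit comes after \<open>H\<close> and what remains behind it is at most half of the
      walk.\<close>
    have bH: "H < b" using a(4)[of b] b by (meson leD leI)
    have "z b \<in> M4"
    proof (cases "b = Suc a")
      case True
      then have "E (z a) (z b)" using w b unfolding walk_def by auto
      then show ?thesis using 2(2)[of "z a" "z b"] za a b 3 4 by auto
    next
      case False
      then have ab: "Suc a < b" using b by auto
      then have "z (Suc a) \<notin> S" using b by auto
      moreover have "z (Suc a) \<in> bag_verts \<langle>l, S, r\<rangle>" using w b unfolding walk_def by auto
      ultimately consider "z (Suc a) \<in> bag_verts l" | "z (Suc a) \<in> bag_verts r" by auto
      then show ?thesis
      proof cases
        case 1
        have "z b \<in> NL"
          by (rule complete_marks_child[OF cov sep w ab b(3) m b(4) 1 a(3) b(2) _ 3(2)]) (use za 2 in auto)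
        then show ?thesis using b 3 4 by auto
      next
        case 2
        have cov': "covers E \<langle>r, S, l\<rangle>" "separated \<langle>r, S, l\<rangle>" "walk E (bag_verts \<langle>r, S, l\<rangle>) z m"
          using cov sep w by (auto simp: covers_def Un_ac)
        have "z b \<in> NR"
          by (rule complete_marks_child[OF cov' ab b(3) m b(4) 2 a(3) b(2) _ 4(2)]) (use za assms(6) 3(1) in auto)
        then show ?thesis using b 4 by auto
      qed
    qed
    show ?thesis
    proof (cases k)
      case 0
      then have "b = m" using m b by auto
      then show ?thesis using \<open>z b \<in> M4\<close> 5 by auto
    next
      case (Suc k')
      have "m - b \<le> 2 ^ k'" using H bH Suc by (auto simp: H_def)
      moreover have "walk E (bag_verts \<langle>l, S, r\<rangle>) (\<lambda>i. z (b + i)) (m - b)"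
        using w b unfolding walk_def by auto
      ultimately show ?thesis
        using 5(2)[OF Suc] \<open>z b \<in> M4\<close> b zm unfolding complete_marks_def
        by (auto dest!: spec[of _ "\<lambda>i. z (b + i)"] spec[of _ "m - b"])
    qed
  qed
qed

section \<open>Adding a fixed set to all bags\<close>

definition enlarge :: "'v set \<Rightarrow> 'v set tree \<Rightarrow> 'v set tree" where
  "enlarge U t = map_tree (\<lambda>S. S \<union> U) t"

lemma enlarge_simps [simp]:
  "enlarge U \<langle>\<rangle> = \<langle>\<rangle>" "enlarge U \<langle>l, S, r\<rangle> = \<langle>enlarge U l, S \<union> U, enlarge U r\<rangle>"
  by (auto simp: enlarge_def)

lemma bag_verts_enlarge: "bag_verts (enlarge U t) = bag_verts t \<union> (if t = Leaf then {} else U)"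
  by (induction t) auto

lemma root_bag_enlarge: "root_bag (enlarge U t) = root_bag t \<union> (if t = Leaf then {} else U)"
  by (cases t) auto

text \<open>The new vertices are in every bag, in particular on the right-hand side of each
  inclusion.\<close>

lemma separated_enlarge: "separated t \<Longrightarrow> separated (enlarge U t)"
  by (induction t) (auto simp: bag_verts_enlarge root_bag_enlarge split: if_splits)

section \<open>From paths in the tree to local separation\<close>

fun subtree_at :: "'a tree \<Rightarrow> bool list \<Rightarrow> 'a tree" where
  "subtree_at t [] = t"
| "subtree_at \<langle>\<rangle> (b # p) = \<langle>\<rangle>"
| "subtree_at \<langle>l, S, r\<rangle> (b # p) = subtree_at (if b then r else l) p"

lemma nodes_subtree: "a @ p \<in> nodes t \<longleftrightarrow> p \<in> nodes (subtree_at t a)"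
  by (induction t a rule: subtree_at.induct) auto

lemma bag_subtree: "bag t (a @ p) = bag (subtree_at t a) p"
  by (induction t a rule: subtree_at.induct) auto

lemma subtree_at_snoc:
  "subtree_at t a = \<langle>l, S, r\<rangle> \<Longrightarrow> subtree_at t (a @ [b]) = (if b then r else l)"
  by (induction t a rule: subtree_at.induct) auto

lemma set_tree_bag: "set_tree t = bag t ` nodes t"
proof (induction t)
  case (Node l S r)
  then show ?case by (auto simp: image_image image_Un)
qed simp

lemma bag_vertsE:
  assumes "y \<in> bag_verts t"
  obtains p where "p \<in> nodes t" "y \<in> bag t p"
  using assms by (auto simp: bag_verts_def set_tree_bag)

lemma nodes_prefix: "a @ p \<in> nodes t \<Longrightarrow> a \<in> nodes t"
proof (induction t a rule: subtree_at.induct)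
  case (1 t)
  then show ?case by (cases t) auto
qed auto

context
  fixes T :: "'a tree"
begin

interpretation pair_wf_digraph "tree_graph T"
  by unfold_locales (auto simp: tree_graph_def)

lemma pverts_tree_graph: "pverts (tree_graph T) = nodes T"
  by (simp add: tree_graph_def)

lemma tree_arc: "a @ [b] \<in> nodes T \<Longrightarrow> (a, a @ [b]) \<in> parcs (tree_graph T) \<and> (a @ [b], a) \<in> parcs (tree_graph T)"
  using nodes_prefix[of a "[b]" T] by (auto simp: tree_graph_def)

lemma tree_path_down:
  "a @ p \<in> nodes T \<Longrightarrow> \<exists>w. apath a w (a @ p) \<and> (\<forall>y\<in>set (pawalk_verts a w). \<exists>s. y = a @ s)"
proof (induction p arbitrary: a)
  case Nil
  then have "apath a [] (a @ [])" by (simp add: apath_Nil_iff pverts_tree_graph)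
  then show ?case by (intro exI[of _ "[]"]) auto
next
  case (Cons b p)
  then obtain w where w: "apath (a @ [b]) w (a @ b # p)" "\<forall>y\<in>set (pawalk_verts (a @ [b]) w). \<exists>s. y = (a @ [b]) @ s"
    using Cons.IH[of "a @ [b]"] Cons.prems by auto
  have "a @ [b] \<in> nodes T" using nodes_prefix[of "a @ [b]" p T] Cons.prems by simp
  moreover have "a \<notin> set (pawalk_verts (a @ [b]) w)" using w(2) by fastforce
  ultimately have "apath a ((a, a @ [b]) # w) (a @ b # p)" using w(1) tree_arc by (simp add: apath_Cons_iff)
  then show ?case using w(2) by (intro exI[of _ "(a, a @ [b]) # w"]) fastforce
qed

text \<open>Prepending the climb from \<open>a @ p\<close> to \<open>a\<close> keeps a path simple
  as long as the given path does not descend below \<open>a\<close>. The induction bounds the depth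
  of the vertices added, so each new lowest vertex is fresh.\<close>

lemma tree_path_climb:
  assumes w: "apath a w c" "\<And>y q. y \<in> set (pawalk_verts a w) \<Longrightarrow> y = a @ q \<Longrightarrow> q = []"
  shows "a @ p \<in> nodes T \<Longrightarrow> \<exists>w'. apath (a @ p) w' c \<and> set (pawalk_verts a w) \<subseteq> set (pawalk_verts (a @ p) w') \<and>
    (\<forall>y\<in>set (pawalk_verts (a @ p) w'). y \<in> set (pawalk_verts a w) \<or> (\<exists>q. y = a @ q \<and> length q \<le> length p))"
proof (induction p rule: rev_induct)
  case Nil
  then show ?case using w by (intro exI[of _ w]) auto
next
  case (snoc b p)
  have "a @ p \<in> nodes T" using nodes_prefix[of "a @ p" "[b]" T] snoc.prems by simp
  then obtain w' where w': "apath (a @ p) w' c" "set (pawalk_verts a w) \<subseteq> set (pawalk_verts (a @ p) w')"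
    "\<And>y. y \<in> set (pawalk_verts (a @ p) w') \<Longrightarrow> y \<in> set (pawalk_verts a w) \<or> (\<exists>q. y = a @ q \<and> length q \<le> length p)"
    using snoc.IH by auto
  have "a @ p @ [b] \<notin> set (pawalk_verts (a @ p) w')"
    using w'(3)[of "a @ p @ [b]"] w(2)[of "a @ p @ [b]" "p @ [b]"] by auto
  then have "apath (a @ p @ [b]) ((a @ p @ [b], a @ p) # w') c"
    using w'(1) tree_arc[of "a @ p" b] snoc.prems by (simp add: apath_Cons_iff)
  then show ?case using w'(2,3) by (intro exI[of _ "(a @ p @ [b], a @ p) # w'"]) fastforce
qed

text \<open>The path climbs from the left subtree to \<open>a\<close> and then descends on the
  right. Only some path through \<open>a\<close> has to be exhibited, as \<open>on_tree_path\<close>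
  is existential.\<close>

lemma on_tree_path_root:
  assumes "a @ False # p \<in> nodes T" "a @ True # q \<in> nodes T"
  shows "on_tree_path T (a @ False # p) (a @ True # q) a"
proof -
  have n: "a @ [False] \<in> nodes T" "a @ [True] \<in> nodes T"
    using nodes_prefix[of "a @ [False]" p T] nodes_prefix[of "a @ [True]" q T] assms by auto
  obtain w where w: "apath (a @ [True]) w (a @ True # q)" "\<forall>y\<in>set (pawalk_verts (a @ [True]) w). \<exists>s. y = (a @ [True]) @ s"
    using tree_path_down[of "a @ [True]" q] assms by auto
  have "a @ [False] \<notin> set (pawalk_verts (a @ [True]) w)" "a \<notin> set (pawalk_verts (a @ [True]) w)"
    using w(2) by fastforce+
  then have w2: "apath (a @ [False]) ((a @ [False], a) # (a, a @ [True]) # w) (a @ True # q)"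
    using w(1) tree_arc n by (simp add: apath_Cons_iff)
  obtain w' where w': "apath ((a @ [False]) @ p) w' (a @ True # q)"
    "set (pawalk_verts (a @ [False]) ((a @ [False], a) # (a, a @ [True]) # w)) \<subseteq> set (pawalk_verts ((a @ [False]) @ p) w')"
    using tree_path_climb[OF w2, of p] w(2) assms by fastforce
  then show ?thesis unfolding on_tree_path_def by (intro exI[of _ w']) auto
qed

lemma on_tree_path_child:
  assumes "a @ b # p \<in> nodes T"
  shows "on_tree_path T (a @ b # p) a (a @ [b])"
proof -
  have n: "a @ [b] \<in> nodes T" using nodes_prefix[of "a @ [b]" p T] assms by auto
  then have "a \<in> nodes T" using nodes_prefix by blast
  then have w2: "apath (a @ [b]) [(a @ [b], a)] a"
    using tree_arc n by (simp add: apath_Cons_iff apath_Nil_iff pverts_tree_graph)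
  obtain w' where w': "apath ((a @ [b]) @ p) w' a"
    "set (pawalk_verts (a @ [b]) [(a @ [b], a)]) \<subseteq> set (pawalk_verts ((a @ [b]) @ p) w')"
    using tree_path_climb[OF w2, of p] assms by fastforce
  then show ?thesis unfolding on_tree_path_def by (intro exI[of _ w']) auto
qed

end

text \<open>The connectivity condition speaks of paths in the whole of \<open>T\<close>, so the
  induction carries the address \<open>a\<close> of the subtree along and lifts its nodes to
  addresses in \<open>T\<close>.\<close>

lemma separated_subtree:
  assumes td: "tree_decomposition G T"
  shows "subtree_at T a = t \<Longrightarrow> separated t"
proof (induction t arbitrary: a)
  case (Node l S r)
  have sub: "subtree_at T (a @ [False]) = l" "subtree_at T (a @ [True]) = r"
    using subtree_at_snoc[OF Node.prems] by auto
  have S: "bag T a = S" "a \<in> nodes T"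
    using bag_subtree[of T a "[]"] nodes_subtree[of a "[]" T] Node.prems by auto
  have conn: "y \<in> bag T t3" if "on_tree_path T t1 t2 t3" "t1 \<in> nodes T" "t2 \<in> nodes T" "t3 \<in> nodes T"
    "y \<in> bag T t1" "y \<in> bag T t2" for t1 t2 t3 y
    using td that unfolding tree_decomposition_def by blast
  have node: "a @ b # p \<in> nodes T" "bag T (a @ b # p) = bag (if b then r else l) p"
    "a @ [b] \<in> nodes T" "bag T (a @ [b]) = root_bag (if b then r else l)"
    if "p \<in> nodes (if b then r else l)" for b p
  proof -
    have sb: "subtree_at T (a @ [b]) = (if b then r else l)" using sub by (cases b) auto
    show 1: "a @ b # p \<in> nodes T" using nodes_subtree[of "a @ [b]" p T] that sb by simp
    show "bag T (a @ b # p) = bag (if b then r else l) p" using bag_subtree[of T "a @ [b]" p] sb by simp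
    show "a @ [b] \<in> nodes T" using nodes_prefix[of "a @ [b]" p T] 1 by simp
    show "bag T (a @ [b]) = root_bag (if b then r else l)"
      using bag_subtree[of T "a @ [b]" "[]"] sb by (cases "if b then r else l") auto
  qed
  have "y \<in> S" if "y \<in> bag_verts l" "y \<in> bag_verts r" for y
  proof -
    obtain p q where p: "p \<in> nodes l" "y \<in> bag l p" and q: "q \<in> nodes r" "y \<in> bag r q"
      using \<open>y \<in> bag_verts l\<close> \<open>y \<in> bag_verts r\<close> by (meson bag_vertsE)
    show ?thesis
      using conn[OF on_tree_path_root[of a p T q]] node[of p False] node[of q True] p q S by auto
  qed
  moreover have "y \<in> root_bag (if b then r else l)" if yb: "y \<in> bag_verts (if b then r else l)" "y \<in> S" for y b
  proof -
    obtain p where p: "p \<in> nodes (if b then r else l)" "y \<in> bag (if b then r else l) p"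
      by (rule bag_vertsE[OF yb(1)])
    show ?thesis
      using conn[OF on_tree_path_child[of a b p T]] node[OF p(1)] p S yb(2) by auto
  qed
  from this[of _ False] this[of _ True] have "bag_verts l \<inter> S \<subseteq> root_bag l" "bag_verts r \<inter> S \<subseteq> root_bag r"
    by auto
  ultimately show ?case using Node.IH sub by auto
qed simp

section \<open>The main loop\<close>

text \<open>Rounds of the main loop allotted to a call: one for each of its eight stages, plus those
  of the calls that it makes. At \<open>k = 0\<close> the two calls with a halved bound
  disappear.\<close>

fun cost :: "'a tree \<Rightarrow> nat \<Rightarrow> nat" where
  "cost \<langle>\<rangle> k = 0"
| "cost \<langle>l, S, r\<rangle> 0 = 8 + cost l 0 + cost r 0"
| "cost \<langle>l, S, r\<rangle> (Suc k) = 8 + 2 * cost \<langle>l, S, r\<rangle> k + cost l (Suc k) + cost r (Suc k)"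

section \<open>Invariants of stack positions and the memory layout\<close>

locale ram_struct = ram_tree +
  assumes bags: "\<And>S. S \<in> set_tree T \<Longrightarrow> S \<subseteq> {..<n}" and sep: "separated T"
    and cov: "covers edge (enlarge {y. y < n \<and> (bit_at x (Suc (pu + y)) \<or> bit_at x (Suc (pv + y)))} T)"
begin

definition U :: "nat set" where
  "U = {y. y < n \<and> (bit_at x (Suc (pu + y)) \<or> bit_at x (Suc (pv + y)))}"

abbreviation ext :: "nat set tree \<Rightarrow> nat set tree" where
  "ext t \<equiv> enlarge U t"

lemma loc_struct: "loc ds t c b k \<Longrightarrow> set_tree t \<subseteq> set_tree T \<and> separated (ext t) \<and> covers edge (ext t) \<and> k \<le> k0"
proof (induction rule: loc.induct)
  case loc_root
  then show ?case using sep cov by (auto simp: separated_enlarge U_def[symmetric])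
next
  case (loc_left ds l S r c b k)
  then show ?case using covers_left[of edge "ext l" "S \<union> U" "ext r"] by (auto simp del: separated.simps) (auto)
next
  case (loc_right ds l S r c b k)
  then show ?case using covers_right[of edge "ext l" "S \<union> U" "ext r"] by (auto simp del: separated.simps) (auto)
qed auto

lemma mem_loc:
  assumes "loc ds t c b k" "y < n"
  shows "mem c y \<longleftrightarrow> y \<in> root_bag (ext t)"
proof -
  obtain l S r where t: "t = \<langle>l, S, r\<rangle>" using loc_inp[OF assms(1)] by (cases t) auto
  have "inp x (Suc c) (encode_set n S)" using loc_inp[OF assms(1)] inp_node(4)[of c l S r] t by simp
  from inp_encode_set[OF this assms(2)] show ?thesis
    using t assms(2) by (auto simp: mem_def U_def)
qed

lemma root_bag_loc:
  assumes "loc ds t c b k"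
  shows "root_bag (ext t) = {y. y < n \<and> mem c y}"
proof -
  obtain l S r where t: "t = \<langle>l, S, r\<rangle>" using loc_inp[OF assms(1)] by (cases t) auto
  then have "S \<subseteq> {..<n}" using loc_struct[OF assms(1)] bags by auto
  then show ?thesis using mem_loc[OF assms(1)] t by (auto simp: U_def)
qed

lemma loc_rank:
  assumes "loc ds t c b k" "\<And>S. S \<in> set_tree T \<Longrightarrow> card (S \<union> U) \<le> W"
  shows "rank c n \<le> W"
proof -
  obtain l S r where t: "t = \<langle>l, S, r\<rangle>" using loc_inp[OF assms(1)] by (cases t) auto
  then have "S \<in> set_tree T" using loc_struct[OF assms(1)] by auto
  moreover have "rank c n = card (S \<union> U)"
    using root_bag_loc[OF assms(1)] t by (simp add: rank_def)
  ultimately show ?thesis using assms(2) by simp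
qed

text \<open>Every stack symbol either descends one level or uses up one halving, so the sum of stack
  length, remaining height and remaining exponent never increases.\<close>

lemma loc_height: "loc ds t c b k \<Longrightarrow> length ds + height t + k \<le> height T + k0"
  by (induction rule: loc.induct) auto

text \<open>With \<open>W\<close> bounding the size of an enlarged bag, \<open>b\<close> plus
  \<open>W\<close> cells per level still below never exceeds \<open>W * height T\<close>: going down
  moves one bag from the reserve to the cells in use.\<close>

lemma loc_base:
  assumes W: "\<And>S. S \<in> set_tree T \<Longrightarrow> card (S \<union> U) \<le> W"
  shows "loc ds t c b k \<Longrightarrow> b + W * height t \<le> W * height T \<and> rank c n \<le> W"
proof (induction rule: loc.induct)
  case loc_root
  have "rank root n \<le> W" by (rule loc_rank[OF loc.loc_root W])
  then show ?case by simp
next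
  case (loc_left ds l S r c b k)
  have "rank (c + Suc (Suc n)) n \<le> W"
    by (rule loc_rank[OF loc.loc_left[OF loc_left(1,2)] W])
  moreover have "W * Suc (height l) \<le> W * height \<langle>l, S, r\<rangle>" by (intro mult_le_mono2) simp
  then have "W + W * height l \<le> W * height \<langle>l, S, r\<rangle>" by (simp only: mult_Suc_right)
  ultimately show ?case using loc_left.IH by (intro conjI) linarith+
next
  case (loc_right ds l S r c b k)
  have "rank (c + Suc (Suc n) + length (encode_tree n l)) n \<le> W"
    by (rule loc_rank[OF loc.loc_right[OF loc_right(1,2)] W])
  moreover have "W * Suc (height r) \<le> W * height \<langle>l, S, r\<rangle>" by (intro mult_le_mono2) simp
  then have "W + W * height r \<le> W * height \<langle>l, S, r\<rangle>" by (simp only: mult_Suc_right)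
  ultimately show ?case using loc_right.IH by (intro conjI) linarith+
next
  case (loc_half ds t c b k d)
  then show ?case by simp
qed

lemma loc_bounds':
  assumes "\<And>S. S \<in> set_tree T \<Longrightarrow> card (S \<union> U) \<le> W" "loc ds t c b k"
  shows "b + rank c n \<le> W * height T \<and> Suc (length ds) \<le> height T + k0"
proof -
  \<comment> \<open>The subtree of a call has at least one level, which leaves room for the marks of
    its own bag and for the stage symbol on top.\<close>
  have h: "0 < height t" using loc_inp[OF assms(2)] by (cases t) auto
  then have "W \<le> W * height t" by simp
  then show ?thesis using loc_base[OF assms] loc_height[OF assms(2)] h by linarith
qed

end

text \<open>\<open>R\<close> will be the set of vertices reachable from \<open>u\<close>. Soundness
  of all stages amounts to the marks staying inside an edge-closed set, so walks need not be built
  while the program runs.\<close>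

locale ram_run = ram_struct +
  fixes R :: "nat set"
  assumes loc_bounds: "loc ds t c b k \<Longrightarrow> b + rank c n \<le> A 1 \<and> Suc (length ds) \<le> A 0" and A1: "A 1 \<le> V"
    and R: "\<And>y z. y \<in> R \<Longrightarrow> y < n \<Longrightarrow> z < n \<Longrightarrow> edge y z \<Longrightarrow> z \<in> R"
begin

section \<open>The effect of single stages\<close>

lemma stage_HALVE: "a = 1 \<or> a = 7 \<Longrightarrow> stage a = HALVE (Suc a)"
  by (auto simp: stage_def numeral_2_eq_2)

lemma stage_POP: "stage 8 = Mv 0 MoveLeft"
  by (simp add: stage_def)

lemma stage_EDGES: "stage 2 = EDGES rC rB ;; Wr 0 3"
  by (simp add: stage_def)

lemma stage_DOWN: "a = (if d then 5 else 3) \<Longrightarrow> stage a = DOWN d (Suc a) (Suc (Suc a))"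
  by (auto simp: stage_def)

lemma stage_UP: "a = (if d then 6 else 4) \<Longrightarrow> stage a = UP d (Suc a)"
  by (auto simp: stage_def)

lemma frame_cong:
  "frame c b S f \<Longrightarrow> (\<And>y. y < n \<Longrightarrow> mem c y \<Longrightarrow> y \<in> S \<longleftrightarrow> y \<in> S') \<Longrightarrow> frame c b S' f"
  by (auto simp: frame_def)

lemma st_upd: "st (ds @ [a]) f i h m \<Longrightarrow> a' \<noteq> 9 \<Longrightarrow> st (ds @ [a']) f i h (m(0 := (m 0)(h 0 := a')))"
  using stack_upd[of ds a "m 0" "h 0" a'] by (simp add: st_def)

lemma wp_PUSH:
  assumes "st ds f i h m" "Suc (length ds) \<le> A 0" "\<And>i h m. st (ds @ [1]) f i h m \<Longrightarrow> Q \<rho> i h m"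
  shows "wp PUSH Q \<rho> i h m"
proof -
  have h: "h 0 = length ds" using assms(1) by (simp add: st_def stack_def)
  have "st (ds @ [1]) f i (h(0 := Suc (h 0))) (m(0 := (m 0)(Suc (h 0) := 1)))"
    using assms(1) stack_push[of ds "m 0" "h 0" 1] by (simp add: st_def)
  then show ?thesis unfolding PUSH_def using assms(2,3) h by simp
qed

lemma wp_RESTORE:
  assumes "\<rho> rC \<le> V" "\<rho> rB \<le> V" "\<rho> rC0 \<le> V" "\<rho> rB0 \<le> V"
    "Q (\<rho>(rC := \<rho> rC0, rB := \<rho> rB0, rC0 := 0, rB0 := 0)) i h m"
  shows "wp RESTORE Q \<rho> i h m"
  unfolding RESTORE_def wp.simps(7)
  by (intro wp_CLR wp_MOVE) (use assms in \<open>simp_all add: fun_upd_twist\<close>)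

lemma body_HALVE:
  assumes loc: "loc ds t c b k" and a: "a = 1 \<or> a = 7" and st: "st (ds @ [a]) f i h m" and rd: "ready \<rho>"
    and zero: "\<And>i h m. k = 0 \<Longrightarrow> st (ds @ [Suc a]) f i h m \<Longrightarrow> Q \<rho> i h m"
    and pos: "\<And>k' i h m. k = Suc k' \<Longrightarrow> st ((ds @ [Suc a]) @ [1]) f i h m \<Longrightarrow> Q \<rho> i h m"
  shows "wp BODY Q \<rho> i h m"
proof (rule wp_BODY[OF loc st _ rd])
  let ?\<rho> = "\<rho>(rC := c, rB := b, rKK := k)"
  let ?Q = "\<lambda>\<rho>' i' h' m'. \<rho>' = ?\<rho> \<and> Q \<rho> i' h' m'"
  fix i assume st: "st (ds @ [a]) f i h m"
  let ?m = "m(0 := (m 0)(h 0 := Suc a))"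
  have st': "st (ds @ [Suc a]) f i h ?m" using st_upd[OF st, of "Suc a"] a by auto
  have "wp (HALVE (Suc a)) ?Q ?\<rho> i h m"
  proof (cases k)
    case 0
    then show ?thesis unfolding HALVE_def using zero[OF 0 st'] by simp
  next
    case (Suc k')
    have "loc (ds @ [Suc a]) t c b k'" using loc_half[of ds t c b k' "Suc a"] loc Suc a by auto
    then have "wp PUSH ?Q ?\<rho> i h ?m"
      by (intro wp_PUSH[OF st']) (use loc_bounds pos[OF Suc] in blast)+
    then show ?thesis unfolding HALVE_def using Suc by simp
  qed
  then show "wp (stage a) ?Q ?\<rho> i h m" unfolding stage_HALVE[OF a] .
qed (use a loc_bounds[OF loc] A1 loc_struct[OF loc] k0 in auto)

lemma body_POP:
  assumes loc: "loc ds t c b k" and st: "st (ds @ [8]) f i h m" and rd: "ready \<rho>"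
    and Q: "\<And>i h m. st ds f i h m \<Longrightarrow> Q \<rho> i h m"
  shows "wp BODY Q \<rho> i h m"
proof (rule wp_BODY[OF loc st _ rd])
  let ?\<rho> = "\<rho>(rC := c, rB := b, rKK := k)"
  let ?Q = "\<lambda>\<rho>' i' h' m'. \<rho>' = ?\<rho> \<and> Q \<rho> i' h' m'"
  fix i assume st: "st (ds @ [8]) f i h m"
  have "st ds f i (h(0 := h 0 - 1)) m" using st stack_pop by (auto simp: st_def)
  moreover have "h 0 - 1 \<le> A 0" using st loc_bounds[OF loc] by (auto simp: st_def stack_def)
  ultimately show "wp (stage 8) ?Q ?\<rho> i h m" unfolding stage_POP using Q by simp
qed (use loc_bounds[OF loc] A1 loc_struct[OF loc] k0 in auto)

lemma body_EDGES:
  assumes loc: "loc ds t c b k" and st: "st (ds @ [2]) f i h m" and rd: "ready \<rho>"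
    and fr: "frame c b M f" and M: "M \<subseteq> R"
    and Q: "\<And>i h m f' M'. \<lbrakk>st (ds @ [3]) f' i h m; outside_eq c b f f'; frame c b M' f'; M \<subseteq> M'; M' \<subseteq> R;
      \<And>y z. \<lbrakk>y \<in> M; y < n; z < n; mem c y; mem c z; edge y z\<rbrakk> \<Longrightarrow> z \<in> M'\<rbrakk> \<Longrightarrow> Q \<rho> i h m"
  shows "wp BODY Q \<rho> i h m"
proof (rule wp_BODY[OF loc st _ rd])
  let ?\<rho> = "\<rho>(rC := c, rB := b, rKK := k)"
  let ?Q = "\<lambda>\<rho>' i' h' m'. \<rho>' = ?\<rho> \<and> Q \<rho> i' h' m'"
  fix i assume st: "st (ds @ [2]) f i h m"
  have "wp (EDGES rC rB) (wp (Wr 0 3) ?Q) ?\<rho> i h m"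
  proof (rule wp_EDGES[where S = M and R = R])
    fix i and h' :: "nat \<Rightarrow> nat" and m' :: "nat \<Rightarrow> nat \<Rightarrow> nat" and S'
    assume *: "i \<le> length x + 1" "h' 0 = h 0" "h' 1 \<le> A 1" "m' 0 = m 0" "marks_ok (m' 1)"
      "outside_eq (?\<rho> rC) (?\<rho> rB) (m 1) (m' 1)" "frame (?\<rho> rC) (?\<rho> rB) S' (m' 1)" "M \<subseteq> S'" "S' \<subseteq> R"
      "\<And>y z. \<lbrakk>y \<in> M; y < n; z < n; mem (?\<rho> rC) y; mem (?\<rho> rC) z; edge y z\<rbrakk> \<Longrightarrow> z \<in> S'"
    have "st (ds @ [2]) (m' 1) i h' m'" using st * by (simp add: st_def)
    from st_upd[OF this, of 3] have "st (ds @ [3]) (m' 1) i h' (m'(0 := (m' 0)(h' 0 := 3)))" by simp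
    moreover have "m 1 = f" using st by (simp add: st_def)
    ultimately show "wp (Wr 0 3) ?Q ?\<rho> i h' m'" using Q[of "m' 1" i h' _ S'] * by simp
  qed (use rd st fr M R loc_pos[OF loc] loc_bounds[OF loc] A1 in
      \<open>auto simp: ready_def clean_def clean1_def st_def\<close>)
  then show "wp (stage 2) ?Q ?\<rho> i h m" unfolding stage_EDGES by (rule wp_SeqI)
qed (use loc_bounds[OF loc] A1 loc_struct[OF loc] k0 in auto)

context
  fixes ds l S r c b k d t' c' b'
  assumes loc: "loc ds \<langle>l, S, r\<rangle> c b k"
    and t': "t' = (if d then r else l)"
    and c': "c' = c + Suc (Suc n) + (if d then length (encode_tree n l) else 0)"
    and b': "b' = b + rank c n"
begin

lemma loc_child: "t' \<noteq> Leaf \<Longrightarrow> loc (ds @ [if d then 6 else 4]) t' c' b' k"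
  using loc_left[OF loc] loc_right[OF loc] by (auto simp: t' c' b')

lemma inp_child: "inp x c' (encode_tree n t')" "c' \<le> length x"
  using inp_node[of c l S r] loc_inp[OF loc] by (auto simp: t' c')

lemma child_One: "input_cell x c' = Sym One \<longleftrightarrow> t' \<noteq> Leaf"
  using inp_child(1) by (cases t') (auto dest: inp_Cons)

lemma child_pos: "t' \<noteq> Leaf \<Longrightarrow> c' + n < length x"
  using loc_pos[OF loc_child] by simp

lemma wp_SAVE_CHILD:
  assumes rd: "ready \<rho>" and i: "i \<le> length x + 1"
    and Q: "\<And>i. i \<le> length x + 1 \<Longrightarrow> wp p Q (\<rho>(rC := c', rB := b', rKK := k, rC0 := c, rB0 := b)) i h m"
  shows "wp SAVE (wp (CHILD d) (wp p Q)) (\<rho>(rC := c, rB := b, rKK := k)) i h m"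
  unfolding SAVE_def wp.simps(7)
proof (intro wp_ADD, goal_cases)
  case 11
  note r = rd[unfolded ready_def clean_def clean1_def]
  let ?\<rho> = "\<rho>(rC := c, rB := b, rKK := k, rC0 := c, rB0 := b)"
  have "wp (CHILD d) (wp p Q) ?\<rho> i h m"
  proof (rule wp_CHILD[where l = l and S = S and r = r])
    fix i assume i: "i \<le> length x + 1"
    have eq: "?\<rho>(rC := ?\<rho> rC + Suc (Suc n) + (if d then length (encode_tree n l) else 0),
        rB := ?\<rho> rB + rank (?\<rho> rC) n) = \<rho>(rC := c', rB := b', rKK := k, rC0 := c, rB0 := b)"
      unfolding c' b' by (simp add: fun_eq_iff fun_upd_apply)
    show "wp p Q (?\<rho>(rC := ?\<rho> rC + Suc (Suc n) + (if d then length (encode_tree n l) else 0),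
        rB := ?\<rho> rB + rank (?\<rho> rC) n)) i h m"
      unfolding eq by (rule Q[OF i])
  qed (use r loc_inp[OF loc] loc_bounds[OF loc] A1 i in \<open>auto simp: clean1_def\<close>)
  then show ?case using r by simp
qed (use rd loc_pos[OF loc] LV loc_bounds[OF loc] A1 in \<open>auto simp: ready_def clean_def clean1_def\<close>)

lemma body_DOWN:
  assumes a: "a = (if d then 5 else 3)" and st: "st (ds @ [a]) f i h m" and rd: "ready \<rho>" and fr: "frame c b M f"
    and leaf: "\<And>i h m. t' = Leaf \<Longrightarrow> st (ds @ [Suc (Suc a)]) f i h m \<Longrightarrow> Q \<rho> i h m"
    and node: "\<And>i h m f'. t' \<noteq> Leaf \<Longrightarrow> st ((ds @ [Suc a]) @ [1]) f' i h m \<Longrightarrow> outside_eq c' b' f f' \<Longrightarrow>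
      frame c' b' {y. mem c y \<and> y \<in> M} f' \<Longrightarrow> Q \<rho> i h m"
  shows "wp BODY Q \<rho> i h m"
proof (rule wp_BODY[OF loc st _ rd])
  let ?\<rho> = "\<rho>(rC := c, rB := b, rKK := k)"
  let ?Q = "\<lambda>\<rho>' i' h' m'. \<rho>' = ?\<rho> \<and> Q \<rho> i' h' m'"
  fix i assume st: "st (ds @ [a]) f i h m"
  note r = rd[unfolded ready_def clean_def clean1_def]
  let ?\<rho>1 = "\<rho>(rC := c', rB := b', rKK := k, rC0 := c, rB0 := b)"
  have bV: "b' \<le> V" "b \<le> V" "c' \<le> V" "c \<le> V"
    using loc_bounds[OF loc] A1 inp_child(2) LV loc_pos[OF loc] by (auto simp: b')
  have rest: "wp RESTORE ?Q ?\<rho>1 i h m" if "Q \<rho> i h m" for i h m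
  proof (rule wp_RESTORE)
    have "?\<rho>1(rC := ?\<rho>1 rC0, rB := ?\<rho>1 rB0, rC0 := 0, rB0 := 0) = ?\<rho>"
      using r by (simp add: fun_eq_iff fun_upd_apply)
    then show "?\<rho>1(rC := ?\<rho>1 rC0, rB := ?\<rho>1 rB0, rC0 := 0, rB0 := 0) = ?\<rho> \<and> Q \<rho> i h m" using that by blast
  qed (use bV in auto)
  have main: "wp (IfC (In {Sym One}) (TRANSFER True rC0 rB0 rC rB ;; Wr 0 (Suc a) ;; PUSH) (Wr 0 (Suc (Suc a)))) (wp RESTORE ?Q) ?\<rho>1 c' h m"
  proof (cases "t' = Leaf")
    case True
    have st1: "st (ds @ [a]) f c' h m" using st inp_child(2) by (simp add: st_def)
    have "Q \<rho> c' h (m(0 := (m 0)(h 0 := Suc (Suc a))))"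
      by (rule leaf[OF True]) (use st_upd[OF st1, of "Suc (Suc a)"] a in auto)
    then show ?thesis using rest child_One True by simp
  next
    case False
    note lc = loc_child[OF False]
    have "wp (TRANSFER True rC0 rB0 rC rB) (wp (Wr 0 (Suc a)) (wp PUSH (wp RESTORE ?Q))) ?\<rho>1 c' h m"
    proof (rule wp_TRANSFER)
      \<comment> \<open>The cells of the child hold leftovers. Any set describing them will do,
        because \<open>TRANSFER True\<close> discards it.\<close>
      obtain S1 where "frame c' b' S1 f" using frame_exists[of f c' b'] st by (auto simp: st_def)
      then show "frame (?\<rho>1 rC) (?\<rho>1 rB) (SOME S1. frame c' b' S1 f) (m 1)"
        using st by (auto simp: st_def intro: someI)
      fix i2 and h2 :: "nat \<Rightarrow> nat" and m2 :: "nat \<Rightarrow> nat \<Rightarrow> nat"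
      assume *: "i2 \<le> length x + 1" "h2 0 = h 0" "h2 1 \<le> A 1" "m2 0 = m 0" "marks_ok (m2 1)"
        "outside_eq (?\<rho>1 rC) (?\<rho>1 rB) (m 1) (m2 1)"
        "frame (?\<rho>1 rC) (?\<rho>1 rB) {y. if mem (?\<rho>1 rC0) y then y \<in> M else \<not> True \<and> y \<in> (SOME S1. frame c' b' S1 f)} (m2 1)"
      have "st (ds @ [a]) (m2 1) i2 h2 m2" using st * by (simp add: st_def)
      from st_upd[OF this, of "Suc a"]
      have st2: "st (ds @ [Suc a]) (m2 1) i2 h2 (m2(0 := (m2 0)(h2 0 := Suc a)))" using a by auto
      have "frame c' b' {y. if mem c y then y \<in> M else \<not> True \<and> y \<in> (SOME S1. frame c' b' S1 f)} (m2 1)"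
        using *(7) by (simp split del: if_split)
      then have "frame c' b' {y. mem c y \<and> y \<in> M} (m2 1)" by (rule frame_cong) auto
      then have "Q \<rho> i3 h3 m3" if "st ((ds @ [Suc a]) @ [1]) (m2 1) i3 h3 m3" for i3 h3 m3
        using node[OF False that] * st by (simp add: st_def)
      moreover have "Suc a = (if d then 6 else 4)" using a by simp
      moreover have "Suc (length (ds @ [Suc a])) \<le> A 0" using loc_bounds[OF lc] by simp
      ultimately have "wp PUSH (wp RESTORE ?Q) ?\<rho>1 i2 h2 (m2(0 := (m2 0)(h2 0 := Suc a)))"
        by (intro wp_PUSH[OF st2]) (use rest in blast)+
      then show "wp (Wr 0 (Suc a)) (wp PUSH (wp RESTORE ?Q)) ?\<rho>1 i2 h2 m2" by simp
    qed (use r st fr bV child_pos[OF False] loc_pos[OF loc] loc_bounds[OF loc] loc_bounds[OF lc] A1 inp_child(2) in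
        \<open>auto simp: clean_def clean1_def st_def b'\<close>)
    then have "wp (TRANSFER True rC0 rB0 rC rB ;; Wr 0 (Suc a) ;; PUSH) (wp RESTORE ?Q) ?\<rho>1 c' h m"
      unfolding wp.simps(7) .
    then show ?thesis using child_One False by (simp del: wp.simps(7))
  qed
  have "wp (GOTO rC) (wp (IfC (In {Sym One}) (TRANSFER True rC0 rB0 rC rB ;; Wr 0 (Suc a) ;; PUSH) (Wr 0 (Suc (Suc a)))) (wp RESTORE ?Q)) ?\<rho>1 i h m"
    if "i \<le> length x + 1" for i
    by (rule wp_GOTO) (use r that bV inp_child(2) main in auto)
  then have "wp (DOWN d (Suc a) (Suc (Suc a))) ?Q ?\<rho> i h m"
    unfolding DOWN_def wp.simps(7)
    by (intro wp_SAVE_CHILD[OF rd]) (use st in \<open>auto simp: st_def\<close>)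
  then show "wp (stage a) ?Q ?\<rho> i h m" unfolding stage_DOWN[OF a] .
qed (use a loc_bounds[OF loc] A1 loc_struct[OF loc] k0 in auto)

lemma body_UP:
  assumes a: "a = (if d then 6 else 4)" and st: "st (ds @ [a]) f i h m" and rd: "ready \<rho>" and ne: "t' \<noteq> Leaf"
    and fr: "frame c b M f" "frame c' b' M1 f"
    and Q: "\<And>i h m f'. st (ds @ [Suc a]) f' i h m \<Longrightarrow> outside_eq c b f f' \<Longrightarrow>
      frame c b {y. if mem c' y then y \<in> M1 else y \<in> M} f' \<Longrightarrow> Q \<rho> i h m"
  shows "wp BODY Q \<rho> i h m"
proof (rule wp_BODY[OF loc st _ rd])
  let ?\<rho> = "\<rho>(rC := c, rB := b, rKK := k)"
  let ?Q = "\<lambda>\<rho>' i' h' m'. \<rho>' = ?\<rho> \<and> Q \<rho> i' h' m'"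
  fix i assume st: "st (ds @ [a]) f i h m"
  note r = rd[unfolded ready_def clean_def clean1_def]
  note lc = loc_child[OF ne]
  let ?\<rho>1 = "\<rho>(rC := c', rB := b', rKK := k, rC0 := c, rB0 := b)"
  have bV: "b' \<le> V" "b \<le> V" "c' \<le> V" "c \<le> V"
    using loc_bounds[OF loc] A1 inp_child(2) LV loc_pos[OF loc] by (auto simp: b')
  have rest: "wp RESTORE ?Q ?\<rho>1 i h m" if "Q \<rho> i h m" for i h m
  proof (rule wp_RESTORE)
    have "?\<rho>1(rC := ?\<rho>1 rC0, rB := ?\<rho>1 rB0, rC0 := 0, rB0 := 0) = ?\<rho>"
      using r by (simp add: fun_eq_iff fun_upd_apply)
    then show "?\<rho>1(rC := ?\<rho>1 rC0, rB := ?\<rho>1 rB0, rC0 := 0, rB0 := 0) = ?\<rho> \<and> Q \<rho> i h m" using that by blast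
  qed (use bV in auto)
  have "wp (TRANSFER False rC rB rC0 rB0) (wp (Wr 0 (Suc a)) (wp RESTORE ?Q)) ?\<rho>1 i h m"
    if "i \<le> length x + 1" for i
  proof (rule wp_TRANSFER)
    fix i2 and h2 :: "nat \<Rightarrow> nat" and m2 :: "nat \<Rightarrow> nat \<Rightarrow> nat"
    assume *: "i2 \<le> length x + 1" "h2 0 = h 0" "h2 1 \<le> A 1" "m2 0 = m 0" "marks_ok (m2 1)"
      "outside_eq (?\<rho>1 rC0) (?\<rho>1 rB0) (m 1) (m2 1)"
      "frame (?\<rho>1 rC0) (?\<rho>1 rB0) {y. if mem (?\<rho>1 rC) y then y \<in> M1 else \<not> False \<and> y \<in> M} (m2 1)"
    have "st (ds @ [a]) (m2 1) i2 h2 m2" using st * by (simp add: st_def)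
    from st_upd[OF this, of "Suc a"]
    have st2: "st (ds @ [Suc a]) (m2 1) i2 h2 (m2(0 := (m2 0)(h2 0 := Suc a)))" using a by auto
    have "Q \<rho> i2 h2 (m2(0 := (m2 0)(h2 0 := Suc a)))"
    proof (rule Q[OF st2])
      show "outside_eq c b f (m2 1)" using * st by (simp add: st_def)
      have "frame c b {y. if mem c' y then y \<in> M1 else \<not> False \<and> y \<in> M} (m2 1)"
        using *(7) by (simp split del: if_split)
      then show "frame c b {y. if mem c' y then y \<in> M1 else y \<in> M} (m2 1)"
        by (rule frame_cong) auto
    qed
    from rest[OF this] show "wp (Wr 0 (Suc a)) (wp RESTORE ?Q) ?\<rho>1 i2 h2 m2" by simp
  qed (use r st fr that bV child_pos[OF ne] loc_pos[OF loc] loc_bounds[OF loc] loc_bounds[OF lc] A1 inp_child(2) in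
      \<open>auto simp: clean_def clean1_def st_def b'\<close>)
  then have "wp (UP d (Suc a)) ?Q ?\<rho> i h m"
    unfolding UP_def wp.simps(7)
    by (intro wp_SAVE_CHILD[OF rd, where p = "TRANSFER False rC rB rC0 rB0"]) (use st in \<open>auto simp: st_def\<close>)
  then show "wp (stage a) ?Q ?\<rho> i h m" unfolding stage_UP[OF a] .
qed (use a loc_bounds[OF loc] A1 loc_struct[OF loc] k0 in auto)

end

section \<open>Whole calls and the number of their rounds\<close>

abbreviation loop :: "pred \<Rightarrow> nat \<Rightarrow> pred" where
  "loop Q j \<equiv> while1 (wp BODY) (test x (Tp 0 (- {9}))) Q j"

lemma loop_step:
  assumes st: "st (ds @ [a]) f i h m" and body: "wp BODY (loop Q j) \<rho> i h m"
  shows "loop Q (Suc j) \<rho> i h m"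
proof -
  have "m 0 (h 0) = a" "a \<noteq> 9" using st stack_top[of ds a "m 0" "h 0"] by (auto simp: st_def stack_def)
  then show ?thesis using body by simp
qed

text \<open>A missing child takes fewer rounds than were allotted to it; the surplus is
  harmless.\<close>

lemma loop_le: "loop Q j \<rho> i h m \<Longrightarrow> j \<le> j' \<Longrightarrow> loop Q j' \<rho> i h m"
proof (induction j arbitrary: j' \<rho> i h m)
  case 0
  then show ?case by (cases j') auto
next
  case (Suc j)
  then obtain j'' where "j' = Suc j''" "j \<le> j''" by (cases j') auto
  then show ?case using Suc by (auto split: if_splits elim!: wp_mono)
qed

declare while1.simps [simp del]

text \<open>The specification is in continuation style: if the loop ends within \<open>j\<close>
  rounds from every state in which the call may return, it ends within \<open>N + j\<close> rounds
  from its start, so the rounds of successive calls add up. Only cells up to \<open>b\<close> are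
  preserved; those behind the frame of the call are scratch space.\<close>

definition call_ok :: "nat set tree \<Rightarrow> nat \<Rightarrow> nat \<Rightarrow> bool" where
  "call_ok t k N \<longleftrightarrow> (\<forall>ds c b f i h m M \<rho> Q j. loc ds t c b k \<longrightarrow> st (ds @ [1]) f i h m \<longrightarrow> frame c b M f \<longrightarrow>
     M \<subseteq> root_bag (ext t) \<longrightarrow> M \<subseteq> R \<longrightarrow> ready \<rho> \<longrightarrow>
     (\<forall>i h m f' M'. st ds f' i h m \<longrightarrow> (\<forall>p\<le>b. f' p = f p) \<longrightarrow> frame c b M' f' \<longrightarrow> M \<subseteq> M' \<longrightarrow>
        M' \<subseteq> root_bag (ext t) \<longrightarrow> M' \<subseteq> R \<longrightarrow> complete_marks edge (ext t) k M M' \<longrightarrow> loop Q j \<rho> i h m) \<longrightarrow>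
     loop Q (N + j) \<rho> i h m)"

lemma call_okD:
  assumes "call_ok t k N" "loc ds t c b k" "st (ds @ [1]) f i h m" "frame c b M f"
    "M \<subseteq> root_bag (ext t)" "M \<subseteq> R" "ready \<rho>"
    "\<And>i h m f' M'. \<lbrakk>st ds f' i h m; \<forall>p\<le>b. f' p = f p; frame c b M' f'; M \<subseteq> M';
        M' \<subseteq> root_bag (ext t); M' \<subseteq> R; complete_marks edge (ext t) k M M'\<rbrakk> \<Longrightarrow> loop Q j \<rho> i h m"
  shows "loop Q (N + j) \<rho> i h m"
  by (rule assms(1)[unfolded call_ok_def, rule_format, OF assms(2-7)]) (rule assms(8), auto)

lemma frame_below: "frame c b S f \<Longrightarrow> (\<And>p. p \<le> b + rank c n \<Longrightarrow> f' p = f p) \<Longrightarrow> frame c b S f'"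
  unfolding frame_def using rank_less by (metis Suc_leI add_Suc_right nat_add_left_cancel_le)

lemma run_child:
  assumes loc: "loc ds \<langle>l, S, r\<rangle> c b k" and t': "t' = (if d then r else l)"
    and call: "t' \<noteq> Leaf \<Longrightarrow> call_ok t' k N" and a: "a = (if d then 5 else 3)"
    and st: "st (ds @ [a]) f i h m" and fr: "frame c b M f" and M: "M \<subseteq> root_bag (ext \<langle>l, S, r\<rangle>)" "M \<subseteq> R"
    and rd: "ready \<rho>"
    and Q: "\<And>i h m f' M' NL. \<lbrakk>st (ds @ [Suc (Suc a)]) f' i h m; \<forall>p\<le>b. f' p = f p; frame c b M' f'; M \<subseteq> M';
      M' \<subseteq> root_bag (ext \<langle>l, S, r\<rangle>); M' \<subseteq> R; complete_marks edge (ext t') k (M \<inter> root_bag (ext t')) NL;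
      NL \<inter> root_bag (ext \<langle>l, S, r\<rangle>) \<subseteq> M'\<rbrakk> \<Longrightarrow> loop Q j \<rho> i h m"
  shows "loop Q (2 + N + j) \<rho> i h m"
proof -
  let ?c' = "c + Suc (Suc n) + (if d then length (encode_tree n l) else 0)"
  let ?b' = "b + rank c n"
  have "wp BODY (loop Q (Suc (N + j))) \<rho> i h m"
  proof (rule body_DOWN[OF loc t' refl refl a st rd fr])
    fix i h m assume leaf: "t' = Leaf" and st: "st (ds @ [Suc (Suc a)]) f i h m"
    \<comment> \<open>No walk fits into an empty subtree, so the empty set of marks is a complete
      answer.\<close>
    have "complete_marks edge (ext t') k (M \<inter> root_bag (ext t')) {}"
      using leaf by (simp add: complete_marks_def)
    then have "loop Q j \<rho> i h m" using Q[OF st _ fr] M by simp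
    then show "loop Q (Suc (N + j)) \<rho> i h m" by (rule loop_le) simp
  next
    fix i h m f1
    assume ne: "t' \<noteq> Leaf" and st1: "st ((ds @ [Suc a]) @ [1]) f1 i h m" and out1: "outside_eq ?c' ?b' f f1"
      and fr1: "frame ?c' ?b' {y. mem c y \<and> y \<in> M} f1"
    have lc: "loc (ds @ [Suc a]) t' ?c' ?b' k" using loc_child[OF loc t' refl refl ne] a by (cases d) auto
    let ?M1 = "M \<inter> root_bag (ext t')"
    have fr1': "frame ?c' ?b' ?M1 f1"
      by (rule frame_cong[OF fr1]) (use mem_loc[OF loc] mem_loc[OF lc] M in auto)
    have c2: "loop Q (1 + j) \<rho> i h m"
      if st2: "st (ds @ [Suc a]) f2 i h m" and out2: "\<forall>p\<le>?b'. f2 p = f1 p" and fr2: "frame ?c' ?b' NL f2"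
        and NL: "?M1 \<subseteq> NL" "NL \<subseteq> root_bag (ext t')" "NL \<subseteq> R" and comp: "complete_marks edge (ext t') k ?M1 NL"
      for i h m f2 NL
    proof -
      \<comment> \<open>The marks of the parent lie in cells up to the base of the child, which
        neither the transfer nor the call touches.\<close>
      have below: "f2 p = f p" if "p \<le> ?b'" for p
        using that out1 out2 by (auto simp: outside_eq_def)
      have fr3: "frame c b M f2" by (rule frame_below[OF fr]) (use below in auto)
      have a': "Suc a = (if d then 6 else 4)" using a by simp
      have "wp BODY (loop Q j) \<rho> i h m"
      proof (rule body_UP[OF loc t' refl refl a' st2 rd ne fr3 fr2])
        fix i h m f4
        assume st4: "st (ds @ [Suc (Suc a)]) f4 i h m" and out4: "outside_eq c b f2 f4"
          and fr4: "frame c b {y. if mem ?c' y then y \<in> NL else y \<in> M} f4"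
        let ?M' = "{y \<in> root_bag (ext \<langle>l, S, r\<rangle>). if mem ?c' y then y \<in> NL else y \<in> M}"
        have rb: "root_bag (ext \<langle>l, S, r\<rangle>) = {y. y < n \<and> mem c y}" "root_bag (ext t') = {y. y < n \<and> mem ?c' y}"
          by (rule root_bag_loc[OF loc], rule root_bag_loc[OF lc])
        show "loop Q j \<rho> i h m"
        proof (rule Q[OF st4 _ _ _ _ _ comp])
          show "\<forall>p\<le>b. f4 p = f p" using out4 below by (auto simp: outside_eq_def)
          show "frame c b ?M' f4" by (rule frame_cong[OF fr4]) (use rb in auto)
          show "M \<subseteq> ?M'" using M NL(1) unfolding rb by auto
          show "?M' \<subseteq> R" using M(2) NL(3) by auto
          show "NL \<inter> root_bag (ext \<langle>l, S, r\<rangle>) \<subseteq> ?M'" using NL(2) unfolding rb by auto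
        qed auto
      qed
      then show ?thesis using loop_step[OF st2] by simp
    qed
    have "loop Q (N + (1 + j)) \<rho> i h m"
    proof (rule call_okD[OF call[OF ne] lc st1 fr1' _ _ rd])
      show "?M1 \<subseteq> R" "?M1 \<subseteq> root_bag (ext t')" using M by auto
    qed (rule c2)
    then show "loop Q (Suc (N + j)) \<rho> i h m" by simp
  qed
  then show ?thesis using loop_step[OF st] by simp
qed

text \<open>What stages 2 to 6 contribute to \<open>complete_marks_combine\<close>: the edges of the
  bag and the two child calls, with the intermediate sets of marks hidden.\<close>

definition mid_ok :: "nat set tree \<Rightarrow> nat set \<Rightarrow> nat set tree \<Rightarrow> nat \<Rightarrow> nat set \<Rightarrow> nat set \<Rightarrow> bool" where
  "mid_ok l S r k M1 M4 \<longleftrightarrow> (\<exists>M2 M3 NL NR. M1 \<subseteq> M2 \<and> (\<forall>y z. y \<in> M1 \<longrightarrow> y \<in> S \<longrightarrow> z \<in> S \<longrightarrow> edge y z \<longrightarrow> z \<in> M2) \<and>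
     M2 \<subseteq> M3 \<and> complete_marks edge l k (M2 \<inter> root_bag l) NL \<and> NL \<inter> S \<subseteq> M3 \<and>
     M3 \<subseteq> M4 \<and> complete_marks edge r k (M3 \<inter> root_bag r) NR \<and> NR \<inter> S \<subseteq> M4)"

lemma run_mid:
  assumes loc: "loc ds \<langle>l, S, r\<rangle> c b k"
    and call: "l \<noteq> Leaf \<Longrightarrow> call_ok l k Nl" "r \<noteq> Leaf \<Longrightarrow> call_ok r k Nr"
    and st: "st (ds @ [2]) f i h m" and fr: "frame c b M f" and M: "M \<subseteq> S \<union> U" "M \<subseteq> R"
    and rd: "ready \<rho>"
    and Q: "\<And>i h m f' M'. \<lbrakk>st (ds @ [7]) f' i h m; \<forall>p\<le>b. f' p = f p; frame c b M' f'; M \<subseteq> M';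
      M' \<subseteq> S \<union> U; M' \<subseteq> R; mid_ok (ext l) (S \<union> U) (ext r) k M M'\<rbrakk> \<Longrightarrow> loop Q j \<rho> i h m"
  shows "loop Q (5 + Nl + Nr + j) \<rho> i h m"
proof -
  have rb: "S \<union> U = {y. y < n \<and> mem c y}" using root_bag_loc[OF loc] by simp
  have "wp BODY (loop Q (2 + Nl + (2 + Nr + j))) \<rho> i h m"
  proof (rule body_EDGES[OF loc st rd fr M(2)])
    fix i h m f1 M2'
    assume st1: "st (ds @ [3]) f1 i h m" and out1: "outside_eq c b f f1" and fr1': "frame c b M2' f1"
      and M2': "M \<subseteq> M2'" "M2' \<subseteq> R"
      and E: "\<And>y z. \<lbrakk>y \<in> M; y < n; z < n; mem c y; mem c z; edge y z\<rbrakk> \<Longrightarrow> z \<in> M2'"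
    \<comment> \<open>A frame says nothing about vertices outside the bag, so the result of the edge
      scan may be cut down to the bag.\<close>
    define M2 where "M2 = M2' \<inter> (S \<union> U)"
    have fr1: "frame c b M2 f1" by (rule frame_cong[OF fr1']) (use rb in \<open>auto simp: M2_def\<close>)
    have M2: "M \<subseteq> M2" "M2 \<subseteq> root_bag (ext \<langle>l, S, r\<rangle>)" "M2 \<subseteq> R" using M2' M by (auto simp: M2_def)
    have E2: "\<forall>y z. y \<in> M \<longrightarrow> y \<in> S \<union> U \<longrightarrow> z \<in> S \<union> U \<longrightarrow> edge y z \<longrightarrow> z \<in> M2"
      using E unfolding M2_def rb by auto
    show "loop Q (2 + Nl + (2 + Nr + j)) \<rho> i h m"
    proof (rule run_child[where d = False, OF loc refl _ refl _ fr1 M2(2,3) rd])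
      show "call_ok (if False then r else l) k Nl" if "(if False then r else l) \<noteq> Leaf" using call(1) that by simp
      show "st (ds @ [if False then 5 else 3]) f1 i h m" using st1 by simp
      fix i h m f3 M3 NL
      assume st3: "st (ds @ [Suc (Suc (if False then 5 else 3))]) f3 i h m" and out3: "\<forall>p\<le>b. f3 p = f1 p"
        and fr3: "frame c b M3 f3" and M3: "M2 \<subseteq> M3" "M3 \<subseteq> root_bag (ext \<langle>l, S, r\<rangle>)" "M3 \<subseteq> R"
        and L: "complete_marks edge (ext (if False then r else l)) k (M2 \<inter> root_bag (ext (if False then r else l))) NL"
        "NL \<inter> root_bag (ext \<langle>l, S, r\<rangle>) \<subseteq> M3"
      show "loop Q (2 + Nr + j) \<rho> i h m"
      proof (rule run_child[where d = True, OF loc refl _ refl _ fr3 M3(2,3) rd])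
        show "call_ok (if True then r else l) k Nr" if "(if True then r else l) \<noteq> Leaf" using call(2) that by simp
        show "st (ds @ [if True then 5 else 3]) f3 i h m" using st3 by (simp add: numeral_eq_Suc)
        fix i h m f4 M4 NR
        assume st4: "st (ds @ [Suc (Suc (if True then 5 else 3))]) f4 i h m" and out4: "\<forall>p\<le>b. f4 p = f3 p"
          and fr4: "frame c b M4 f4" and M4: "M3 \<subseteq> M4" "M4 \<subseteq> root_bag (ext \<langle>l, S, r\<rangle>)" "M4 \<subseteq> R"
          and Rr: "complete_marks edge (ext (if True then r else l)) k (M3 \<inter> root_bag (ext (if True then r else l))) NR"
          "NR \<inter> root_bag (ext \<langle>l, S, r\<rangle>) \<subseteq> M4"
        show "loop Q j \<rho> i h m"
        proof (rule Q[OF _ _ fr4])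
          show "st (ds @ [7]) f4 i h m" using st4 by (simp add: numeral_eq_Suc)
          show "\<forall>p\<le>b. f4 p = f p" using out1 out3 out4 by (auto simp: outside_eq_def)
          show "mid_ok (ext l) (S \<union> U) (ext r) k M M4"
            unfolding mid_ok_def using M2 E2 M3 L M4 Rr by (intro exI[of _ M2] exI[of _ M3] exI[of _ NL] exI[of _ NR]) simp
        qed (use M2 M3 M4 in auto)
      qed
    qed
  qed
  \<comment> \<open>One round for the edges, and for each child two rounds around its call.\<close>
  moreover have "5 + Nl + Nr + j = Suc (2 + Nl + (2 + Nr + j))" by simp
  ultimately show ?thesis using loop_step[OF st] by (simp only:)
qed

lemma complete_marks_mid:
  assumes loc: "loc ds \<langle>l, S, r\<rangle> c b k" and M: "M \<subseteq> S \<union> U"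
    and 1: "M \<subseteq> M1" "\<And>k'. k = Suc k' \<Longrightarrow> complete_marks edge (ext \<langle>l, S, r\<rangle>) k' M M1"
    and mid: "mid_ok (ext l) (S \<union> U) (ext r) k M1 M4"
    and 5: "M4 \<subseteq> M5" "\<And>k'. k = Suc k' \<Longrightarrow> complete_marks edge (ext \<langle>l, S, r\<rangle>) k' M4 M5"
  shows "complete_marks edge (ext \<langle>l, S, r\<rangle>) k M M5"
proof -
  obtain M2 M3 NL NR where *: "M1 \<subseteq> M2" "\<forall>y z. y \<in> M1 \<longrightarrow> y \<in> S \<union> U \<longrightarrow> z \<in> S \<union> U \<longrightarrow> edge y z \<longrightarrow> z \<in> M2"
     "M2 \<subseteq> M3" "complete_marks edge (ext l) k (M2 \<inter> root_bag (ext l)) NL" "NL \<inter> (S \<union> U) \<subseteq> M3"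
     "M3 \<subseteq> M4" "complete_marks edge (ext r) k (M3 \<inter> root_bag (ext r)) NR" "NR \<inter> (S \<union> U) \<subseteq> M4"
    using mid unfolding mid_ok_def by blast
  have st: "covers edge \<langle>ext l, S \<union> U, ext r\<rangle>" "separated \<langle>ext l, S \<union> U, ext r\<rangle>"
    using loc_struct[OF loc] by (auto simp del: separated.simps)
  have "complete_marks edge \<langle>ext l, S \<union> U, ext r\<rangle> k M M5"
  proof (rule complete_marks_combine[OF st M 1(1) _ *(1) _ *(3,4,5,6,7,8) 5(1)])
    show "z \<in> M2" if "y \<in> M1" "y \<in> S \<union> U" "z \<in> S \<union> U" "edge y z" for y z
      using *(2) that by blast
  qed (use 1 5 in simp_all)
  then show ?thesis by simp
qed

lemma run_node_0:
  assumes "l \<noteq> Leaf \<Longrightarrow> call_ok l 0 Nl" "r \<noteq> Leaf \<Longrightarrow> call_ok r 0 Nr"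
  shows "call_ok \<langle>l, S, r\<rangle> 0 (8 + Nl + Nr)"
  unfolding call_ok_def
proof (intro allI impI)
  fix ds c b f i h m M \<rho> Q j
  assume loc: "loc ds \<langle>l, S, r\<rangle> c b 0" and st: "st (ds @ [1]) f i h m" and fr: "frame c b M f"
    and M: "M \<subseteq> root_bag (ext \<langle>l, S, r\<rangle>)" "M \<subseteq> R" and rd: "ready \<rho>"
    and Q: "\<forall>i h m f' M'. st ds f' i h m \<longrightarrow> (\<forall>p\<le>b. f' p = f p) \<longrightarrow> frame c b M' f' \<longrightarrow> M \<subseteq> M' \<longrightarrow>
        M' \<subseteq> root_bag (ext \<langle>l, S, r\<rangle>) \<longrightarrow> M' \<subseteq> R \<longrightarrow> complete_marks edge (ext \<langle>l, S, r\<rangle>) 0 M M' \<longrightarrow> loop Q j \<rho> i h m"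
  have "wp BODY (loop Q (5 + Nl + Nr + (2 + j))) \<rho> i h m"
  proof (rule body_HALVE[OF loc _ st rd])
    fix i h m assume "st (ds @ [Suc 1]) f i h m"
    then have st2: "st (ds @ [2]) f i h m" by (simp add: numeral_2_eq_2)
    show "loop Q (5 + Nl + Nr + (2 + j)) \<rho> i h m"
    proof (rule run_mid[OF loc assms st2 fr _ M(2) rd])
      fix i h m f4 M4
      assume st4: "st (ds @ [7]) f4 i h m" and out: "\<forall>p\<le>b. f4 p = f p" and fr4: "frame c b M4 f4" and M4: "M \<subseteq> M4"
       "M4 \<subseteq> S \<union> U" "M4 \<subseteq> R" "mid_ok (ext l) (S \<union> U) (ext r) 0 M M4"
      have fin: "loop Q j \<rho> i h m" if "st ds f4 i h m" for i h m
        using Q that out fr4 M4 complete_marks_mid[OF loc _ subset_refl _ M4(4) subset_refl] M by auto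
      have "wp BODY (loop Q (Suc j)) \<rho> i h m"
      proof (rule body_HALVE[OF loc _ st4 rd])
        fix i h m assume "st (ds @ [Suc 7]) f4 i h m"
        then have st8: "st (ds @ [8]) f4 i h m" by simp
        show "loop Q (Suc j) \<rho> i h m"
          by (rule loop_step[OF st8], rule body_POP[OF loc st8 rd], rule fin)
      qed auto
      from loop_step[OF st4 this] show "loop Q (2 + j) \<rho> i h m" by simp
    qed (use M in auto)
  qed auto
  moreover have "8 + Nl + Nr + j = Suc (5 + Nl + Nr + (2 + j))" by simp
  ultimately show "loop Q (8 + Nl + Nr + j) \<rho> i h m" using loop_step[OF st] by (simp only:)
qed

lemma run_node_Suc:
  assumes "call_ok \<langle>l, S, r\<rangle> k N" "l \<noteq> Leaf \<Longrightarrow> call_ok l (Suc k) Nl" "r \<noteq> Leaf \<Longrightarrow> call_ok r (Suc k) Nr"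
  shows "call_ok \<langle>l, S, r\<rangle> (Suc k) (8 + 2 * N + Nl + Nr)"
  unfolding call_ok_def
proof (intro allI impI)
  fix ds c b f i h m M \<rho> Q j
  assume loc: "loc ds \<langle>l, S, r\<rangle> c b (Suc k)" and st: "st (ds @ [1]) f i h m" and fr: "frame c b M f"
    and M: "M \<subseteq> root_bag (ext \<langle>l, S, r\<rangle>)" "M \<subseteq> R" and rd: "ready \<rho>"
    and Q: "\<forall>i h m f' M'. st ds f' i h m \<longrightarrow> (\<forall>p\<le>b. f' p = f p) \<longrightarrow> frame c b M' f' \<longrightarrow> M \<subseteq> M' \<longrightarrow>
        M' \<subseteq> root_bag (ext \<langle>l, S, r\<rangle>) \<longrightarrow> M' \<subseteq> R \<longrightarrow> complete_marks edge (ext \<langle>l, S, r\<rangle>) (Suc k) M M' \<longrightarrow> loop Q j \<rho> i h m"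
  have "wp BODY (loop Q (N + (5 + Nl + Nr + (1 + (N + (1 + j)))))) \<rho> i h m"
  proof (rule body_HALVE[OF loc _ st rd])
    fix k' i h m assume "st ((ds @ [Suc 1]) @ [1]) f i h m"
    then have st1: "st ((ds @ [2]) @ [1]) f i h m" by (simp add: numeral_2_eq_2)
    have loc2: "loc (ds @ [2]) \<langle>l, S, r\<rangle> c b k" using loc_half[OF loc] by simp
    show "loop Q (N + (5 + Nl + Nr + (1 + (N + (1 + j))))) \<rho> i h m"
    proof (rule call_okD[OF assms(1) loc2 st1 fr M rd])
      fix i h m f1 M1
      assume st2: "st (ds @ [2]) f1 i h m" and out1: "\<forall>p\<le>b. f1 p = f p" and fr1: "frame c b M1 f1" and M1: "M \<subseteq> M1"
        "M1 \<subseteq> root_bag (ext \<langle>l, S, r\<rangle>)" "M1 \<subseteq> R" "complete_marks edge (ext \<langle>l, S, r\<rangle>) k M M1"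
      show "loop Q (5 + Nl + Nr + (1 + (N + (1 + j)))) \<rho> i h m"
      proof (rule run_mid[OF loc assms(2,3) st2 fr1 _ M1(3) rd])
        fix i h m f4 M4
        assume st4: "st (ds @ [7]) f4 i h m" and out4: "\<forall>p\<le>b. f4 p = f1 p" and fr4: "frame c b M4 f4" and M4: "M1 \<subseteq> M4"
          "M4 \<subseteq> S \<union> U" "M4 \<subseteq> R" "mid_ok (ext l) (S \<union> U) (ext r) (Suc k) M1 M4"
        have "wp BODY (loop Q (N + (1 + j))) \<rho> i h m"
        proof (rule body_HALVE[OF loc _ st4 rd])
          fix k' i h m assume "st ((ds @ [Suc 7]) @ [1]) f4 i h m"
          then have st7: "st ((ds @ [8]) @ [1]) f4 i h m" by simp
          have loc8: "loc (ds @ [8]) \<langle>l, S, r\<rangle> c b k" using loc_half[OF loc] by simp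
          show "loop Q (N + (1 + j)) \<rho> i h m"
          proof (rule call_okD[OF assms(1) loc8 st7 fr4 _ M4(3) rd])
            fix i h m f5 M5
            assume st8: "st (ds @ [8]) f5 i h m" and out5: "\<forall>p\<le>b. f5 p = f4 p" and fr5: "frame c b M5 f5" and M5: "M4 \<subseteq> M5"
              "M5 \<subseteq> root_bag (ext \<langle>l, S, r\<rangle>)" "M5 \<subseteq> R" "complete_marks edge (ext \<langle>l, S, r\<rangle>) k M4 M5"
            have comp: "complete_marks edge (ext \<langle>l, S, r\<rangle>) (Suc k) M M5"
              by (rule complete_marks_mid[OF loc _ M1(1) _ M4(4) M5(1)]) (use M M1(4) M5(4) in simp_all)
            have "loop Q j \<rho> i h m" if "st ds f5 i h m" for i h m
              using Q that out1 out4 out5 fr5 comp M1(1) M4(1) M5 by auto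
            then have "wp BODY (loop Q j) \<rho> i h m" by (rule body_POP[OF loc st8 rd])
            from loop_step[OF st8 this] show "loop Q (1 + j) \<rho> i h m" by simp
          qed (use M4 in auto)
        qed auto
        from loop_step[OF st4 this] show "loop Q (1 + (N + (1 + j))) \<rho> i h m" by simp
      qed (use M1 in auto)
    qed
  qed auto
  moreover have "8 + 2 * N + Nl + Nr + j = Suc (N + (5 + Nl + Nr + (1 + (N + (1 + j)))))" by simp
  ultimately show "loop Q (8 + 2 * N + Nl + Nr + j) \<rho> i h m" using loop_step[OF st] by (simp only:)
qed

text \<open>Every recursive call keeps the node and lowers \<open>k\<close>, or keeps
  \<open>k\<close> and moves to a child; the recursion of \<open>cost\<close> follows the same order
  and supplies the induction.\<close>

lemma call_ok_cost: "t \<noteq> Leaf \<Longrightarrow> call_ok t k (cost t k)"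
  by (induction t k rule: cost.induct) (simp_all add: run_node_0 run_node_Suc)

end

section \<open>The complete program\<close>

text \<open>The number of vertices is nowhere written on the input; it is the length of the first
  adjacency row.\<close>

definition COUNT :: com where
  "COUNT = InM MoveRight ;; WhileC (In (- {Sym Sep})) (InM MoveRight ;; Inc rN)"

definition CHECK :: com where
  "CHECK = IfC (In {Sym One}) (IfC (NZ rF) Skip (Inc rF)) Skip ;; InM MoveRight"

text \<open>Only entries off the diagonal are inspected. The head sweeps over the matrix without
  storing its position, so all registers stay at most \<open>n\<close>.\<close>

definition LOOPFREE :: com where
  "LOOPFREE = REW ;; InM MoveRight ;; FOR rX rN rCX (ADD rX rZ ;; WhileC (NZ rZ) (Dec rZ ;; CHECK) ;;
     InM MoveRight ;; WhileC (In (- {Sym Sep})) CHECK ;; InM MoveRight)"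

text \<open>The distance from the last separator back to the bit of \<open>v\<close> is
  \<open>n - v\<close>. Going left by the same amount from the separator before the vector of
  \<open>v\<close> leads to bit \<open>v\<close> in the vector of \<open>u\<close>. Only this one
  distance is stored.\<close>

definition EQUAL :: com where
  "EQUAL = WhileC (In (- {RightEnd})) (InM MoveRight) ;; InM MoveLeft ;;
     WhileC (In (- {Sym One})) (InM MoveLeft ;; Inc rZ) ;; WhileC (In (- {Sym Sep})) (InM MoveLeft) ;;
     WhileC (NZ rZ) (Dec rZ ;; InM MoveLeft) ;; IfC (In {Sym One}) (Wr 0 1) Skip"

definition LOG :: com where
  "LOG = ADD rN rW ;; WhileC (NZ rW)
     (WhileC (NZ rW) (Dec rW ;; IfC (NZ rW) (Dec rW ;; Inc rD) Skip) ;; MOVE rD rW ;; Inc rK0)"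

text \<open>The vector of \<open>v\<close> starts \<open>n + 1\<close> cells after that of
  \<open>u\<close>, while \<open>rPU\<close> and \<open>rPV\<close> are to point one cell before the
  vectors. Adding \<open>n\<close> to the start of the first vector thus gives \<open>rPV\<close>,
  and \<open>rPU\<close> is decremented last.\<close>

definition SETUP :: com where
  "SETUP = ADD rN rW ;; WhileC (NZ rW) (Dec rW ;; (ADD rN rRoot ;; Inc rRoot)) ;; Inc rRoot ;;
     ADD rRoot rPU ;; SKIP rPU ;; ADD rPU rPV ;; ADD rN rPV ;; Dec rPU"

definition MARK :: com where
  "MARK = ADD rRoot rC ;; FOR rX rN rCX (PEEK rPU rX ;; IfC (In {Sym One}) (SET rC rB rX 1) Skip) ;; CLR rC"

text \<open>The stack is empty again and its head is on cell 0, so the marker there is overwritten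
  by the answer that the compiled machine inspects.\<close>

definition FINAL :: com where
  "FINAL = Wr 0 0 ;; ADD rRoot rC ;; FOR rX rN rCX (PEEK rPV rX ;; IfC (In {Sym One})
     (IFSET rC rB rX (Wr 0 1) Skip) Skip)"

definition MAIN :: com where
  "MAIN = Wr 0 9 ;; Wr 1 9 ;; LOG ;; SETUP ;; MARK ;; PUSH ;; WhileC (Tp 0 (- {9})) BODY ;; FINAL"

definition REACH :: com where
  "REACH = COUNT ;; LOOPFREE ;; IfC (NZ rF) MAIN EQUAL"

lemma com_ok_REACH: "com_ok 24 REACH"
  by (simp add: REACH_def MAIN_def FINAL_def MARK_def SETUP_def LOG_def EQUAL_def LOOPFREE_def CHECK_def COUNT_def
      BODY_def stage_def UP_def DOWN_def HALVE_def PUSH_def RESTORE_def SAVE_def LOCATE_def CHILD_def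
      EDGES_def TRANSFER_def EDGE_def IFSET_def SET_def IFMEM_def SKIP_def ADDR_def RANK_def MEM_def TESTBIT_def
      FOR_def PEEK_def TGOTO_def GOTO_def REW_def ADD_def CLR_def MOVE_def)

text \<open>The number of binary digits. The strict inequality suits both uses: a counter of this
  width holds all values up to \<open>n\<close>, and walks of length at most \<open>n\<close> fit
  under \<open>2 ^ log_ceil n\<close>.\<close>

definition log_ceil :: "nat \<Rightarrow> nat" where
  "log_ceil n = (LEAST k. n < 2 ^ k)"

lemma less_log_ceil: "n < 2 ^ log_ceil n"
  unfolding log_ceil_def by (rule LeastI[of _ n]) (rule less_exp)

lemma log_ceil_le: "0 < n \<Longrightarrow> 2 ^ log_ceil n \<le> 2 * n"
proof -
  assume n: "0 < n"
  then have "0 < log_ceil n" using less_log_ceil[of n] by (cases "log_ceil n") auto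
  then obtain k where k: "log_ceil n = Suc k" by (cases "log_ceil n") auto
  then have "\<not> n < 2 ^ k" using not_less_Least[of k "\<lambda>k. n < 2 ^ k"] unfolding log_ceil_def by auto
  then show ?thesis using k by simp
qed

lemma log_ceil_self: "log_ceil n \<le> n"
  unfolding log_ceil_def by (rule Least_le) (rule less_exp)

lemma div_pow_log_ceil: "j < log_ceil n \<Longrightarrow> n div 2 ^ j \<noteq> 0"
  using not_less_Least[of j "\<lambda>k. n < 2 ^ k"] unfolding log_ceil_def by (simp add: div_eq_0_iff)

context ram_bounds
begin

text \<open>For loops that are not plain countdowns: the number of rounds appears in the proof only,
  not in a register.\<close>

lemma wp_while_index:
  assumes "I 0 \<rho> i h m" "N \<le> B"
    and step: "\<And>j \<rho> i h m. j < N \<Longrightarrow> I j \<rho> i h m \<Longrightarrow> test x b \<rho> i h m \<and> wp c (I (Suc j)) \<rho> i h m"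
    and Q: "\<And>\<rho> i h m. I N \<rho> i h m \<Longrightarrow> \<not> test x b \<rho> i h m \<and> Q \<rho> i h m"
  shows "wp (WhileC b c) Q \<rho> i h m"
proof (rule wp_WhileI[OF _ assms(2)])
  have "while1 (wp c) (test x b) Q k \<rho> i h m" if "k \<le> N" "I (N - k) \<rho> i h m" for k \<rho> i h m
    using that
  proof (induction k arbitrary: \<rho> i h m)
    case 0
    then show ?case using Q by (simp add: while1.simps)
  next
    case (Suc k)
    then have "test x b \<rho> i h m" and w: "wp c (I (Suc (N - Suc k))) \<rho> i h m"
      using step[of "N - Suc k" \<rho> i h m] by auto
    have "wp c (while1 (wp c) (test x b) Q k) \<rho> i h m"
      by (rule wp_mono[OF w]) (use Suc in \<open>auto simp: Suc_diff_Suc\<close>)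
    then show ?case using \<open>test x b \<rho> i h m\<close> by (simp add: while1.simps)
  qed
  from this[of N \<rho> i h m] assms(1) show "while1 (wp c) (test x b) Q N \<rho> i h m" by simp
qed

lemma wp_right_until:
  assumes "i \<le> i'" "i' \<le> length x + 1" "\<And>j. i \<le> j \<Longrightarrow> j < i' \<Longrightarrow> input_cell x j \<notin> S" "input_cell x i' \<in> S" "Q \<rho> i' h m"
  shows "wp (WhileC (In (- S)) (InM MoveRight)) Q \<rho> i h m"
  by (rule wp_while_index[where N = "i' - i" and I = "\<lambda>j \<rho>' p h' m'. \<rho>' = \<rho> \<and> p = i + j \<and> h' = h \<and> m' = m"])
    (use assms LB in auto)

lemma wp_left_until:
  assumes "i' \<le> i" "i \<le> length x + 1" "\<And>j. i' < j \<Longrightarrow> j \<le> i \<Longrightarrow> input_cell x j \<notin> S" "input_cell x i' \<in> S" "Q \<rho> i' h m"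
  shows "wp (WhileC (In (- S)) (InM MoveLeft)) Q \<rho> i h m"
  by (rule wp_while_index[where N = "i - i'" and I = "\<lambda>j \<rho>' p h' m'. \<rho>' = \<rho> \<and> p = i - j \<and> h' = h \<and> m' = m"])
    (use assms LB in auto)

lemma wp_right_count:
  assumes "i \<le> i'" "i' \<le> length x + 1" "\<And>j. i \<le> j \<Longrightarrow> j < i' \<Longrightarrow> input_cell x j \<notin> S" "input_cell x i' \<in> S"
    "\<rho> r = 0" "i' - i \<le> V" "Q (\<rho>(r := i' - i)) i' h m"
  shows "wp (WhileC (In (- S)) (InM MoveRight ;; Inc r)) Q \<rho> i h m"
  by (rule wp_while_index[where N = "i' - i" and I = "\<lambda>j \<rho>' p h' m'. \<rho>' = \<rho>(r := j) \<and> p = i + j \<and> h' = h \<and> m' = m"])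
    (use assms LB in \<open>auto simp: fun_upd_idem\<close>)

lemma wp_left_count:
  assumes "i' \<le> i" "i \<le> length x + 1" "\<And>j. i' < j \<Longrightarrow> j \<le> i \<Longrightarrow> input_cell x j \<notin> S" "input_cell x i' \<in> S"
    "\<rho> r = 0" "i - i' \<le> V" "Q (\<rho>(r := i - i')) i' h m"
  shows "wp (WhileC (In (- S)) (InM MoveLeft ;; Inc r)) Q \<rho> i h m"
  by (rule wp_while_index[where N = "i - i'" and I = "\<lambda>j \<rho>' p h' m'. \<rho>' = \<rho>(r := j) \<and> p = i - j \<and> h' = h \<and> m' = m"])
    (use assms LB in \<open>auto simp: fun_upd_idem\<close>)

lemma wp_CHECK:
  assumes "\<rho> rF = of_bool P" "0 < V" "i \<le> length x" "Q (\<rho>(rF := of_bool (P \<or> input_cell x i = Sym One))) (Suc i) h m"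
  shows "wp CHECK Q \<rho> i h m"
  using assms unfolding CHECK_def by (auto simp: fun_upd_idem)

lemma wp_COUNT:
  assumes "\<And>j. j < n \<Longrightarrow> input_cell x (Suc j) \<noteq> Sym Sep" "input_cell x (Suc n) = Sym Sep" "n < length x"
    "n \<le> V" "\<rho> rN = 0" "Q (\<rho>(rN := n)) (Suc n) h m"
  shows "wp COUNT Q \<rho> 0 h m"
  unfolding COUNT_def wp.simps(4,7)
proof (rule wp_right_count[where i' = "Suc n"])
  fix j assume "min (length x + 1) (shift MoveRight 0) \<le> j" "j < Suc n"
  then show "input_cell x j \<notin> {Sym Sep}" using assms(1)[of "j - 1"] by auto
qed (use assms in auto)

lemma wp_LOOPFREE:
  assumes cells: "\<And>y z. y < n \<Longrightarrow> z < n \<Longrightarrow> input_cell x (Suc (y * Suc n + z)) = Sym (if e y z then One else Zero)"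
    "\<And>y. y < n \<Longrightarrow> input_cell x (Suc (y * Suc n + n)) = Sym Sep"
    and len: "n * Suc n < length x" and V: "n \<le> V" "0 < V" and i: "i \<le> length x + 1"
    and \<rho>: "\<rho> rN = n" "\<rho> rF = 0" "\<rho> rX = 0" "\<rho> rCX = 0" "\<rho> rZ = 0" "\<rho> rT = 0"
    and Q: "\<And>i. i \<le> length x + 1 \<Longrightarrow> Q (\<rho>(rF := of_bool (\<exists>y<n. \<exists>z<n. y \<noteq> z \<and> e y z))) i h m"
  shows "wp LOOPFREE Q \<rho> i h m"
  unfolding LOOPFREE_def wp.simps(4,7)
proof (rule wp_REW[OF i])
  let ?P = "\<lambda>j. \<exists>y<j. \<exists>z<n. y \<noteq> z \<and> e y z"
  show "wp (FOR rX rN rCX (ADD rX rZ ;; WhileC (NZ rZ) (Dec rZ ;; CHECK) ;;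
     InM MoveRight ;; WhileC (In (- {Sym Sep})) CHECK ;; InM MoveRight)) Q \<rho> (min (length x + 1) (shift MoveRight 0)) h m"
  proof (rule wp_FOR[where N = n and I = "\<lambda>j \<rho>' i' h' m'. \<rho>' = \<rho>(rF := of_bool (?P j)) \<and> i' = Suc (j * Suc n) \<and> h' = h \<and> m' = m"])
    fix j \<rho>' i' h' m'
    assume j: "j < n" "\<rho>' = \<rho>(rF := of_bool (?P j)) \<and> i' = Suc (j * Suc n) \<and> h' = h \<and> m' = m"
    have "Suc j * Suc n \<le> n * Suc n" using j(1) by (intro mult_le_mono1) simp
    then have lenj: "j * Suc n + n < length x" using len by simp
    let ?C = "\<lambda>k. ?P j \<or> (\<exists>z<k. j \<noteq> z \<and> e j z)"
    let ?r = "\<lambda>k w. \<rho>(rF := of_bool (?C k), rCX := n - Suc j, rX := j, rZ := w)"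
    let ?Q = "\<lambda>\<rho>' i' h' m'. \<rho>' rCX = n - Suc j \<and> \<rho>' rX = j \<and>
      (\<rho>'(rCX := 0, rX := 0) = \<rho>(rF := of_bool (?P (Suc j))) \<and> i' = Suc (Suc j * Suc n) \<and> h' = h \<and> m' = m)"
    have start: "(\<rho>'(rCX := n - Suc j, rX := j))(rZ := (\<rho>'(rCX := n - Suc j, rX := j)) rZ + (\<rho>'(rCX := n - Suc j, rX := j)) rX) = ?r 0 j"
      using j \<rho> by simp
    show "wp (ADD rX rZ ;; WhileC (NZ rZ) (Dec rZ ;; CHECK) ;;
     InM MoveRight ;; WhileC (In (- {Sym Sep})) CHECK ;; InM MoveRight) ?Q (\<rho>'(rCX := n - Suc j, rX := j)) i' h' m'"
      unfolding wp.simps(4,7)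
    proof (rule wp_ADD, goal_cases)
      case 6
      show ?case unfolding start
      proof (rule wp_count[where N = j and I = "\<lambda>k \<rho>' i' h' m'. \<rho>' = ?r k (j - k) \<and> i' = Suc (j * Suc n + k) \<and> h' = h \<and> m' = m"])
        fix k \<rho>' i' h' m'
        assume k: "k < j" "\<rho>' = ?r k (j - k) \<and> i' = Suc (j * Suc n + k) \<and> h' = h \<and> m' = m"
        have "(?r k (j - Suc k))(rF := of_bool (?C k \<or> input_cell x i' = Sym One)) = ?r (Suc k) (j - Suc k)"
          using k j(1) cells(1)[of j k] by (auto simp: fun_eq_iff fun_upd_apply less_Suc_eq)
        then show "wp CHECK (\<lambda>\<rho>' i' h' m'. (\<rho>' = ?r (Suc k) (j - Suc k) \<and> i' = Suc (j * Suc n + Suc k) \<and> h' = h \<and> m' = m) \<and>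
            \<rho>' rZ = j - Suc k) (\<rho>'(rZ := j - Suc k)) i' h' m'"
          by (intro wp_CHECK[where P = "?C k"]) (use k j lenj V in auto)
      next
        fix \<rho>' i' h' m'
        assume k: "\<rho>' = ?r j (j - j) \<and> i' = Suc (j * Suc n + j) \<and> h' = h \<and> m' = m"
        \<comment> \<open>This move passes the diagonal entry, so a loop edge never sets the
          flag.\<close>
        have pos: "min (length x + 1) (shift MoveRight i') = Suc (j * Suc n + Suc j)" using k j(1) lenj by simp
        show "wp (WhileC (In (- {Sym Sep})) CHECK)
             (\<lambda>\<rho>' i' h' m'. ?Q \<rho>' (min (length x + 1) (shift MoveRight i')) h' m')
             \<rho>' (min (length x + 1) (shift MoveRight i')) h' m'"
          unfolding pos
        proof (rule wp_while_index[where N = "n - Suc j" and I = "\<lambda>k \<rho>' i' h' m'. \<rho>' = ?r (Suc j + k) 0 \<and>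
            i' = Suc (j * Suc n + Suc j + k) \<and> h' = h \<and> m' = m"])
          show "\<rho>' = ?r (Suc j + 0) 0 \<and> Suc (j * Suc n + Suc j) = Suc (j * Suc n + Suc j + 0) \<and> h' = h \<and> m' = m"
            using k by (auto simp: fun_eq_iff fun_upd_apply less_Suc_eq)
        next
          fix k \<rho>' i' h' m'
          assume l: "k < n - Suc j" "\<rho>' = ?r (Suc j + k) 0 \<and> i' = Suc (j * Suc n + Suc j + k) \<and> h' = h \<and> m' = m"
          have c: "input_cell x i' = Sym (if e j (Suc j + k) then One else Zero)"
            using cells(1)[of j "Suc j + k"] l j(1) by (simp add: add_ac)
          have "(?r (Suc j + k) 0)(rF := of_bool (?C (Suc j + k) \<or> input_cell x i' = Sym One)) = ?r (Suc j + Suc k) 0"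
            using c by (auto simp: fun_eq_iff fun_upd_apply less_Suc_eq)
          then have "wp CHECK (\<lambda>\<rho>' i' h' m'. \<rho>' = ?r (Suc j + Suc k) 0 \<and>
              i' = Suc (j * Suc n + Suc j + Suc k) \<and> h' = h \<and> m' = m) \<rho>' i' h' m'"
            by (intro wp_CHECK[where P = "?C (Suc j + k)"]) (use l j lenj V in auto)
          then show "test x (In (- {Sym Sep})) \<rho>' i' h' m' \<and> wp CHECK (\<lambda>\<rho>' i' h' m'. \<rho>' = ?r (Suc j + Suc k) 0 \<and>
              i' = Suc (j * Suc n + Suc j + Suc k) \<and> h' = h \<and> m' = m) \<rho>' i' h' m'"
            using c by simp
        next
          fix \<rho>' i' h' m'
          assume l: "\<rho>' = ?r (Suc j + (n - Suc j)) 0 \<and> i' = Suc (j * Suc n + Suc j + (n - Suc j)) \<and> h' = h \<and> m' = m"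
          have i': "i' = Suc (j * Suc n + n)" using l j(1) by simp
          have "?C n \<longleftrightarrow> ?P (Suc j)" by (auto simp: less_Suc_eq)
          then have "(?r n 0)(rCX := 0, rX := 0) = \<rho>(rF := of_bool (?P (Suc j)))"
            using \<rho> by (simp add: fun_eq_iff fun_upd_apply)
          moreover have "\<rho>' = ?r n 0" using l j(1) by simp
          moreover have "min (length x + 1) (shift MoveRight i') = Suc (Suc j * Suc n)" using lenj i' by simp
          moreover have "\<not> test x (In (- {Sym Sep})) \<rho>' i' h' m'" using cells(2)[OF j(1)] i' by simp
          ultimately show "\<not> test x (In (- {Sym Sep})) \<rho>' i' h' m' \<and> ?Q \<rho>' (min (length x + 1) (shift MoveRight i')) h' m'"
            using l by simp
        qed (use LB lenj in simp)
      qed (use j V \<rho> in \<open>auto simp: fun_eq_iff fun_upd_apply\<close>)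
    qed (use j \<rho> V in auto)
  next
    fix \<rho>' i' h' m'
    assume "\<rho>' = \<rho>(rF := of_bool (?P n)) \<and> i' = Suc (n * Suc n) \<and> h' = h \<and> m' = m"
    then show "Q \<rho>' i' h' m'" using Q[of i'] len by simp
  qed (use \<rho> V in \<open>auto simp: fun_upd_idem\<close>)
qed

lemma wp_EQUAL:
  assumes cells: "\<And>z. z < n \<Longrightarrow> input_cell x (Suc (pu + z)) = Sym (if z = u then One else Zero)"
    "\<And>z. z < n \<Longrightarrow> input_cell x (Suc (pv + z)) = Sym (if z = v then One else Zero)"
    "input_cell x pv = Sym Sep" "input_cell x (length x) = Sym Sep"
    and len: "length x = Suc (pv + n)" "pv = Suc (pu + n)" and uv: "u < n" "v < n"
    and i: "i \<le> length x + 1" and V: "n \<le> V" and \<rho>: "\<rho> rZ = 0"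
    and Q: "\<And>i. Q \<rho> i h (if u = v then m(0 := (m 0)(h 0 := 1)) else m)"
  shows "wp EQUAL Q \<rho> i h m"
proof -
  have one: "input_cell x (Suc (pu + z)) = Sym One \<longleftrightarrow> z = u" if "z < n" for z
    using cells(1)[OF that] by simp
  have "wp (IfC (In {Sym One}) (Wr 0 1) Skip) Q \<rho> (Suc (pu + v)) h m"
    using one[OF uv(2)] Q[of "Suc (pu + v)"] by (auto split: if_splits)
  moreover have "wp (WhileC (NZ rZ) (Dec rZ ;; InM MoveLeft)) Q' (\<rho>(rZ := n - v)) pv h m"
    if "Q' \<rho> (Suc (pu + v)) h m" for Q'
    by (rule wp_count[where N = "n - v" and I = "\<lambda>k \<rho>' i' h' m'. \<rho>' = \<rho>(rZ := n - v - k) \<and> i' = pv - k \<and> h' = h \<and> m' = m"])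
      (use that V uv len \<rho> in \<open>auto simp: fun_upd_idem\<close>)
  ultimately have 1: "wp (WhileC (NZ rZ) (Dec rZ ;; InM MoveLeft)) (wp (IfC (In {Sym One}) (Wr 0 1) Skip) Q) (\<rho>(rZ := n - v)) pv h m"
    by blast
  have 2: "wp (WhileC (In (- {Sym Sep})) (InM MoveLeft)) (wp (WhileC (NZ rZ) (Dec rZ ;; InM MoveLeft))
      (wp (IfC (In {Sym One}) (Wr 0 1) Skip) Q)) (\<rho>(rZ := n - v)) (Suc (pv + v)) h m"
  proof (rule wp_left_until[where i' = pv])
    fix j assume "pv < j" "j \<le> Suc (pv + v)"
    then show "input_cell x j \<notin> {Sym Sep}" using cells(2)[of "j - Suc pv"] uv by auto
  next
    show "wp (WhileC (NZ rZ) (Dec rZ ;; InM MoveLeft)) (wp (IfC (In {Sym One}) (Wr 0 1) Skip) Q) (\<rho>(rZ := n - v)) pv h m"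
      by (rule 1)
  qed (use cells(3) len uv in simp_all)
  have 3: "wp (WhileC (In (- {Sym One})) (InM MoveLeft ;; Inc rZ)) (wp (WhileC (In (- {Sym Sep})) (InM MoveLeft))
      (wp (WhileC (NZ rZ) (Dec rZ ;; InM MoveLeft)) (wp (IfC (In {Sym One}) (Wr 0 1) Skip) Q))) \<rho> (length x) h m"
  proof (rule wp_left_count[where i' = "Suc (pv + v)"])
    fix j assume j: "Suc (pv + v) < j" "j \<le> length x"
    show "input_cell x j \<notin> {Sym One}"
    proof (cases "j = length x")
      case False
      define z where "z = j - Suc pv"
      have "j = Suc (pv + z)" "z < n" "z \<noteq> v" using j False len by (auto simp: z_def)
      then show ?thesis using cells(2)[of z] by simp
    qed (use cells(4) in simp)
  next
    have "length x - Suc (pv + v) = n - v" using len by simp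
    then show "wp (WhileC (In (- {Sym Sep})) (InM MoveLeft))
      (wp (WhileC (NZ rZ) (Dec rZ ;; InM MoveLeft)) (wp (IfC (In {Sym One}) (Wr 0 1) Skip) Q))
      (\<rho>(rZ := length x - Suc (pv + v))) (Suc (pv + v)) h m" using 2 by simp
  qed (use cells(2)[of v] len uv V \<rho> in auto)
  show ?thesis
    unfolding EQUAL_def wp.simps(4,7)
  proof (rule wp_right_until[where i' = "length x + 1"])
    have "min (length x + 1) (shift MoveLeft (length x + 1)) = length x" by simp
    then show "wp (WhileC (In (- {Sym One})) (InM MoveLeft ;; Inc rZ)) (wp (WhileC (In (- {Sym Sep})) (InM MoveLeft))
      (wp (WhileC (NZ rZ) (Dec rZ ;; InM MoveLeft)) (wp (IfC (In {Sym One}) (Wr 0 1) Skip) Q))) \<rho>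
      (min (length x + 1) (shift MoveLeft (length x + 1))) h m" using 3 by (simp only:)
  qed (use i in \<open>auto simp: input_cell_def\<close>)
qed

lemma wp_LOG:
  assumes \<rho>: "\<rho> rN = n" "\<rho> rW = 0" "\<rho> rT = 0" "\<rho> rD = 0" "\<rho> rK0 = 0" and V: "n \<le> V"
    and Q: "Q (\<rho>(rK0 := log_ceil n)) i h m"
  shows "wp LOG Q \<rho> i h m"
  unfolding LOG_def wp.simps(7)
proof (rule wp_ADD, goal_cases)
  case 6
  let ?c = "WhileC (NZ rW) (Dec rW ;; IfC (NZ rW) (Dec rW ;; Inc rD) Skip) ;; MOVE rD rW ;; Inc rK0"
  let ?I = "\<lambda>j \<rho>' i' h' m'. \<rho>' = \<rho>(rW := n div 2 ^ j, rK0 := j) \<and> i' = i \<and> h' = h \<and> m' = m"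
  show ?case
  proof (rule wp_while_index[where N = "log_ceil n" and I = ?I])
    show "log_ceil n \<le> B" using log_ceil_self[of n] V VB by simp
  next
    fix j \<rho>' i' h' m'
    assume j: "j < log_ceil n" "?I j \<rho>' i' h' m'"
    let ?w = "n div 2 ^ j"
    have w: "?w \<noteq> 0" "?w \<le> V"
      using div_pow_log_ceil[OF j(1)] le_trans[OF div_le_dividend V] by auto
    have "wp ?c (?I (Suc j)) \<rho>' i' h' m'"
      unfolding wp.simps(7)
    \<comment> \<open>Each round takes two units off \<open>rW\<close> and adds one to
      \<open>rD\<close>, except that for odd \<open>?w\<close> the last round finds a single unit.
      The rounds are half of \<open>?w\<close> rounded up, and \<open>rD\<close> ends at half
      rounded down.\<close>
    proof (rule wp_while_index[where N = "(?w + 1) div 2" and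
          I = "\<lambda>k \<rho>' i' h' m'. \<rho>' = \<rho>(rW := ?w - 2 * k, rK0 := j, rD := min k (?w div 2)) \<and> i' = i \<and> h' = h \<and> m' = m"])
      show "(?w + 1) div 2 \<le> B" using w VB by simp
    next
      fix k \<rho>' i' h' m'
      assume k: "k < (?w + 1) div 2"
        "\<rho>' = \<rho>(rW := ?w - 2 * k, rK0 := j, rD := min k (?w div 2)) \<and> i' = i \<and> h' = h \<and> m' = m"
      have pos: "0 < ?w - 2 * k" using k(1) by simp
      have "k \<le> V" using k(1) w by simp
      have a: "?w - 2 * k - 1 = 0 \<Longrightarrow> min (Suc k) (?w div 2) = k \<and> min k (?w div 2) = k \<and> ?w - 2 * Suc k = 0"
        using pos by simp
      have b: "?w - 2 * k - 1 \<noteq> 0 \<Longrightarrow> min (Suc k) (?w div 2) = Suc k \<and> min k (?w div 2) = k \<and> ?w - 2 * Suc k = ?w - 2 * k - 1 - 1"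
        using pos by simp
      show "test x (NZ rW) \<rho>' i' h' m' \<and> wp (Dec rW ;; IfC (NZ rW) (Dec rW ;; Inc rD) Skip)
        (\<lambda>\<rho>' i' h' m'. \<rho>' = \<rho>(rW := ?w - 2 * Suc k, rK0 := j, rD := min (Suc k) (?w div 2)) \<and> i' = i \<and> h' = h \<and> m' = m) \<rho>' i' h' m'"
      proof (cases "?w - 2 * k - 1 = 0")
        case True
        then show ?thesis using k(2) pos a[OF True] by (simp add: fun_eq_iff fun_upd_apply)
      next
        case False
        define q where "q = ?w - 2 * k"
        have q: "Suc 0 < q" "q - 1 - 1 = ?w - 2 * Suc k" using False b[OF False] by (auto simp: q_def)
        have \<rho>': "\<rho>' = \<rho>(rW := q, rK0 := j, rD := k)" using k(2) b[OF False] by (simp add: q_def)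
        then have r: "\<rho>' rW = q" "\<rho>' rD = k" by simp_all
        have "\<rho>'(rW := q - 1 - 1, rD := Suc k) = \<rho>(rW := ?w - 2 * Suc k, rK0 := j, rD := min (Suc k) (?w div 2))"
          unfolding \<rho>' q(2) using b[OF False] by (simp add: fun_eq_iff fun_upd_apply)
        moreover have "Suc k \<le> V" using b[OF False] w by (metis div_le_dividend le_trans min.cobounded2)
        ultimately show ?thesis using k(2) r q(1) by simp
      qed
    next
      show "\<rho>' = \<rho>(rW := ?w - 2 * 0, rK0 := j, rD := min 0 (?w div 2)) \<and> i' = i \<and> h' = h \<and> m' = m"
        using j(2) \<rho> by (auto simp: fun_eq_iff fun_upd_apply)
    next
      fix \<rho>' i' h' m'
      assume k: "\<rho>' = \<rho>(rW := ?w - 2 * ((?w + 1) div 2), rK0 := j, rD := min ((?w + 1) div 2) (?w div 2)) \<and> i' = i \<and> h' = h \<and> m' = m"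
      have e: "?w - 2 * ((?w + 1) div 2) = 0" "min ((?w + 1) div 2) (?w div 2) = ?w div 2" by auto
      have d: "?w div 2 = n div 2 ^ Suc j" by (simp add: div_mult2_eq[symmetric] mult.commute)
      have "wp (MOVE rD rW) (wp (Inc rK0) (?I (Suc j))) \<rho>' i' h' m'"
      proof (rule wp_MOVE)
        have eq: "\<rho>'(rD := 0, rW := \<rho>' rW + \<rho>' rD) = \<rho>(rW := n div 2 ^ Suc j, rK0 := j)"
          using k e d \<rho> by (auto simp: fun_eq_iff fun_upd_apply)
        have "Suc j \<le> V" using j(1) log_ceil_self[of n] V by simp
        then show "wp (Inc rK0) (?I (Suc j)) (\<rho>'(rD := 0, rW := \<rho>' rW + \<rho>' rD)) i' h' m'"
          unfolding eq using k by simp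
        show "\<rho>' rW + \<rho>' rD \<le> V" using k e w by simp
      qed simp
      then show "\<not> test x (NZ rW) \<rho>' i' h' m' \<and> wp (MOVE rD rW) (wp (Inc rK0) (?I (Suc j))) \<rho>' i' h' m'"
        using k e by simp
    qed
    then show "test x (NZ rW) \<rho>' i' h' m' \<and> wp ?c (?I (Suc j)) \<rho>' i' h' m'"
      using j w by simp
  next
    fix \<rho>' i' h' m'
    assume j: "?I (log_ceil n) \<rho>' i' h' m'"
    have "n div 2 ^ log_ceil n = 0" using less_log_ceil[of n] by simp
    then have "\<rho>' = \<rho>(rK0 := log_ceil n)" using j \<rho> by (auto simp: fun_eq_iff fun_upd_apply)
    then show "\<not> test x (NZ rW) \<rho>' i' h' m' \<and> Q \<rho>' i' h' m'" using j \<rho> Q by simp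
  qed (use \<rho> in \<open>auto simp: fun_eq_iff fun_upd_apply\<close>)
qed (use \<rho> V in auto)

end

section \<open>The main branch of the program, from the layout of the input to the answer\<close>

locale ram_full = ram_run +
  fixes u v :: nat
  assumes root: "root = Suc (n * Suc n)" and pu_eq: "Suc pu = root + length (encode_tree n T)"
    and pv_eq: "pv = Suc (pu + n)" and uv: "u < n" "v < n"
    and bit_u: "\<And>y. y < n \<Longrightarrow> bit_at x (Suc (pu + y)) \<longleftrightarrow> y = u"
    and bit_v: "\<And>y. y < n \<Longrightarrow> bit_at x (Suc (pv + y)) \<longleftrightarrow> y = v"
    and k0_eq: "k0 = log_ceil n" and cost: "cost T k0 \<le> B" and uR: "u \<in> R"
    and vR: "v \<in> R \<Longrightarrow> \<exists>z m. m \<le> n \<and> walk edge (bag_verts T) z m \<and> z 0 = u \<and> z m = v"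
begin

lemma wp_SETUP:
  assumes \<rho>: "\<rho> rN = n" "\<rho> rW = 0" "\<rho> rT = 0" "\<rho> rD = 0" "\<rho> rRoot = 0" "\<rho> rPU = 0" "\<rho> rPV = 0"
    and i: "i \<le> length x + 1"
    and Q: "\<And>i. i \<le> length x + 1 \<Longrightarrow> Q (\<rho>(rRoot := root, rPU := pu, rPV := pv)) i h m"
  shows "wp SETUP Q \<rho> i h m"
  unfolding SETUP_def wp.simps(7)
proof (rule wp_ADD, goal_cases)
  case 6
  have pos: "root \<le> length x" "Suc pu \<le> length x" "pv + n < length x" using loc_pos[OF loc_root] pu pv by auto
  let ?R = "wp (Inc rRoot) (wp (ADD rRoot rPU) (wp (SKIP rPU) (wp (ADD rPU rPV) (wp (ADD rN rPV) (wp (Dec rPU) Q)))))"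
  have end_part: "?R (\<rho>(rRoot := n * Suc n)) i h m"
  proof -
    let ?\<rho>1 = "\<rho>(rRoot := root)" let ?\<rho>2 = "\<rho>(rRoot := root, rPU := root)"
    have fin: "wp (ADD rPU rPV) (wp (ADD rN rPV) (wp (Dec rPU) Q)) (?\<rho>2(rPU := ?\<rho>2 rPU + length (encode_tree n T))) i h m"
      if i: "i \<le> length x + 1" for i
    proof -
      have e: "?\<rho>2(rPU := ?\<rho>2 rPU + length (encode_tree n T)) = \<rho>(rRoot := root, rPU := Suc pu)"
        using pu_eq by simp
      have f: "\<rho>(rRoot := root, rPU := Suc pu, rPV := pv, rPU := pu) = \<rho>(rRoot := root, rPU := pu, rPV := pv)"
        by (simp add: fun_eq_iff fun_upd_apply)
      have "wp (Dec rPU) Q (\<rho>(rRoot := root, rPU := Suc pu, rPV := pv)) i h m"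
        using Q[OF i] f by simp
      then show ?thesis unfolding e
        by (intro wp_ADD) (use \<rho> pos LV pv_eq in simp_all)
    qed
    have skip: "wp (SKIP rPU) (wp (ADD rPU rPV) (wp (ADD rN rPV) (wp (Dec rPU) Q))) ?\<rho>2 i h m"
      by (rule wp_SKIP[where t = T]) (use \<rho> inp_T i fin in auto)
    have "wp (ADD rRoot rPU) (wp (SKIP rPU) (wp (ADD rPU rPV) (wp (ADD rN rPV) (wp (Dec rPU) Q)))) ?\<rho>1 i h m"
      by (rule wp_ADD) (use \<rho> skip pos LV in simp_all)
    then show ?thesis using root pos LV by simp
  qed
  show ?case
  proof (rule wp_count[where N = n and I = "\<lambda>j \<rho>' i' h' m'. \<rho>' = \<rho>(rRoot := j * Suc n, rW := n - j) \<and> i' = i \<and> h' = h \<and> m' = m"])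
    fix j \<rho>' i' h' m'
    assume j: "j < n" "\<rho>' = \<rho>(rRoot := j * Suc n, rW := n - j) \<and> i' = i \<and> h' = h \<and> m' = m"
    have "Suc j * Suc n \<le> n * Suc n" using j(1) by (intro mult_le_mono1) simp
    then have le: "Suc (n + j * Suc n) \<le> V" using root pos LV by simp
    show "wp (ADD rN rRoot ;; Inc rRoot) (\<lambda>\<rho>' i' h' m'. (\<rho>' = \<rho>(rRoot := Suc j * Suc n, rW := n - Suc j) \<and>
          i' = i \<and> h' = h \<and> m' = m) \<and> \<rho>' rW = n - Suc j) (\<rho>'(rW := n - Suc j)) i' h' m'"
      by (rule wp_SeqI, rule wp_ADD) (use j le \<rho> in \<open>auto simp: fun_eq_iff fun_upd_apply\<close>)
  next
    fix \<rho>' i' h' m'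
    assume j: "\<rho>' = \<rho>(rRoot := n * Suc n, rW := n - n) \<and> i' = i \<and> h' = h \<and> m' = m"
    then have "\<rho>' = \<rho>(rRoot := n * Suc n)" using \<rho> by (auto simp: fun_eq_iff fun_upd_apply)
    then show "?R \<rho>' i' h' m'" using end_part j by simp
  qed (use \<rho> pos LV pv in \<open>auto simp: fun_eq_iff fun_upd_apply\<close>)
qed (use \<rho> LV pv in auto)

lemma root_pos: "root + n < length x" "root \<le> V" "n \<le> V" "rank root n \<le> V" "rank root n \<le> A 1"
  using loc_pos[OF loc_root] loc_bounds[OF loc_root] LV pv A1 by auto

lemma mem_uv: "mem root u" "mem root v"
  using bit_u[OF uv(1)] bit_v[OF uv(2)] by (auto simp: mem_def)

lemma wp_MARK:
  assumes rd: "ready \<rho>" and i: "i \<le> length x + 1" and m: "m 1 = (\<lambda>_. 0)(0 := 9)" "h 1 \<le> A 1"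
    and Q: "\<And>i h' m'. \<lbrakk>i \<le> length x + 1; h' 0 = h 0; h' 1 \<le> A 1; m' 0 = m 0; marks_ok (m' 1); frame root 0 {u} (m' 1)\<rbrakk> \<Longrightarrow>
      Q \<rho> i h' m'"
  shows "wp MARK Q \<rho> i h m"
  unfolding MARK_def wp.simps(7)
proof (rule wp_ADD, goal_cases)
  case 6
  note r = rd[unfolded ready_def clean_def clean1_def]
  let ?\<rho> = "\<rho>(rC := root)"
  have eq: "\<rho>(rC := \<rho> rC + \<rho> rRoot) = ?\<rho>" using r by simp
  let ?I = "\<lambda>j \<rho>' i' (h' :: nat \<Rightarrow> nat) (m' :: nat \<Rightarrow> nat \<Rightarrow> nat). \<rho>' = ?\<rho> \<and> i' \<le> length x + 1 \<and> h' 0 = h 0 \<and> h' 1 \<le> A 1 \<and> m' 0 = m 0 \<and>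
      marks_ok (m' 1) \<and> frame root 0 {y. y = u \<and> y < j} (m' 1)"
  show ?case unfolding eq
  proof (rule wp_FOR[where N = n and I = ?I])
    fix j \<rho>' i' h' m'
    assume j: "j < n" "?I j \<rho>' i' h' m'"
    let ?\<rho>j = "?\<rho>(rCX := n - Suc j, rX := j)"
    let ?Q = "\<lambda>\<rho>' i' h' m'. \<rho>' rCX = n - Suc j \<and> \<rho>' rX = j \<and> ?I (Suc j) (\<rho>'(rCX := 0, rX := 0)) i' h' m'"
    have undo: "?\<rho>j(rCX := 0, rX := 0) = ?\<rho>" using r by (simp add: fun_eq_iff fun_upd_apply)
    have cl: "clean1 ?\<rho>j" using r by (simp add: clean1_def)
    have "wp (IfC (In {Sym One}) (SET rC rB rX 1) Skip) ?Q ?\<rho>j (Suc (pu + j)) h' m'"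
    proof (cases "j = u")
      case True
      have "wp (SET rC rB rX 1) ?Q ?\<rho>j (Suc (pu + j)) h' m'"
      proof (rule wp_SET)
        fix i2 and h2 :: "nat \<Rightarrow> nat"
        assume 2: "i2 \<le> length x + 1" "h2 0 = h' 0" "h2 1 \<le> A 1"
        have "frame root 0 (insert u {y. y = u \<and> y < j}) ((m' 1)(Suc (0 + rank root u) := 1))"
          by (rule frame_insert) (use j mem_uv in auto)
        moreover have "insert u {y. y = u \<and> y < j} = {y. y = u \<and> y < Suc j}" using True by auto
        ultimately have "?I (Suc j) ?\<rho> i2 h2 (m'(1 := (m' 1)(Suc (0 + rank root u) := 1)))"
          using j 2 by (simp add: marks_ok_upd)
        then show "?Q ?\<rho>j i2 h2 (m'(1 := (m' 1)(Suc (?\<rho>j rB + rank (?\<rho>j rC) (?\<rho>j rX)) := 1)))"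
          using undo True r by simp
      qed (use cl r j True mem_uv root_pos pu in auto)
      then show ?thesis using bit_u[OF j(1)] True by (simp add: bit_at_def)
    next
      case False
      have "{y. y = u \<and> y < Suc j} = {y. y = u \<and> y < j}" using False by (auto simp: less_Suc_eq)
      then show ?thesis using bit_u[OF j(1)] False undo j pu by (simp add: bit_at_def)
    qed
    then have "wp (PEEK rPU rX) (wp (IfC (In {Sym One}) (SET rC rB rX 1) Skip) ?Q) ?\<rho>j i' h' m'"
      by (intro wp_PEEK) (use j r pu LV in auto)
    then show "wp (PEEK rPU rX ;; IfC (In {Sym One}) (SET rC rB rX 1) Skip) ?Q (\<rho>'(rCX := n - Suc j, rX := j)) i' h' m'"
      unfolding wp.simps(7) using j by simp
  next
    have "marks_ok ((\<lambda>_. 0)(0 := 9))" by (auto simp: marks_ok_def fun_upd_apply)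
    then show "?I 0 ?\<rho> i h m" using i m by (auto simp: frame_def fun_upd_apply)
  next
    fix \<rho>' i' h' m'
    assume j: "?I n \<rho>' i' h' m'"
    have "{y. y = u \<and> y < n} = {u}" using uv by auto
    then have "Q \<rho> i' h' m'" using Q[of i' h' m'] j by auto
    then show "wp (CLR rC) Q \<rho>' i' h' m'"
      using j root_pos r by (intro wp_CLR) (auto simp: fun_upd_idem)
  qed (use r root_pos in auto)
qed (use rd root_pos in \<open>auto simp: ready_def clean_def clean1_def\<close>)

lemma wp_FINAL:
  assumes rd: "ready \<rho>" and st: "st [] f i h m" and fr: "frame root 0 M f"
    and Q: "\<And>\<rho> i h m. m 0 (h 0) = 1 \<longleftrightarrow> v \<in> M \<Longrightarrow> Q \<rho> i h m"
  shows "wp FINAL Q \<rho> i h m"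
  unfolding FINAL_def wp.simps(5,7)
proof (rule wp_ADD, goal_cases)
  case 6
  note r = rd[unfolded ready_def clean_def clean1_def]
  let ?\<rho> = "\<rho>(rC := root)"
  have eq: "\<rho>(rC := \<rho> rC + \<rho> rRoot) = ?\<rho>" using r by simp
  let ?I = "\<lambda>j \<rho>' i' (h' :: nat \<Rightarrow> nat) (m' :: nat \<Rightarrow> nat \<Rightarrow> nat). \<rho>' = ?\<rho> \<and> i' \<le> length x + 1 \<and> h' 0 = 0 \<and> h' 1 \<le> A 1 \<and> m' 1 = f \<and>
      m' 0 0 = of_bool (v < j \<and> v \<in> M)"
  show ?case unfolding eq
  proof (rule wp_FOR[where N = n and I = ?I])
    fix j \<rho>' i' h' m'
    assume j: "j < n" "?I j \<rho>' i' h' m'"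
    let ?\<rho>j = "?\<rho>(rCX := n - Suc j, rX := j)"
    let ?Q = "\<lambda>\<rho>' i' h' m'. \<rho>' rCX = n - Suc j \<and> \<rho>' rX = j \<and> ?I (Suc j) (\<rho>'(rCX := 0, rX := 0)) i' h' m'"
    have undo: "?\<rho>j(rCX := 0, rX := 0) = ?\<rho>" using r by (simp add: fun_eq_iff fun_upd_apply)
    have cl: "clean1 ?\<rho>j" using r by (simp add: clean1_def)
    have mk: "marks_ok f" using st by (simp add: st_def)
    have "wp (IfC (In {Sym One}) (IFSET rC rB rX (Wr 0 1) Skip) Skip) ?Q ?\<rho>j (Suc (pv + j)) h' m'"
    proof (cases "j = v")
      case True
      have fv: "f (Suc (rank root v)) = of_bool (v \<in> M)" using fr uv mem_uv by (simp add: frame_def)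
      have "wp (IFSET rC rB rX (Wr 0 1) Skip) ?Q ?\<rho>j (Suc (pv + j)) h' m'"
      proof (rule wp_IFSET)
        fix i2 and h2 :: "nat \<Rightarrow> nat"
        assume 2: "i2 \<le> length x + 1" "h2 0 = h' 0" "h2 1 \<le> A 1"
        show "wp (Wr 0 1) ?Q ?\<rho>j i2 h2 m'" if "m' 1 (Suc (?\<rho>j rB + rank (?\<rho>j rC) (?\<rho>j rX))) = 1"
        proof -
          have "v \<in> M" using that fv True r j by (cases "v \<in> M") auto
          then show ?thesis using undo True j 2 by simp
        qed
        show "wp Skip ?Q ?\<rho>j i2 h2 m'" if "m' 1 (Suc (?\<rho>j rB + rank (?\<rho>j rC) (?\<rho>j rX))) = 0"
        proof -
          have "v \<notin> M" using that fv True r j by auto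
          then show ?thesis using undo True j 2 by simp
        qed
      qed (use cl r j True mem_uv root_pos pv mk in auto)
      then show ?thesis using bit_v[OF j(1)] True by (simp add: bit_at_def)
    next
      case False
      have "v < Suc j \<longleftrightarrow> v < j" using False by auto
      then show ?thesis using bit_v[OF j(1)] False undo j pv by (simp add: bit_at_def)
    qed
    then have "wp (PEEK rPV rX) (wp (IfC (In {Sym One}) (IFSET rC rB rX (Wr 0 1) Skip) Skip) ?Q) ?\<rho>j i' h' m'"
      by (intro wp_PEEK) (use j r pv LV in auto)
    then show "wp (PEEK rPV rX ;; IfC (In {Sym One}) (IFSET rC rB rX (Wr 0 1) Skip) Skip) ?Q (\<rho>'(rCX := n - Suc j, rX := j)) i' h' m'"
      unfolding wp.simps(7) using j by simp
  next
    show "?I 0 ?\<rho> i h (m(0 := (m 0)(h 0 := 0)))" using st by (auto simp: st_def stack_def)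
  next
    fix \<rho>' i' h' m'
    assume j: "?I n \<rho>' i' h' m'"
    show "Q \<rho>' i' h' m'" by (rule Q) (use j uv in auto)
  qed (use r root_pos in auto)
qed (use rd root_pos in \<open>auto simp: ready_def clean_def clean1_def\<close>)

text \<open>Both ends lie in the enlarged root bag and a shortest walk has at most
  \<open>n < 2 ^ k0\<close> edges, so completeness at the root finds \<open>v\<close>. The converse
  is that marks stay in \<open>R\<close>.\<close>

lemma complete_reach:
  assumes "complete_marks edge (ext T) k0 {u} M" "M \<subseteq> R"
  shows "v \<in> M \<longleftrightarrow> v \<in> R"
proof
  assume "v \<in> R"
  then obtain z m where z: "m \<le> n" "walk edge (bag_verts T) z m" "z 0 = u" "z m = v" using vR by blast
  have "m \<le> 2 ^ k0" using z(1) less_log_ceil[of n] by (simp add: k0_eq)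
  moreover have "walk edge (bag_verts (ext T)) z m" using z(2) by (auto simp: walk_def bag_verts_enlarge)
  moreover have "v \<in> root_bag (ext T)" using root_bag_loc[OF loc_root] mem_uv uv by auto
  ultimately show "v \<in> M" using assms(1) z(3,4) unfolding complete_marks_def by auto
qed (use assms in auto)

lemma wp_MAIN:
  assumes \<rho>: "\<rho> rN = n" "\<And>r. r \<noteq> rN \<Longrightarrow> r \<noteq> rF \<Longrightarrow> \<rho> r = 0" and i: "i \<le> length x + 1"
    and h: "h 0 = 0" "h 1 = 0" and m: "m = (\<lambda>_ _. 0)"
    and Q: "\<And>\<rho> i h m. m 0 (h 0) = 1 \<longleftrightarrow> v \<in> R \<Longrightarrow> Q \<rho> i h m"
  shows "wp MAIN Q \<rho> i h m"
proof -
  let ?\<rho> = "\<rho>(rK0 := k0, rRoot := root, rPU := pu, rPV := pv)"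
  let ?m = "m(0 := (m 0)(h 0 := 9), 1 := (m 1)(h 1 := 9))"
  have rd: "ready ?\<rho>" using \<rho> by (simp add: ready_def clean_def clean1_def)
  have loop0: "loop (wp FINAL Q) (cost T k0) ?\<rho> i h' m'"
    if "st ([] @ [1]) f i h' m'" "frame root 0 {u} f" for i h' m' f
  proof -
    have "loop (wp FINAL Q) (cost T k0 + 0) ?\<rho> i h' m'"
    proof (rule call_okD[OF call_ok_cost[OF T] loc_root that _ _ rd])
      show "{u} \<subseteq> root_bag (ext T)" using root_bag_loc[OF loc_root] mem_uv uv by auto
      show "{u} \<subseteq> R" using uR by simp
      fix i h m f' M'
      assume s: "st [] f' i h m" "frame root 0 M' f'" "M' \<subseteq> R" "complete_marks edge (ext T) k0 {u} M'"
      have "wp FINAL Q ?\<rho> i h m"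
        by (rule wp_FINAL[OF rd s(1,2)]) (use complete_reach[OF s(4,3)] Q in blast)
      moreover have "m 0 (h 0) = 9" using s(1) by (simp add: st_def stack_def)
      ultimately show "loop (wp FINAL Q) 0 ?\<rho> i h m" by (simp add: while1.simps)
    qed
    then show ?thesis by simp
  qed
  have "wp PUSH (wp (WhileC (Tp 0 (- {9})) BODY) (wp FINAL Q)) ?\<rho> i h' m'"
    if "st [] f i h' m'" "frame root 0 {u} f" for i h' m' f
  proof (rule wp_PUSH[OF that(1)])
    show "Suc (length []) \<le> A 0" using loc_bounds[OF loc_root] by simp
    fix i h m assume "st ([] @ [1]) f i h m"
    from loop0[OF this that(2)] cost show "wp (WhileC (Tp 0 (- {9})) BODY) (wp FINAL Q) ?\<rho> i h m"
      by (intro wp_WhileI)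
  qed
  then have "wp MARK (wp PUSH (wp (WhileC (Tp 0 (- {9})) BODY) (wp FINAL Q))) ?\<rho> i h ?m"
    if "i \<le> length x + 1" for i
    using that
    by (intro wp_MARK[OF rd]) (auto simp: st_def stack_def h h[unfolded One_nat_def] m)
  then have "wp SETUP (wp MARK (wp PUSH (wp (WhileC (Tp 0 (- {9})) BODY) (wp FINAL Q)))) (\<rho>(rK0 := k0)) i h ?m"
    by (intro wp_SETUP) (use \<rho> i in auto)
  then have "wp LOG (wp SETUP (wp MARK (wp PUSH (wp (WhileC (Tp 0 (- {9})) BODY) (wp FINAL Q))))) \<rho> i h ?m"
    by (intro wp_LOG) (use \<rho> root_pos k0_eq in auto)
  then show ?thesis unfolding MAIN_def wp.simps(5,7) by simp
qed

end

section \<open>Encoded inputs\<close>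

lemma length_encode_graph_rows:
  "length (concat (map (\<lambda>i. encode_set n (f i)) xs)) = length xs * Suc n"
  by (induction xs) auto

lemma length_encode_graph [simp]: "length (encode_graph n G) = n * Suc n"
  by (simp add: encode_graph_def length_encode_graph_rows)

lemma length_encode_tree: "length (encode_tree n t) = size t * (n + 3) + 1"
  by (induction t) (auto simp: algebra_simps)

lemma inp_row:
  assumes "y < n"
  shows "inp (encode_graph n G @ ys) (Suc (y * Suc n)) (encode_set n {z. (y, z) \<in> parcs G})"
proof -
  let ?f = "\<lambda>i. encode_set n {j. (i, j) \<in> parcs G}"
  have "[0..<n] = [0..<y] @ y # [Suc y..<n]"
    using assms upt_add_eq_append[of 0 y "n - y"] upt_conv_Cons[of y n] by simp
  then have "encode_graph n G @ ys =
      concat (map ?f [0..<y]) @ ?f y @ concat (map ?f [Suc y..<n]) @ ys"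
    by (simp add: encode_graph_def)
  then show ?thesis unfolding inp_def
    by (intro exI[of _ "concat (map ?f [0..<y])"] exI[of _ "concat (map ?f [Suc y..<n]) @ ys"])
      (simp add: length_encode_graph_rows)
qed

lemma inp_encode_set_cell:
  assumes "inp x p (encode_set n S)"
  shows "z < n \<Longrightarrow> input_cell x (p + z) = Sym (if z \<in> S then One else Zero)"
    "input_cell x (p + n) = Sym Sep"
  using inp_nth[OF assms, of z] inp_nth[OF assms, of n] by (auto simp: encode_set_def nth_append)

text \<open>A simple path visits each vertex at most once, which bounds its length by the number of
  vertices.\<close>

lemma reachable_walk:
  assumes G: "pair_wf_digraph G" "finite (pverts G)" and uv: "u \<rightarrow>\<^sup>*\<^bsub>with_proj G\<^esub> v"
  shows "\<exists>z m. m \<le> card (pverts G) \<and> walk (\<lambda>y z. (y, z) \<in> parcs G) (pverts G) z m \<and> z 0 = u \<and> z m = v"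
proof -
  interpret pair_wf_digraph G by fact
  have "finite (parcs G)"
    by (rule finite_subset[of _ "pverts G \<times> pverts G"]) (use G(2) in_arcsD1 in_arcsD2 in auto)
  then interpret pair_fin_digraph G by unfold_locales (use G in auto)
  obtain p where p: "apath u p v" using uv by (auto simp: reachable_apath)
  then have aw: "awalk u p v" by (auto intro: awalkI_apath)
  have "length p < card (pverts G)" using length_apath_less[OF p] by simp
  have nth: "length (pawalk_verts u p) = Suc (length p) \<and> pawalk_verts u p ! 0 = u \<and>
      pawalk_verts u p ! length p = v \<and>
      (\<forall>i<length p. (pawalk_verts u p ! i, pawalk_verts u p ! Suc i) \<in> parcs G)"
    if "awalk u p v" for u p
    using that
  proof (induction p arbitrary: u)
    case Nil
    then show ?case by (simp add: awalk_Nil_iff)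
  next
    case (Cons e p)
    then have e: "e \<in> parcs G" "fst e = u" "awalk (snd e) p v" by (auto simp: awalk_Cons_iff)
    from Cons.IH[OF e(3)] show ?case using e by (auto simp: nth_Cons split: nat.splits)
  qed
  have "set (pawalk_verts u p) \<subseteq> pverts G" using awalk_verts_in_verts aw by (auto simp: awalk_def)
  then have "\<forall>i\<le>length p. pawalk_verts u p ! i \<in> pverts G"
    using nth[OF aw] nth_mem[of _ "pawalk_verts u p"] by (auto simp: subset_iff less_Suc_eq_le)
  then show ?thesis
    using nth[OF aw] \<open>length p < card (pverts G)\<close> unfolding walk_def
    by (intro exI[of _ "\<lambda>i. pawalk_verts u p ! i"] exI[of _ "length p"]) auto
qed

text \<open>The additional 8 makes the induction close: the four recursive calls contribute four
  times 8, which covers the 8 stages and the 8 of the claim. Each of them has a sum of height and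
  exponent smaller by at least one, whence the base 4.\<close>

lemma cost_le: "cost t k + 8 \<le> 8 * 4 ^ (height t + k)"
proof (induction t k rule: cost.induct)
  case (1 k)
  then show ?case by simp
next
  case (2 l S r)
  let ?H = "max (height l) (height r)"
  have "(4::nat) ^ height l \<le> 4 ^ ?H" "(4::nat) ^ height r \<le> 4 ^ ?H" by (auto intro: power_increasing)
  then have "cost l 0 + 8 \<le> 8 * 4 ^ ?H" "cost r 0 + 8 \<le> 8 * 4 ^ ?H" using 2 by (simp_all; linarith)+
  then show ?case by (simp del: max_def)
next
  case (3 l S r k)
  let ?H = "max (height l) (height r)"
  have "(4::nat) ^ (height l + Suc k) \<le> 4 ^ (?H + Suc k)" "(4::nat) ^ (height r + Suc k) \<le> 4 ^ (?H + Suc k)"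
    by (auto intro!: power_increasing)
  then have "cost l (Suc k) + 8 \<le> 8 * 4 ^ (?H + Suc k)" "cost r (Suc k) + 8 \<le> 8 * 4 ^ (?H + Suc k)"
    using 3 by linarith+
  then show ?case using 3 by simp
qed

section \<open>A fixed encoded instance\<close>

locale reach_input =
  fixes n :: nat and G :: "nat pair_pre_digraph" and T :: "nat set tree" and u v :: nat
  assumes G: "pair_wf_digraph G" and verts: "pverts G = {0..<n}" and td: "tree_decomposition G T"
    and uv: "u \<in> pverts G" "v \<in> pverts G"
begin

definition "x = encode n G T u v"
definition "tree_pos = Suc (n * Suc n)"
definition "pu = n * Suc n + length (encode_tree n T)"
definition "pv = Suc (pu + n)"

lemma uv_less: "u < n" "v < n"
  using uv verts by auto

lemma length_x: "length x = Suc (pv + n)" "length x = n * Suc n + (size T * (n + 3) + 1) + 2 * Suc n"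
  by (simp_all add: x_def encode_def pu_def pv_def length_encode_tree)

lemma inp_rows: "y < n \<Longrightarrow> inp x (Suc (y * Suc n)) (encode_set n {z. (y, z) \<in> parcs G})"
  unfolding x_def encode_def by (rule inp_row)

lemma inp_tree: "inp x tree_pos (encode_tree n T)"
  unfolding inp_def x_def encode_def tree_pos_def
  by (intro exI[of _ "encode_graph n G"] exI[of _ "encode_set n {u} @ encode_set n {v}"]) simp

lemma inp_u: "inp x (Suc pu) (encode_set n {u})"
  unfolding inp_def x_def encode_def pu_def
  by (intro exI[of _ "encode_graph n G @ encode_tree n T"] exI[of _ "encode_set n {v}"]) simp

lemma inp_v: "inp x (Suc pv) (encode_set n {v})"
  unfolding inp_def x_def encode_def pu_def pv_def
  by (intro exI[of _ "encode_graph n G @ encode_tree n T @ encode_set n {u}"] exI[of _ "[]"]) simp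

definition reach :: bool where
  "reach \<longleftrightarrow> u \<rightarrow>\<^sup>*\<^bsub>with_proj G\<^esub> v"

definition nonloop :: bool where
  "nonloop \<longleftrightarrow> (\<exists>y<n. \<exists>z<n. y \<noteq> z \<and> (y, z) \<in> parcs G)"

lemma bags_subset: "S \<in> set_tree T \<Longrightarrow> S \<subseteq> {..<n}"
  using td verts unfolding tree_decomposition_def set_tree_bag by fastforce

lemma T_not_Leaf: "T \<noteq> Leaf"
  using td uv(1) by (auto simp: tree_decomposition_def)

lemma card_bag: "S \<in> set_tree T \<Longrightarrow> card S \<le> treewidth T + 1"
proof -
  have fin: "finite (nodes T)" by (induction T) auto
  assume "S \<in> set_tree T"
  then obtain t where "t \<in> nodes T" "S = bag T t" by (auto simp: set_tree_bag)
  then have "card S - 1 \<le> treewidth T"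
    unfolding treewidth_def using fin by (intro Max_ge) auto
  then show ?thesis by simp
qed

text \<open>An edge between different vertices needs a bag of size two. This is what turns the term
  \<open>h\<close> of the counters into \<open>w * h\<close>.\<close>

lemma treewidth_pos:
  assumes nonloop
  shows "0 < treewidth T"
proof -
  obtain y z where yz: "y \<noteq> z" "(y, z) \<in> parcs G" using assms by (auto simp: nonloop_def)
  then obtain t where t: "t \<in> nodes T" "y \<in> bag T t" "z \<in> bag T t"
    using td by (force simp: tree_decomposition_def)
  then have S: "bag T t \<in> set_tree T" by (auto simp: set_tree_bag)
  have "finite (bag T t)" using bags_subset[OF S] finite_subset by blast
  then have "card {y, z} \<le> card (bag T t)" using t by (intro card_mono) auto
  then show ?thesis using card_bag[OF S] yz(1) by auto
qed

lemma treewidth_less: "treewidth T + 1 \<le> n"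
proof -
  have fin: "finite (nodes T)" by (induction T) auto
  have "nodes T \<noteq> {}" using T_not_Leaf by (cases T) auto
  then have "treewidth T \<in> (\<lambda>t. card (bag T t) - 1) ` nodes T"
    unfolding treewidth_def using fin by (intro Max_in) auto
  then obtain t where t: "t \<in> nodes T" "treewidth T = card (bag T t) - 1" by auto
  then have "bag T t \<subseteq> {..<n}" by (intro bags_subset) (auto simp: set_tree_bag)
  then have "card (bag T t) \<le> n" using card_mono[of "{..<n}" "bag T t"] by simp
  then show ?thesis using t uv_less by simp
qed

lemma reach_loops:
  assumes "\<not> nonloop"
  shows "reach \<longleftrightarrow> u = v"
proof
  assume reach
  then obtain z m where z: "walk (\<lambda>y z. (y, z) \<in> parcs G) (pverts G) z m" "z 0 = u" "z m = v"
    using reachable_walk[OF G, of u v] verts by (auto simp: reach_def)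
  have "z i = u" if "i \<le> m" for i
    using that
  proof (induction i)
    case 0
    then show ?case using z(2) by simp
  next
    case (Suc i)
    then have "(z i, z (Suc i)) \<in> parcs G" "z i < n" "z (Suc i) < n"
      using z(1) verts by (auto simp: walk_def)
    then have "z i = z (Suc i)" using assms unfolding nonloop_def by blast
    then show ?case using Suc by simp
  qed
  then show "u = v" using z(3) by auto
next
  interpret pair_wf_digraph G by (rule G)
  assume "u = v"
  then show reach unfolding reach_def using uv by simp
qed

text \<open>Up to the case distinction the registers need only hold values up to \<open>n\<close>.
  So an instance without proper edges can be decided with \<open>V = n\<close>, that is with
  counters of logarithmic length irrespective of the size of the tree.\<close>

lemma wp_prefix:
  assumes VB: "V \<le> B" "length x + 1 \<le> B" and V: "n \<le> V"
    and main: "\<And>i. nonloop \<Longrightarrow> i \<le> length x + 1 \<Longrightarrow>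
      ram.wp x V B A MAIN Q ((\<lambda>_. 0)(rN := n, rF := 1)) i (\<lambda>_. 0) (\<lambda>_ _. 0)"
    and Q: "\<And>\<rho> i h m. \<not> nonloop \<Longrightarrow> m 0 (h 0) = (if u = v then 1 else 0) \<Longrightarrow> Q \<rho> i h m"
  shows "ram.wp x V B A REACH Q (\<lambda>_. 0) 0 (\<lambda>_. 0) (\<lambda>_ _. 0)"
proof -
  interpret ram_bounds x V B A by unfold_locales (use VB in auto)
  have n: "0 < n" using uv_less by simp
  have cell: "input_cell x (Suc (y * Suc n + z)) = Sym (if (y, z) \<in> parcs G then One else Zero)" if "y < n" "z < n" for y z
    using inp_encode_set_cell(1)[OF inp_rows[OF that(1)] that(2)] by simp
  have sep: "input_cell x (Suc (y * Suc n + n)) = Sym Sep" if "y < n" for y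
    using inp_encode_set_cell(2)[OF inp_rows[OF that]] by simp
  have len: "n * Suc n < length x" "n < length x" by (simp_all add: length_x(2))
  have eqcase: "wp EQUAL Q ((\<lambda>_. 0)(rN := n, rF := 0)) i (\<lambda>_. 0) (\<lambda>_ _. 0)" if "\<not> nonloop" "i \<le> length x + 1" for i
  proof (rule wp_EQUAL[where pu = pu and pv = pv and u = u and v = v and n = n])
    show "input_cell x (Suc (pu + z)) = Sym (if z = u then One else Zero)" if "z < n" for z
      using inp_encode_set_cell(1)[OF inp_u that] by simp
    show "input_cell x (Suc (pv + z)) = Sym (if z = v then One else Zero)" if "z < n" for z
      using inp_encode_set_cell(1)[OF inp_v that] by simp
    show "input_cell x pv = Sym Sep" using inp_encode_set_cell(2)[OF inp_u] by (simp add: pv_def)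
    show "input_cell x (length x) = Sym Sep" using inp_encode_set_cell(2)[OF inp_v] by (simp add: length_x(1))
  qed (use that V uv_less length_x(1) Q in \<open>auto simp: pv_def\<close>)
  have "wp LOOPFREE (wp (IfC (NZ rF) MAIN EQUAL) Q) ((\<lambda>_. 0)(rN := n)) (Suc n) (\<lambda>_. 0) (\<lambda>_ _. 0)"
  proof (rule wp_LOOPFREE[where n = n and e = "\<lambda>y z. (y, z) \<in> parcs G"])
    fix i assume i: "i \<le> length x + 1"
    show "wp (IfC (NZ rF) MAIN EQUAL) Q ((\<lambda>_. 0)(rN := n, rF := of_bool (\<exists>y<n. \<exists>z<n. y \<noteq> z \<and> (y, z) \<in> parcs G))) i (\<lambda>_. 0) (\<lambda>_ _. 0)"
      unfolding nonloop_def[symmetric]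
      using main[OF _ i] eqcase[OF _ i] by (cases nonloop) auto
  qed (use cell sep len V n in auto)
  then show ?thesis
    unfolding REACH_def wp.simps(7)
    by (intro wp_COUNT) (use cell[of 0] sep[of 0] n len V in auto)
qed

end

definition machine_time :: "nat poly" where
  "machine_time = ptime (PSeq (prologue 24) (tr REACH)) + 1"

context reach_input
begin

definition "k0 = log_ceil n"
definition "stack_cells = height T + k0"
text \<open>A bag has at most \<open>treewidth T + 1\<close> vertices, and \<open>u\<close> and
  \<open>v\<close> may add two; one such region is reserved for each level.\<close>

definition "mark_cells = (treewidth T + 3) * height T"

lemma wp_MAIN_reach:
  assumes V: "length x + 1 \<le> V" "stack_cells \<le> V" "mark_cells \<le> V" and B: "V \<le> B" "cost T k0 \<le> B"
    and i: "i \<le> length x + 1"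
  shows "ram.wp x V B (\<lambda>j. if j = 0 then stack_cells else mark_cells) MAIN
    (\<lambda>\<rho> i h m. m 0 (h 0) = 1 \<longleftrightarrow> reach) ((\<lambda>_. 0)(rN := n, rF := 1)) i (\<lambda>_. 0) (\<lambda>_ _. 0)"
proof -
  let ?A = "\<lambda>j :: nat. if j = 0 then stack_cells else mark_cells"
  define R where "R = {y. u \<rightarrow>\<^sup>*\<^bsub>with_proj G\<^esub> y}"
  interpret pair_wf_digraph G by (rule G)
  interpret ram_tree x V B ?A n pu pv T tree_pos k0
    by unfold_locales
      (use V B inp_tree T_not_Leaf length_x uv_less in \<open>auto simp: pv_def stack_cells_def mark_cells_def\<close>)
  have bit_u: "bit_at x (Suc (pu + y)) \<longleftrightarrow> y = u" if "y < n" for y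
    using inp_encode_set[OF inp_u that] by simp
  have bit_v: "bit_at x (Suc (pv + y)) \<longleftrightarrow> y = v" if "y < n" for y
    using inp_encode_set[OF inp_v that] by simp
  have edge: "edge y z \<longleftrightarrow> (y, z) \<in> parcs G" if "y < n" "z < n" for y z
    using inp_encode_set[OF inp_rows[OF that(1)] that(2)] by (simp add: edge_def)
  have U: "{y. y < n \<and> (bit_at x (Suc (pu + y)) \<or> bit_at x (Suc (pv + y)))} = {u, v}"
    using bit_u bit_v uv_less by blast
  have bag_verts: "bag_verts T = {..<n}"
    using bags_subset td verts by (fastforce simp: bag_verts_def set_tree_bag tree_decomposition_def)
  have cov: "covers edge (enlarge {u, v} T)"
    unfolding covers_def
  proof (intro ballI impI)
    fix y z assume "y \<in> bag_verts (enlarge {u, v} T)" "z \<in> bag_verts (enlarge {u, v} T)" "edge y z"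
    then have "(y, z) \<in> parcs G"
      using bag_verts uv_less edge T_not_Leaf by (auto simp: bag_verts_enlarge)
    then obtain t where t: "t \<in> nodes T" "y \<in> bag T t" "z \<in> bag T t"
      using td by (force simp: tree_decomposition_def)
    then have "bag T t \<union> {u, v} \<in> set_tree (enlarge {u, v} T)"
      using set_tree_bag[of T] by (auto simp: enlarge_def tree.set_map)
    then show "\<exists>S\<in>set_tree (enlarge {u, v} T). y \<in> S \<and> z \<in> S" using t by blast
  qed
  interpret ram_struct x V B ?A n pu pv T tree_pos k0
  proof unfold_locales
    show "S \<subseteq> {..<n}" if "S \<in> set_tree T" for S using bags_subset[OF that] .
    show "separated T" using separated_subtree[OF td, of "[]"] by simp
    show "covers edge (enlarge {y. y < n \<and> (bit_at x (Suc (pu + y)) \<or> bit_at x (Suc (pv + y)))} T)"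
      unfolding U by (rule cov)
  qed
  have card: "card (S \<union> U) \<le> treewidth T + 3" if "S \<in> set_tree T" for S
  proof -
    have "card (S \<union> U) \<le> card S + card {u, v}" unfolding U_def U by (rule card_Un_le)
    moreover have "card {u, v} \<le> 2" using card_insert_le_m1[of 2 "{v}" u] by simp
    ultimately show ?thesis using card_bag[OF that] by simp
  qed
  interpret ram_full x V B ?A n pu pv T tree_pos k0 R u v
  proof unfold_locales
    fix ds t c b k assume "loc ds t c b k"
    then show "b + rank c n \<le> ?A 1 \<and> Suc (length ds) \<le> ?A 0"
      using loc_bounds'[OF card] by (simp add: stack_cells_def mark_cells_def)
  next
    fix y z assume "y \<in> R" "y < n" "z < n" "edge y z"
    then show "z \<in> R" using edge by (auto simp: R_def intro: reachable_adj_trans)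
  next
    assume "v \<in> R"
    then obtain z m where z: "m \<le> n" "walk (\<lambda>y z. (y, z) \<in> parcs G) (pverts G) z m" "z 0 = u" "z m = v"
      using reachable_walk[OF G, of u v] verts by (auto simp: R_def)
    then have "walk edge (bag_verts T) z m"
      using edge verts by (fastforce simp: walk_def bag_verts)
    then show "\<exists>z m. m \<le> n \<and> walk edge (bag_verts T) z m \<and> z 0 = u \<and> z m = v" using z by blast
  next
    show "u \<in> R" using uv by (simp add: R_def)
  next
    show "Suc pu = tree_pos + length (encode_tree n T)" by (simp add: pu_def tree_pos_def)
  qed (use V B uv_less bit_u bit_v in \<open>auto simp: tree_pos_def pv_def k0_def\<close>)
  show ?thesis by (rule wp_MAIN) (use i in \<open>auto simp: R_def reach_def\<close>)
qed

lemma decides_nonloop: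
  assumes nonloop and V: "length x + 1 \<le> V" "stack_cells \<le> V" "mark_cells \<le> V"
    and B: "V < B" "cost T k0 \<le> B"
  shows "decides_within (machine_of 24 REACH) x reach (poly machine_time B)
    (real (stack_cells + mark_cells + 2 + 24 * (log_ceil V + 2)))"
proof -
  have VB: "V \<le> B" using B(1) by simp
  have wp: "ram.wp x V B (\<lambda>j. if j = 0 then stack_cells else mark_cells) REACH
      (\<lambda>\<rho> i h m. m 0 (h 0) = 1 \<longleftrightarrow> reach) (\<lambda>_. 0) 0 (\<lambda>_. 0) (\<lambda>_ _. 0)"
    by (rule wp_prefix) (use assms VB wp_MAIN_reach[OF V VB B(2)] length_x(2) in auto)
  show ?thesis
    using machine_of_decides[OF wp less_log_ceil _ com_ok_REACH] log_ceil_self[of V] B(1)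
    by (simp add: machine_time_def)
qed

lemma decides_loops:
  assumes "\<not> nonloop" and B: "length x + 1 \<le> B"
  shows "decides_within (machine_of 24 REACH) x reach (poly machine_time B) (real (2 + 24 * (log_ceil n + 2)))"
proof -
  have VB: "n + 1 \<le> B" using B length_x(2) by simp
  have wp: "ram.wp x n B (\<lambda>_. 0) REACH
      (\<lambda>\<rho> i h m. m 0 (h 0) = 1 \<longleftrightarrow> reach) (\<lambda>_. 0) 0 (\<lambda>_. 0) (\<lambda>_ _. 0)"
    by (rule wp_prefix) (use assms VB reach_loops in auto)
  show ?thesis
    using machine_of_decides[OF wp less_log_ceil _ com_ok_REACH] log_ceil_self[of n] VB
    by (simp add: machine_time_def)
qed

section \<open>Logarithmic counters and polynomial time\<close>

lemma real_log_ceil: "0 < m \<Longrightarrow> real (log_ceil m) \<le> 1 + log 2 (real m)"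
proof -
  assume m: "0 < m"
  have "real (2 ^ log_ceil m) \<le> real (2 * m)" using log_ceil_le[OF m] by (simp only: of_nat_le_iff)
  then have "log 2 (2 ^ log_ceil m) \<le> log 2 (2 * real m)"
    by (subst log_le_cancel_iff) (use m in auto)
  then show ?thesis using m by (simp add: log_mult log_nat_power)
qed

text \<open>A bound for all register values in product form: its logarithm splits into
  \<open>O(log n)\<close> and the logarithm of the tree size, which is at most the height.\<close>

definition "bound_V = 4 * (n + 3)\<^sup>2 * size1 T"

lemma bound_V: "length x + 1 \<le> bound_V" "stack_cells \<le> bound_V" "mark_cells \<le> bound_V"
proof -
  have h: "height T \<le> size T" by (rule height_le_size_tree)
  show "length x + 1 \<le> bound_V"
    by (simp add: length_x(2) bound_V_def size1_size power2_eq_square algebra_simps)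
  show "stack_cells \<le> bound_V"
    using h log_ceil_self[of n]
    by (simp add: stack_cells_def k0_def bound_V_def size1_size power2_eq_square algebra_simps)
  have "mark_cells \<le> (n + 2) * size T"
    unfolding mark_cells_def using treewidth_less h by (intro mult_le_mono) auto
  then show "mark_cells \<le> bound_V"
    by (simp add: bound_V_def size1_size power2_eq_square algebra_simps)
qed


text \<open>\<open>n + 3 \<le> 4 * n\<close> gives
  \<open>bound_V \<le> 2 ^ 6 * n * n * 2 ^ height T\<close>. The exponent 6 and the rounding up by
  \<open>log_ceil\<close> make the 7.\<close>

lemma log_ceil_bound_V: "real (log_ceil bound_V) \<le> 7 + 2 * log 2 (real n) + real (height T)"
proof -
  have n: "0 < n" using uv_less by simp
  have "real (n + 3) \<le> 4 * real n" using n by simp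
  then have "(real (n + 3))\<^sup>2 \<le> (4 * real n)\<^sup>2" by (intro power_mono) auto
  moreover have "real (size1 T) \<le> 2 ^ height T" using size1_height[of T] by (metis of_nat_le_iff of_nat_numeral of_nat_power)
  ultimately have "real bound_V \<le> (4 * (4 * real n)\<^sup>2) * 2 ^ height T"
    unfolding bound_V_def of_nat_mult of_nat_power of_nat_numeral by (intro mult_mono) auto
  also have "\<dots> = 2 ^ 6 * (real n * real n * 2 ^ height T)" by (simp add: power2_eq_square)
  finally have "log 2 (real bound_V) \<le> log 2 (2 ^ 6 * (real n * real n * 2 ^ height T))"
    by (subst log_le_cancel_iff) (use n in \<open>simp_all add: bound_V_def size1_size add_pos_nonneg\<close>)
  also have "\<dots> = 6 + (2 * log 2 (real n) + height T)"
    using n log_nat_power[of 2 2 6] by (simp add: log_mult log_nat_power)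
  finally show ?thesis using real_log_ceil[of bound_V] by (simp add: bound_V_def size1_size)
qed

lemma decides:
  assumes B: "bound_V < B" "cost T k0 \<le> B"
  shows "decides_within (machine_of 24 REACH) x reach (poly machine_time B)
    (300 * (real (treewidth T) * real (height T) + log 2 (real n) + 1))"
proof -
  have n: "0 < n" using uv_less by simp
  then have L: "0 \<le> log 2 (real n)" by simp
  have wh: "0 \<le> real (treewidth T) * real (height T)" by simp
  have k0: "real k0 \<le> 1 + log 2 (real n)" using real_log_ceil[OF n] by (simp add: k0_def)
  show ?thesis
  proof (cases nonloop)
    case True
    \<comment> \<open>With a proper edge the width is at least 1. The stack, the marks and the 24
      counters then add up to at most 29 times \<open>w * h\<close>, 49 times \<open>log 2 n\<close>
      and 219, so the constant 300 is generous.\<close>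
    then have "real (height T) \<le> real (treewidth T) * real (height T)"
      using treewidth_pos by (simp add: mult_le_cancel_right1)
    moreover have "real (stack_cells + mark_cells + 2 + 24 * (log_ceil bound_V + 2)) =
        real k0 + real (treewidth T) * real (height T) + 4 * real (height T) + 50 + 24 * real (log_ceil bound_V)"
      by (simp add: stack_cells_def mark_cells_def algebra_simps)
    ultimately have "real (stack_cells + mark_cells + 2 + 24 * (log_ceil bound_V + 2)) \<le>
        300 * (real (treewidth T) * real (height T) + log 2 (real n) + 1)"
      using k0 log_ceil_bound_V L wh by argo
    then show ?thesis using decides_nonloop[OF True bound_V B] unfolding decides_within_def by force
  next
    case False
    have "real (2 + 24 * (log_ceil n + 2)) \<le> 300 * (real (treewidth T) * real (height T) + log 2 (real n) + 1)"
      using k0 L wh unfolding k0_def of_nat_add of_nat_mult of_nat_numeral by argo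
    moreover have "length x + 1 \<le> B" using bound_V(1) B(1) by simp
    ultimately show ?thesis using decides_loops[OF False] unfolding decides_within_def by force
  qed
qed

lemma length_x_ge: "n \<le> length x" "n + 3 \<le> length x" "size1 T \<le> length x" "(n + 3) * size1 T \<le> length x"
  using uv_less by (auto simp: length_x(2) size1_size algebra_simps)

lemma bound_V_le: "bound_V \<le> 4 * (length x)\<^sup>2"
  using mult_le_mono[OF length_x_ge(2,4)] by (simp add: bound_V_def power2_eq_square algebra_simps)

text \<open>Balance enters here: \<open>4 ^ h\<close> is at most \<open>size1 T\<close> to the power
  \<open>2 * c\<close>, a polynomial whose degree depends on \<open>c\<close>. The factor
  \<open>4 ^ k0\<close> is at most \<open>4 * n * n\<close>, as
  \<open>2 ^ k0 \<le> 2 * n\<close>.\<close>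

lemma cost_bound:
  assumes "balanced c T"
  shows "cost T k0 \<le> 32 * length x ^ (nat \<lceil>2 * c\<rceil> + 2)"
proof -
  let ?d = "nat \<lceil>2 * c\<rceil>"
  have s: "1 \<le> real (size1 T)" by (simp add: size1_size)
  have "(4::real) ^ height T = 2 powr (2 * real (height T))"
    by (simp add: powr_realpow[symmetric] powr_powr[symmetric])
  also have "\<dots> \<le> 2 powr (2 * c * log 2 (real (size1 T)))"
    using assms by (auto simp: balanced_def)
  also have "\<dots> = real (size1 T) powr (2 * c)"
    using s by (simp add: powr_def log_def)
  also have "\<dots> \<le> real (size1 T) powr real ?d"
    using s by (intro powr_mono) linarith+
  also have "\<dots> = real (size1 T) ^ ?d" using s by (simp add: powr_realpow)
  finally have "(4::nat) ^ height T \<le> size1 T ^ ?d"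
    by (metis of_nat_le_iff of_nat_numeral of_nat_power)
  also have "\<dots> \<le> length x ^ ?d" using length_x_ge(3) by (rule power_mono) simp
  finally have h: "4 ^ height T \<le> length x ^ ?d" .
  have "(2 ^ k0)\<^sup>2 \<le> (2 * n)\<^sup>2" using log_ceil_le[of n] uv_less by (intro power_mono) (auto simp: k0_def)
  also have "\<dots> \<le> (2 * length x)\<^sup>2" using length_x_ge(1) by (intro power_mono) auto
  finally have "4 ^ k0 \<le> 4 * (length x)\<^sup>2"
    by (simp add: power_mult[symmetric] mult.commute[of _ 2] power_mult power_mult_distrib)
  from mult_le_mono[OF h this] have "4 ^ (height T + k0) \<le> 4 * length x ^ (?d + 2)"
    by (simp add: power_add power2_eq_square algebra_simps)
  then show ?thesis using cost_le[of T k0] by simp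
qed

end

text \<open>The machine and the space constant are chosen before \<open>c\<close>; only the time
  polynomial depends on how well the tree is balanced. The summand 1 covers \<open>n = 1\<close> and
  \<open>w = 0\<close>, where the other terms vanish although some cells are visited.\<close>

theorem theorem3:
  shows "\<exists>(M :: symbol machine) (C :: real). wf_machine M \<and>
    (\<forall>c :: real. \<exists>time :: nat poly.
      \<forall>(n :: nat) (G :: nat pair_pre_digraph) (T :: nat set tree) (h :: nat) (w :: nat) (u :: nat) (v :: nat).
        pair_wf_digraph G \<and> pverts G = {0..<n} \<and>
        tree_decomposition G T \<and> balanced c T \<and> height T = h \<and> treewidth T = w \<and>
        u \<in> pverts G \<and> v \<in> pverts G \<longrightarrow>
        decides_within M (encode n G T u v) (u \<rightarrow>\<^sup>*\<^bsub>with_proj G\<^esub> v)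
          (poly time (length (encode n G T u v)))
          (C * (real w * real h + log 2 (real n) + 1)))"
proof (rule exI[of _ "machine_of 24 REACH"], rule exI[of _ 300], intro conjI allI)
  show "wf_machine (machine_of 24 REACH)" by (rule wf_machine_of[OF com_ok_REACH])
  fix c :: real
  \<comment> \<open>The monomials dominate \<open>cost T k0\<close> and \<open>bound_V\<close>. The
    summand 1 makes the second bound strict, because counters of \<open>log_ceil V\<close> digits
    require \<open>log_ceil V + 1 \<le> B\<close>.\<close>
  define q :: "nat poly" where "q = monom 32 (nat \<lceil>2 * c\<rceil> + 2) + monom 4 2 + 1"
  show "\<exists>time :: nat poly.
      \<forall>(n :: nat) (G :: nat pair_pre_digraph) (T :: nat set tree) (h :: nat) (w :: nat) (u :: nat) (v :: nat).
        pair_wf_digraph G \<and> pverts G = {0..<n} \<and>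
        tree_decomposition G T \<and> balanced c T \<and> height T = h \<and> treewidth T = w \<and>
        u \<in> pverts G \<and> v \<in> pverts G \<longrightarrow>
        decides_within (machine_of 24 REACH) (encode n G T u v) (u \<rightarrow>\<^sup>*\<^bsub>with_proj G\<^esub> v)
          (poly time (length (encode n G T u v)))
          (300 * (real w * real h + log 2 (real n) + 1))"
  proof (intro exI[of _ "pcompose machine_time q"] allI impI, elim conjE)
    fix n h w u v :: nat and G :: "nat pair_pre_digraph" and T :: "nat set tree"
    assume *: "pair_wf_digraph G" "pverts G = {0..<n}" "tree_decomposition G T" "u \<in> pverts G" "v \<in> pverts G"
      and c: "balanced c T" and hw: "height T = h" "treewidth T = w"
    interpret reach_input n G T u v by (rule reach_input.intro) (rule *)+
    have "poly q (length x) = 32 * length x ^ (nat \<lceil>2 * c\<rceil> + 2) + 4 * (length x)\<^sup>2 + 1"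
      by (simp add: q_def poly_monom)
    then have "bound_V < poly q (length x)" "cost T k0 \<le> poly q (length x)"
      using bound_V_le cost_bound[OF c] by linarith+
    from decides[OF this] show "decides_within (machine_of 24 REACH) (encode n G T u v) (u \<rightarrow>\<^sup>*\<^bsub>with_proj G\<^esub> v)
        (poly (pcompose machine_time q) (length (encode n G T u v))) (300 * (real w * real h + log 2 (real n) + 1))"
      by (simp add: poly_pcompose reach_def x_def hw)
  qed
qed

end
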